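(* Let $(M,E)$ be a Finsler manifold with Barthel connection $\Gamma=[J,S]$. Then there exists a unique lift $D^{\star}$ of $\Gamma$ (a linear connection on $TM$) such that, for all $\zeta,\eta\in\mathfrak{X}(TM)$: (a) $D^{\star}$ is vertically metric: $D^{\star}_{J\eta}g=0$; (b) the classical torsion $T^{\star}$ of $D^{\star}$ satisfies $T^{\star}(J\zeta,J\eta)=0$; (c) $v\,T^{\star}(h\zeta,J\eta)=0$.
   Context: Setting. $M$ is an $n$-dimensional smooth manifold, $\mathcal{T}M=TM\setminus\{0\}$ is the slit tangent bundle, and all geometric objects "on $TM$" below (vector fields $\mathfrak{X}(TM)$, linear connections on $TM$, i.e. covariant derivatives of vector fields on $TM$) are considered over $\mathcal{T}M$, where they are smooth. In induced coordinates $(x^i,y^i)$ on $TM$, the almost tangent structure is the vector $1$-form $J=\frac{\partial}{\partial y^i}\otimes dx^i$ (so $J^2=0$, $\mathrm{Im}\,J=\ker J=V(TM)$, the vertical bundle), and the Liouville vector field is $C=y^i\frac{\partial}{\partial y^i}$. A Finsler manifold $(M,E)$ is $M$ with $E:TM\to\mathbb{R}$ such that $E>0$ on $\mathcal{T}M$, $E(0)=0$, $E$ is smooth on $\mathcal{T}M$ and $C^1$ on $TM$, $\mathcal{L}_CE=2E$ ($E$ positively homogeneous of degree 2), and $\Omega:=dd_JE$ has maximal rank, where $d_JE(\zeta)=dE(J\zeta)$. The canonical spray $S$ is the unique vector field with $i_S\Omega=-dE$; it satisfies $JS=C$, $[C,S]=S$. The Barthel connection is $\Gamma=[J,S]$,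 i.e. $\Gamma\zeta=[J\zeta,S]-J[\zeta,S]$; it satisfies $J\Gamma=J$, $\Gamma J=-J$. Its horizontal and vertical projectors are $h=\frac12(I+\Gamma)$ and $v=\frac12(I-\Gamma)$. The metric $g$ on $T(TM)$ is $g(\zeta,\xi)=\overline g(J\zeta,J\xi)+\overline g(v\zeta,v\xi)$, where $\overline g$ is the metric on $V(TM)$ given by $\overline g(J\zeta,J\xi)=\Omega(J\zeta,\xi)$. Lifts. A (nonlinear) connection on $M$ is a vector $1$-form $\Gamma$ on $TM$, smooth on $\mathcal{T}M$ and continuous on $TM$, with $J\Gamma=J$, $\Gamma J=-J$. A linear connection $D$ on $TM$ is regular if $DJ=0$ and the map $\varphi:V(TM)\to V(TM)$, $\zeta\mapsto D_\zeta C$, is an isomorphism; it then induces the nonlinear connection $I-2\varphi^{-1}\circ DC$ on $M$, where $DC:\zeta\mapsto D_\zeta C$. A regular $D$ with induced connection $\Gamma$ is reducible if $D\Gamma=0$. $D$ is almost-projectable if $DJ=0$ and $D_{J\eta}C=J\eta$ for all $\eta$; it projects onto $\Gamma$ if it is almost-projectable and its induced connection is $\Gamma$. A lift of $\Gamma$ is a reducible connection that projects onto $\Gamma$; thus a lift of $\Gamma$ satisfies $DJ=0$, $D_\zeta C=v\zeta$ and $D\Gamma=0$. The classical torsion of $D$ is $T(\zeta,\eta)=D_\zeta\eta-D_\eta\zeta-[\zeta,\eta]$. *)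

theory Defs
  imports "HOL-Analysis.Analysis" "HOL-Library.Function_Algebras"
begin

section \<open>Smooth functions on open subsets of Euclidean spaces\<close>

text \<open>Used for open sets only.\<close>

primrec Ck_on :: "nat \<Rightarrow> 'a::euclidean_space set \<Rightarrow> ('a \<Rightarrow> 'b::real_normed_vector) \<Rightarrow> bool" where
  "Ck_on 0 S f \<longleftrightarrow> continuous_on S f"
| "Ck_on (Suc k) S f \<longleftrightarrow>
     (\<forall>x\<in>S. f differentiable (at x)) \<and> (\<forall>u. Ck_on k S (\<lambda>x. frechet_derivative f (at x) u))"

definition smooth_on :: "'a::euclidean_space set \<Rightarrow> ('a \<Rightarrow> 'b::real_normed_vector) \<Rightarrow> bool" where
  "smooth_on S f \<longleftrightarrow> (\<forall>k. Ck_on k S f)"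

section \<open>Smooth manifolds\<close>

text \<open>A chart is a pair of its domain and its coordinate map; the values of the coordinate map
  outside the domain are irrelevant.\<close>

type_synonym ('p, 'e) chart = "'p set \<times> ('p \<Rightarrow> 'e)"
type_synonym ('p, 'e) atlas = "('p, 'e) chart set"

definition chart_inv :: "('p, 'e) chart \<Rightarrow> 'e \<Rightarrow> 'p" where
  "chart_inv c = inv_into (fst c) (snd c)"

definition chart_image :: "('p, 'e) chart \<Rightarrow> 'e set" where
  "chart_image c = snd c ` fst c"

definition carrier_of :: "('p, 'e) atlas \<Rightarrow> 'p set" where
  "carrier_of A = (\<Union>c\<in>A. fst c)"

definition smooth_manifold :: "'p topology \<Rightarrow> ('p, 'e::euclidean_space) atlas \<Rightarrow> bool" where
  "smooth_manifold M A \<longleftrightarrow>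
     Hausdorff_space M \<and> second_countable M \<and>
     topspace M = carrier_of A \<and>
     (\<forall>c\<in>A. openin M (fst c) \<and> open (chart_image c) \<and>
        homeomorphic_map (subtopology M (fst c)) (top_of_set (chart_image c)) (snd c)) \<and>
     (\<forall>c\<in>A. \<forall>c'\<in>A. smooth_on (snd c ` (fst c \<inter> fst c')) (snd c' \<circ> chart_inv c))"

section \<open>Functions, tangent vectors and vector fields relative to an atlas\<close>

text \<open>A tangent vector at \<open>p\<close> is the family of its component vectors with respect to all charts
  of the atlas around \<open>p\<close>, related by the Jacobians of the coordinate changes. The value \<open>0\<close> at all
  other charts is a convention making this family unique; it makes \<open>0\<close> the only
  element of the tangent space at a point outside the manifold.\<close>

type_synonym ('p, 'e) tvec = "('p, 'e) chart \<Rightarrow> 'e"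
type_synonym ('p, 'e) field = "'p \<Rightarrow> ('p, 'e) tvec"

definition tangent_space :: "('p, 'e::euclidean_space) atlas \<Rightarrow> 'p \<Rightarrow> ('p, 'e) tvec set" where
  "tangent_space A p = {v.
     (\<forall>c\<in>A. \<forall>c'\<in>A. p \<in> fst c \<longrightarrow> p \<in> fst c' \<longrightarrow>
        v c' = frechet_derivative (snd c' \<circ> chart_inv c) (at (snd c p)) (v c)) \<and>
     (\<forall>c. \<not> (c \<in> A \<and> p \<in> fst c) \<longrightarrow> v c = 0)}"

definition Ck_fun :: "nat \<Rightarrow> ('p, 'e::euclidean_space) atlas \<Rightarrow> ('p \<Rightarrow> real) \<Rightarrow> bool" where
  "Ck_fun k A f \<longleftrightarrow> (\<forall>c\<in>A. Ck_on k (chart_image c) (f \<circ> chart_inv c))"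

definition smooth_fun :: "('p, 'e::euclidean_space) atlas \<Rightarrow> ('p \<Rightarrow> real) \<Rightarrow> bool" where
  "smooth_fun A f \<longleftrightarrow> (\<forall>c\<in>A. smooth_on (chart_image c) (f \<circ> chart_inv c))"

definition field_in :: "('p, 'e) chart \<Rightarrow> ('p, 'e) field \<Rightarrow> 'e \<Rightarrow> 'e" where
  "field_in c X = (\<lambda>z. X (chart_inv c z) c)"

definition vector_fields :: "('p, 'e::euclidean_space) atlas \<Rightarrow> ('p, 'e) field set" where
  "vector_fields A = {X. (\<forall>p. X p \<in> tangent_space A p) \<and>
     (\<forall>c\<in>A. smooth_on (chart_image c) (field_in c X))}"

definition fscale :: "('p \<Rightarrow> real) \<Rightarrow> ('p, 'e::real_vector) field \<Rightarrow> ('p, 'e) field" where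
  "fscale f X = (\<lambda>p c. f p *\<^sub>R X p c)"

text \<open>The derivative \<open>X f = df(X)\<close> at \<open>p\<close>, computed in an arbitrary chart around \<open>p\<close>; by the
  transformation law of \<open>X p\<close> it does not depend on that chart.\<close>

definition deriv_along ::
    "('p, 'e::euclidean_space) atlas \<Rightarrow> ('p, 'e) field \<Rightarrow> ('p \<Rightarrow> real) \<Rightarrow> 'p \<Rightarrow> real" where
  "deriv_along A X f p = (let c = (SOME c. c \<in> A \<and> p \<in> fst c)
     in frechet_derivative (f \<circ> chart_inv c) (at (snd c p)) (X p c))"

definition bracket ::
    "('p, 'e::euclidean_space) atlas \<Rightarrow> ('p, 'e) field \<Rightarrow> ('p, 'e) field \<Rightarrow> ('p, 'e) field" where
  "bracket A X Y = (\<lambda>p c. if c \<in> A \<and> p \<in> fst c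
     then frechet_derivative (field_in c Y) (at (snd c p)) (X p c)
        - frechet_derivative (field_in c X) (at (snd c p)) (Y p c)
     else 0)"

text \<open>Differential forms are treated as functions of vector fields.\<close>

definition ext_deriv ::
    "('p, 'e::euclidean_space) atlas \<Rightarrow> (('p, 'e) field \<Rightarrow> 'p \<Rightarrow> real) \<Rightarrow>
     ('p, 'e) field \<Rightarrow> ('p, 'e) field \<Rightarrow> 'p \<Rightarrow> real" where
  "ext_deriv A \<theta> X Y = (\<lambda>p. deriv_along A X (\<theta> Y) p - deriv_along A Y (\<theta> X) p - \<theta> (bracket A X Y) p)"

text \<open>Nondegeneracy of a 2-form at every point: the value of the form at \<open>p\<close> depends only on the
  values of its arguments at \<open>p\<close>, and every tangent vector at \<open>p\<close> is the value of a global field.\<close>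

definition maximal_rank ::
    "('p, 'e::euclidean_space) atlas \<Rightarrow> (('p, 'e) field \<Rightarrow> ('p, 'e) field \<Rightarrow> 'p \<Rightarrow> real) \<Rightarrow> bool" where
  "maximal_rank A \<omega> \<longleftrightarrow> (\<forall>p\<in>carrier_of A. \<forall>X\<in>vector_fields A.
     (\<forall>Y\<in>vector_fields A. \<omega> X Y p = 0) \<longrightarrow> X p = 0)"

section \<open>Linear connections\<close>

text \<open>Connections are only meant to be applied to vector fields; requiring the value \<open>0\<close> on all other
  arguments makes equality of connections coincide with equality of functions.\<close>

type_synonym ('p, 'e) conn = "('p, 'e) field \<Rightarrow> ('p, 'e) field \<Rightarrow> ('p, 'e) field"

definition linear_connection :: "('p, 'e::euclidean_space) atlas \<Rightarrow> ('p, 'e) conn \<Rightarrow> bool" where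
  "linear_connection A D \<longleftrightarrow>
     (\<forall>X\<in>vector_fields A. \<forall>Y\<in>vector_fields A. D X Y \<in> vector_fields A) \<and>
     (\<forall>X Y. X \<notin> vector_fields A \<or> Y \<notin> vector_fields A \<longrightarrow> D X Y = 0) \<and>
     (\<forall>X\<in>vector_fields A. \<forall>X'\<in>vector_fields A. \<forall>Y\<in>vector_fields A.
        D (X + X') Y = D X Y + D X' Y) \<and>
     (\<forall>f. \<forall>X\<in>vector_fields A. \<forall>Y\<in>vector_fields A. smooth_fun A f \<longrightarrow>
        D (fscale f X) Y = fscale f (D X Y)) \<and>
     (\<forall>X\<in>vector_fields A. \<forall>Y\<in>vector_fields A. \<forall>Y'\<in>vector_fields A.
        D X (Y + Y') = D X Y + D X Y') \<and>
     (\<forall>f. \<forall>X\<in>vector_fields A. \<forall>Y\<in>vector_fields A. smooth_fun A f \<longrightarrow>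
        D X (fscale f Y) = fscale (deriv_along A X f) Y + fscale f (D X Y))"

definition torsion :: "('p, 'e::euclidean_space) atlas \<Rightarrow> ('p, 'e) conn \<Rightarrow> ('p, 'e) conn" where
  "torsion A D X Y = D X Y - D Y X - bracket A X Y"

definition cov_deriv_endo ::
    "('p, 'e::euclidean_space) conn \<Rightarrow> ('p, 'e) field \<Rightarrow> (('p, 'e) field \<Rightarrow> ('p, 'e) field) \<Rightarrow>
     ('p, 'e) field \<Rightarrow> ('p, 'e) field" where
  "cov_deriv_endo D X K Y = D X (K Y) - K (D X Y)"

definition cov_deriv_form ::
    "('p, 'e::euclidean_space) atlas \<Rightarrow> ('p, 'e) conn \<Rightarrow> ('p, 'e) field \<Rightarrow>
     (('p, 'e) field \<Rightarrow> ('p, 'e) field \<Rightarrow> 'p \<Rightarrow> real) \<Rightarrow>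
     ('p, 'e) field \<Rightarrow> ('p, 'e) field \<Rightarrow> 'p \<Rightarrow> real" where
  "cov_deriv_form A D X b Y Z = (\<lambda>p. deriv_along A X (b Y Z) p - b (D X Y) Z p - b Y (D X Z) p)"

definition parallel_endo ::
    "('p, 'e::euclidean_space) atlas \<Rightarrow> ('p, 'e) conn \<Rightarrow> (('p, 'e) field \<Rightarrow> ('p, 'e) field) \<Rightarrow> bool" where
  "parallel_endo A D K \<longleftrightarrow>
     (\<forall>X\<in>vector_fields A. \<forall>Y\<in>vector_fields A. cov_deriv_endo D X K Y = 0)"

section \<open>The tangent bundle and the slit tangent bundle\<close>

type_synonym ('p, 'e) tpoint = "'p \<times> ('p, 'e) tvec"
type_synonym ('p, 'e) tfield = "(('p, 'e) tpoint, 'e \<times> 'e) field"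
type_synonym ('p, 'e) tconn = "(('p, 'e) tpoint, 'e \<times> 'e) conn"

text \<open>The induced coordinates \<open>(x, y)\<close>.\<close>

definition induced_chart ::
    "('p, 'e::euclidean_space) atlas \<Rightarrow> ('p, 'e) chart \<Rightarrow> (('p, 'e) tpoint, 'e \<times> 'e) chart" where
  "induced_chart A c =
     ({(p, v). p \<in> fst c \<and> v \<in> tangent_space A p}, \<lambda>(p, v). (snd c p, v c))"

definition tangent_atlas ::
    "('p, 'e::euclidean_space) atlas \<Rightarrow> (('p, 'e) tpoint, 'e \<times> 'e) atlas" where
  "tangent_atlas A = induced_chart A ` A"

definition slit_atlas ::
    "('p, 'e::euclidean_space) atlas \<Rightarrow> (('p, 'e) tpoint, 'e \<times> 'e) atlas" where
  "slit_atlas A = (\<lambda>d. (fst d \<inter> {q. snd q \<noteq> 0}, snd d)) ` tangent_atlas A"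

abbreviation slit_fields :: "('p, 'e::euclidean_space) atlas \<Rightarrow> ('p, 'e) tfield set" where
  "slit_fields A \<equiv> vector_fields (slit_atlas A)"

text \<open>All charts of the two atlases above are induced ones, so \<open>J = \<partial>/\<partial>y\<^sup>i \<otimes> dx\<^sup>i\<close> maps components
  \<open>(a, b)\<close> to \<open>(0, a)\<close> in each of them, and \<open>C = y\<^sup>i \<partial>/\<partial>y\<^sup>i\<close> has components \<open>(0, y)\<close>. The atlas
  argument of \<open>liouville\<close> is one of these two.\<close>

definition J :: "('p, 'e::euclidean_space) tfield \<Rightarrow> ('p, 'e) tfield" where
  "J X = (\<lambda>q d. (0, fst (X q d)))"

definition liouville ::
    "(('p, 'e::euclidean_space) tpoint, 'e \<times> 'e) atlas \<Rightarrow> ('p, 'e) tfield" where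
  "liouville B = (\<lambda>q d. if d \<in> B \<and> q \<in> fst d then (0, snd (snd d q)) else 0)"

definition vertical_fields :: "('p, 'e::euclidean_space) atlas \<Rightarrow> ('p, 'e) tfield set" where
  "vertical_fields A = {X \<in> slit_fields A. J X = 0}"

section \<open>Finsler manifolds\<close>

definition dJ ::
    "('p, 'e::euclidean_space) atlas \<Rightarrow> (('p, 'e) tpoint \<Rightarrow> real) \<Rightarrow> ('p, 'e) tfield \<Rightarrow>
     ('p, 'e) tpoint \<Rightarrow> real" where
  "dJ A E X = deriv_along (slit_atlas A) (J X) E"

definition Omega ::
    "('p, 'e::euclidean_space) atlas \<Rightarrow> (('p, 'e) tpoint \<Rightarrow> real) \<Rightarrow>
     ('p, 'e) tfield \<Rightarrow> ('p, 'e) tfield \<Rightarrow> ('p, 'e) tpoint \<Rightarrow> real" where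
  "Omega A E = ext_deriv (slit_atlas A) (dJ A E)"

definition finsler_manifold ::
    "'p topology \<Rightarrow> ('p, 'e::euclidean_space) atlas \<Rightarrow> (('p, 'e) tpoint \<Rightarrow> real) \<Rightarrow> bool" where
  "finsler_manifold M A E \<longleftrightarrow>
     smooth_manifold M A \<and>
     (\<forall>q\<in>carrier_of (slit_atlas A). E q > 0) \<and>
     (\<forall>p\<in>carrier_of A. E (p, 0) = 0) \<and>
     smooth_fun (slit_atlas A) E \<and>
     Ck_fun 1 (tangent_atlas A) E \<and>
     (\<forall>q\<in>carrier_of (tangent_atlas A).
        deriv_along (tangent_atlas A) (liouville (tangent_atlas A)) E q = 2 * E q) \<and>
     maximal_rank (slit_atlas A) (Omega A E)"

definition canonical_spray ::
    "('p, 'e::euclidean_space) atlas \<Rightarrow> (('p, 'e) tpoint \<Rightarrow> real) \<Rightarrow> ('p, 'e) tfield" where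
  "canonical_spray A E = (THE S. S \<in> slit_fields A \<and>
     (\<forall>Y\<in>slit_fields A. \<forall>q\<in>carrier_of (slit_atlas A).
        Omega A E S Y q = - deriv_along (slit_atlas A) Y E q))"

definition barthel ::
    "('p, 'e::euclidean_space) atlas \<Rightarrow> (('p, 'e) tpoint \<Rightarrow> real) \<Rightarrow> ('p, 'e) tfield \<Rightarrow> ('p, 'e) tfield" where
  "barthel A E X =
     bracket (slit_atlas A) (J X) (canonical_spray A E)
       - J (bracket (slit_atlas A) X (canonical_spray A E))"

definition hor :: "(('p, 'e::euclidean_space) tfield \<Rightarrow> ('p, 'e) tfield) \<Rightarrow> ('p, 'e) tfield \<Rightarrow> ('p, 'e) tfield" where
  "hor \<Gamma> X = fscale (\<lambda>_. 1/2) (X + \<Gamma> X)"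

definition ver :: "(('p, 'e::euclidean_space) tfield \<Rightarrow> ('p, 'e) tfield) \<Rightarrow> ('p, 'e) tfield \<Rightarrow> ('p, 'e) tfield" where
  "ver \<Gamma> X = fscale (\<lambda>_. 1/2) (X - \<Gamma> X)"

text \<open>The metric on vertical fields given by \<open>(V, J \<xi>) \<mapsto> \<Omega>(V, \<xi>)\<close>; the result does not depend on the
  choice of \<open>\<xi>\<close>, as \<open>\<Omega>\<close> vanishes on pairs of vertical fields.\<close>

definition vertical_metric ::
    "('p, 'e::euclidean_space) atlas \<Rightarrow> (('p, 'e) tpoint \<Rightarrow> real) \<Rightarrow>
     ('p, 'e) tfield \<Rightarrow> ('p, 'e) tfield \<Rightarrow> ('p, 'e) tpoint \<Rightarrow> real" where
  "vertical_metric A E V W = Omega A E V (SOME \<xi>. \<xi> \<in> slit_fields A \<and> J \<xi> = W)"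

definition finsler_metric ::
    "('p, 'e::euclidean_space) atlas \<Rightarrow> (('p, 'e) tpoint \<Rightarrow> real) \<Rightarrow>
     ('p, 'e) tfield \<Rightarrow> ('p, 'e) tfield \<Rightarrow> ('p, 'e) tpoint \<Rightarrow> real" where
  "finsler_metric A E X Y = (\<lambda>q.
     vertical_metric A E (J X) (J Y) q
       + vertical_metric A E (ver (barthel A E) X) (ver (barthel A E) Y) q)"

section \<open>Lifts of nonlinear connections\<close>

definition DC ::
    "('p, 'e::euclidean_space) atlas \<Rightarrow> ('p, 'e) tconn \<Rightarrow> ('p, 'e) tfield \<Rightarrow> ('p, 'e) tfield" where
  "DC A D X = D X (liouville (slit_atlas A))"

text \<open>The bundle map \<open>\<phi>\<close> on the vertical bundle is given by the restriction of \<open>DC\<close> to vertical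
  fields. As this map is linear over the smooth functions, it is bijective on fields
  if and only if \<open>\<phi>\<close> is an isomorphism of vector bundles.\<close>

definition regular_connection :: "('p, 'e::euclidean_space) atlas \<Rightarrow> ('p, 'e) tconn \<Rightarrow> bool" where
  "regular_connection A D \<longleftrightarrow>
     linear_connection (slit_atlas A) D \<and>
     parallel_endo (slit_atlas A) D J \<and>
     bij_betw (DC A D) (vertical_fields A) (vertical_fields A)"

definition induced_connection ::
    "('p, 'e::euclidean_space) atlas \<Rightarrow> ('p, 'e) tconn \<Rightarrow> ('p, 'e) tfield \<Rightarrow> ('p, 'e) tfield" where
  "induced_connection A D X =
     X - fscale (\<lambda>_. 2) (inv_into (vertical_fields A) (DC A D) (DC A D X))"

definition reducible_connection :: "('p, 'e::euclidean_space) atlas \<Rightarrow> ('p, 'e) tconn \<Rightarrow> bool" where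
  "reducible_connection A D \<longleftrightarrow>
     regular_connection A D \<and> parallel_endo (slit_atlas A) D (induced_connection A D)"

definition almost_projectable :: "('p, 'e::euclidean_space) atlas \<Rightarrow> ('p, 'e) tconn \<Rightarrow> bool" where
  "almost_projectable A D \<longleftrightarrow>
     linear_connection (slit_atlas A) D \<and>
     parallel_endo (slit_atlas A) D J \<and>
     (\<forall>X\<in>slit_fields A. DC A D (J X) = J X)"

definition projects_onto ::
    "('p, 'e::euclidean_space) atlas \<Rightarrow> ('p, 'e) tconn \<Rightarrow> (('p, 'e) tfield \<Rightarrow> ('p, 'e) tfield) \<Rightarrow> bool" where
  "projects_onto A D \<Gamma> \<longleftrightarrow>
     almost_projectable A D \<and> (\<forall>X\<in>slit_fields A. induced_connection A D X = \<Gamma> X)"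

definition is_lift ::
    "('p, 'e::euclidean_space) atlas \<Rightarrow> (('p, 'e) tfield \<Rightarrow> ('p, 'e) tfield) \<Rightarrow> ('p, 'e) tconn \<Rightarrow> bool" where
  "is_lift A \<Gamma> D \<longleftrightarrow> reducible_connection A D \<and> projects_onto A D \<Gamma>"

definition vertically_metric ::
    "('p, 'e::euclidean_space) atlas \<Rightarrow> (('p, 'e) tpoint \<Rightarrow> real) \<Rightarrow> ('p, 'e) tconn \<Rightarrow> bool" where
  "vertically_metric A E D \<longleftrightarrow>
     (\<forall>X\<in>slit_fields A. \<forall>Y\<in>slit_fields A. \<forall>Z\<in>slit_fields A. \<forall>q\<in>carrier_of (slit_atlas A).
        cov_deriv_form (slit_atlas A) D (J X) (finsler_metric A E) Y Z q = 0)"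

end

theory Submission
  imports Defs
begin

text \<open>Let \<open>h\<close> and \<open>v\<close> be the horizontal and vertical projectors. A lift \<open>D\<close> commutes with \<open>J\<close>, \<open>h\<close>
  and \<open>v\<close>, so it is determined by its values on vertical fields \<open>V\<close>. Condition (c) forces
  \<open>D\<^bsub>h X\<^esub> V = v [h X, V]\<close>, and by (a) and (b) the restriction of \<open>D\<close> to vertical directions and
  vertical fields is the Levi-Civita connection of the vertical metric, given by the Koszul formula.
  Conversely these two formulas define a connection on the vertical bundle; transporting it to the
  horizontal bundle by \<open>V \<mapsto> h [V, S]\<close>, the inverse of \<open>J\<close>, gives \<open>D\<close>. That \<open>D C = v\<close> comes from
  homogeneity: \<open>[C, S] = S\<close> yields \<open>[C, h X] = h [C, X]\<close>, and \<open>\<L>\<^bsub>C\<^esub> \<Omega> = \<Omega>\<close> makes the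
  Koszul formula return \<open>V\<close> for \<open>D\<^bsub>V\<^esub> C\<close>.

  The arguments are coordinate-free: a vector field is determined by its action on smooth functions, and
  a \<open>1\<close>-form is represented by a field through the nondegenerate \<open>\<Omega>\<close>. Both facts, and the existence
  of enough global fields, rest on bump functions pulled back from \<open>M\<close>.\<close>

section \<open>Calculus of smooth functions\<close>

text \<open>Forms and connections act here on global fields, so a statement about one point must be
  reached through tensoriality: a field cut off by a bump stands in for a tangent vector. The
  demanding half of duality is that the representing field is smooth. Cramer's rule shows this in
  each chart, and nondegeneracy at each point glues the local solutions.

  The bumps on the slit bundle can be constant along fibres because its chart domains contain whole
  slit fibres: only the base point can leave a chart.

  Apart from chart calculus, the geometry rests on three identities: \<open>br_J_J\<close>
  (\<open>J\<close> is integrable), \<open>br_C_J\<close> (\<open>J\<close> has weight -1 under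
  \<open>C\<close>) and \<open>J_br_spray\<close> (bracketing with \<open>S\<close> inverts
  \<open>J\<close> up to vertical terms). The first makes \<Omega>(J X, Y) symmetric, hence a metric
  on vertical fields, and makes vertical fields closed under brackets, so that the Koszul formula
  makes sense on them. The second, with the weight +1 of \<open>S\<close>, makes \<Gamma> = [J, S]
  invariant under \<open>C\<close>.\<close>

abbreviation fd :: "('a::real_normed_vector \<Rightarrow> 'b::real_normed_vector) \<Rightarrow> 'a \<Rightarrow> 'a \<Rightarrow> 'b" where
  "fd f x \<equiv> frechet_derivative f (at x)"

lemma Ck_on_subset: "Ck_on k S f \<Longrightarrow> T \<subseteq> S \<Longrightarrow> Ck_on k T f"
  by (induction k arbitrary: f) (auto intro: continuous_on_subset)

text \<open>Differentiation sees only germs, so the induction passes to derivatives on the same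
  neighbourhoods. Objects defined by cases or extended by zero get their smoothness from
  this.\<close>

lemma Ck_on_local:
  assumes "\<And>x. x \<in> S \<Longrightarrow> \<exists>N g. open N \<and> x \<in> N \<and> Ck_on k N g \<and> (\<forall>y\<in>N. f y = g y)"
  shows "Ck_on k S f"
  using assms
proof (induction k arbitrary: f)
  case 0
  have "isCont f x" if x: "x \<in> S" for x
  proof -
    obtain N g where N: "open N" "x \<in> N" "continuous_on N g" "\<forall>y\<in>N. f y = g y"
      using 0[OF x] unfolding Ck_on.simps by blast
    then have "isCont g x" by (simp add: continuous_on_eq_continuous_at)
    moreover have "\<forall>\<^sub>F y in nhds x. f y = g y"
      using N eventually_nhds by blast
    ultimately show ?thesis using isCont_cong by blast
  qed
  then show ?case by (simp add: continuous_at_imp_continuous_on)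
next
  case (Suc k)
  have "f differentiable (at x)" if x: "x \<in> S" for x
  proof -
    obtain N g where N: "open N" "x \<in> N" "g differentiable (at x)" "\<forall>y\<in>N. f y = g y"
      using Suc.prems[OF x] unfolding Ck_on.simps by blast
    then show ?thesis
      by (metis differentiable_def has_derivative_transform_within_open)
  qed
  moreover have "Ck_on k S (\<lambda>x. fd f x u)" for u
  proof (rule Suc.IH)
    fix x assume "x \<in> S"
    then obtain N g where N: "open N" "x \<in> N" "Ck_on (Suc k) N g" "\<forall>y\<in>N. f y = g y"
      using Suc.prems by blast
    then have "\<forall>y\<in>N. fd f y u = fd g y u"
      by (metis Ck_on.simps(2) frechet_derivative_transform_within_open)
    then show "\<exists>N h. open N \<and> x \<in> N \<and> Ck_on k N h \<and> (\<forall>y\<in>N. fd f y u = h y)"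
      using N by (intro exI[of _ N] exI[of _ "\<lambda>y. fd g y u"]) auto
  qed
  ultimately show ?case by simp
qed

lemma Ck_on_cong:
  assumes "open S" "Ck_on k S g" "\<And>y. y \<in> S \<Longrightarrow> f y = g y"
  shows "Ck_on k S f"
  using assms by (intro Ck_on_local) blast

lemma Ck_on_Suc_imp: "Ck_on (Suc k) S f \<Longrightarrow> Ck_on k S f"
proof (induction k arbitrary: f)
  case 0
  then show ?case
    by (auto intro!: continuous_at_imp_continuous_on differentiable_imp_continuous_within)
qed auto

text \<open>Any explicit derivative may replace the one picked by \<open>frechet_derivative\<close>,
  since derivatives are unique.\<close>

lemma Ck_on_SucI:
  assumes "open S" "\<And>x. x \<in> S \<Longrightarrow> (f has_derivative f' x) (at x)"
    "\<And>u. Ck_on k S (\<lambda>x. f' x u)"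
  shows "Ck_on (Suc k) S f"
proof -
  have "fd f x u = f' x u" if "x \<in> S" for x u
    using assms(2)[OF that] frechet_derivative_at by metis
  then show ?thesis
    using assms by (auto simp: differentiable_def intro!: Ck_on_cong[OF assms(1) assms(3)])
qed

lemma Ck_on_derivative:
  assumes "Ck_on (Suc k) S f" "x \<in> S"
  shows "(f has_derivative fd f x) (at x)"
  using assms frechet_derivative_works by auto

lemma Ck_on_const: "Ck_on k S (\<lambda>x. c)"
  by (induction k arbitrary: c) auto

lemma Ck_on_bounded_linear:
  assumes L: "bounded_linear L" and S: "open S"
  shows "Ck_on k S f \<Longrightarrow> Ck_on k S (\<lambda>x. L (f x))"
proof (induction k arbitrary: f)
  case 0
  then show ?case using bounded_linear.continuous_on[OF L] by simp
next
  case (Suc k)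
  show ?case
    by (rule Ck_on_SucI[OF S bounded_linear.has_derivative[OF L Ck_on_derivative[OF Suc.prems]]])
       (use Suc in auto)
qed

lemma Ck_on_add:
  assumes S: "open S"
  shows "Ck_on k S f \<Longrightarrow> Ck_on k S g \<Longrightarrow> Ck_on k S (\<lambda>x. f x + g x)"
proof (induction k arbitrary: f g)
  case 0
  then show ?case by (simp add: continuous_on_add)
next
  case (Suc k)
  show ?case
    by (rule Ck_on_SucI[OF S has_derivative_add[OF Ck_on_derivative[OF Suc.prems(1)]
          Ck_on_derivative[OF Suc.prems(2)]]]) (use Suc in auto)
qed

lemma Ck_on_sum:
  assumes S: "open S"
  shows "(\<And>i. i \<in> I \<Longrightarrow> Ck_on k S (f i)) \<Longrightarrow> Ck_on k S (\<lambda>x. \<Sum>i\<in>I. f i x)"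
  by (induction I rule: infinite_finite_induct) (auto intro!: Ck_on_add S Ck_on_const)

lemma Ck_on_bilinear:
  assumes P: "bounded_bilinear P" and S: "open S"
  shows "Ck_on k S f \<Longrightarrow> Ck_on k S g \<Longrightarrow> Ck_on k S (\<lambda>x. P (f x) (g x))"
proof (induction k arbitrary: f g)
  case 0
  then show ?case using bounded_bilinear.continuous_on[OF P] by simp
next
  case (Suc k)
  show ?case
    by (rule Ck_on_SucI[OF S bounded_bilinear.FDERIV[OF P Ck_on_derivative[OF Suc.prems(1)]
          Ck_on_derivative[OF Suc.prems(2)]]])
       (use Suc.prems Suc.IH in \<open>auto intro!: Ck_on_add[OF S] Suc.IH dest: Ck_on_Suc_imp simp del: Ck_on.simps(2)\<close>,
        use Suc.prems in auto)
qed

text \<open>\<open>Ck_on\<close> controls derivatives only in constant directions. A derivative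
  taken in a varying direction is turned by this expansion into a sum of products of controlled
  functions.\<close>

lemma linear_expand_Basis:
  fixes L :: "'a::euclidean_space \<Rightarrow> 'b::real_vector"
  assumes "linear L"
  shows "L v = (\<Sum>b\<in>Basis. (v \<bullet> b) *\<^sub>R L b)"
  by (metis (no_types, lifting) assms euclidean_representation linear_scale linear_sum sum.cong)

lemma Ck_on_compose:
  fixes f :: "'a::euclidean_space \<Rightarrow> 'b::euclidean_space"
  assumes S: "open S"
  shows "Ck_on k T g \<Longrightarrow> Ck_on k S f \<Longrightarrow> f ` S \<subseteq> T \<Longrightarrow> Ck_on k S (\<lambda>x. g (f x))"
proof (induction k arbitrary: g)
  case 0
  then show ?case using continuous_on_compose2 by auto
next
  case (Suc k)
  have d: "((\<lambda>x. g (f x)) has_derivative (\<lambda>u. fd g (f x) (fd f x u))) (at x)" if "x \<in> S" for x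
    using diff_chain_at[OF Ck_on_derivative[OF Suc.prems(2) that] Ck_on_derivative[OF Suc.prems(1)], of]
      that Suc.prems(3) by (auto simp: o_def image_subset_iff)
  have e: "fd g (f x) (fd f x u) = (\<Sum>b\<in>Basis. (fd f x u \<bullet> b) *\<^sub>R fd g (f x) b)" if "x \<in> S" for x u
    by (rule linear_expand_Basis, rule linear_frechet_derivative) (use Suc.prems that in auto)
  show ?case
  proof (rule Ck_on_SucI[OF S d])
    fix u
    have "Ck_on k S (\<lambda>x. \<Sum>b\<in>Basis. (fd f x u \<bullet> b) *\<^sub>R fd g (f x) b)"
    proof (intro Ck_on_sum[OF S] Ck_on_bilinear[OF bounded_bilinear_scaleR S])
      fix b
      show "Ck_on k S (\<lambda>x. fd f x u \<bullet> b)"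
        by (rule Ck_on_bounded_linear[OF bounded_linear_inner_left S]) (use Suc.prems in auto)
      show "Ck_on k S (\<lambda>x. fd g (f x) b)"
        by (rule Suc.IH) (use Suc.prems Ck_on_Suc_imp[OF Suc.prems(2)] in auto)
    qed
    then show "Ck_on k S (\<lambda>x. fd g (f x) (fd f x u))"
      by (rule Ck_on_cong[OF S]) (use e in auto)
  qed auto
qed

text \<open>The derivative of 1/f is a product of 1/f, the derivative of \<open>f\<close> and 1/f
  again, so the induction hypothesis for 1/f closes the step.\<close>

lemma Ck_on_inverse:
  fixes f :: "'a::euclidean_space \<Rightarrow> real"
  assumes S: "open S" and nz: "\<And>x. x \<in> S \<Longrightarrow> f x \<noteq> 0"
  shows "Ck_on k S f \<Longrightarrow> Ck_on k S (\<lambda>x. inverse (f x))"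
proof (induction k)
  case 0
  then show ?case using nz by (auto intro!: continuous_on_inverse)
next
  case (Suc k)
  have 1: "Ck_on k S (\<lambda>x. inverse (f x))" using Suc Ck_on_Suc_imp by blast
  show ?case
    by (rule Ck_on_SucI[OF S Deriv.has_derivative_inverse[OF nz Ck_on_derivative[OF Suc.prems]]])
       (use Suc.prems 1 in \<open>auto intro!: Ck_on_bilinear[OF bounded_bilinear_mult S]
          Ck_on_bounded_linear[OF bounded_linear_minus[OF bounded_linear_ident] S]\<close>)
qed

lemma Ck_on_ident: "Ck_on k S (\<lambda>x. x)"
  by (cases k) (auto simp: Ck_on_const)

section \<open>Passage from class C^k to smooth functions\<close>

lemma smooth_on_subset: "smooth_on S f \<Longrightarrow> T \<subseteq> S \<Longrightarrow> smooth_on T f"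
  unfolding smooth_on_def using Ck_on_subset by blast

lemma smooth_on_local:
  assumes "\<And>x. x \<in> S \<Longrightarrow> \<exists>N g. open N \<and> x \<in> N \<and> smooth_on N g \<and> (\<forall>y\<in>N. f y = g y)"
  shows "smooth_on S f"
  using assms unfolding smooth_on_def by (metis Ck_on_local)

lemma smooth_on_cong:
  assumes "open S" "smooth_on S g" "\<And>y. y \<in> S \<Longrightarrow> f y = g y"
  shows "smooth_on S f"
  using assms by (intro smooth_on_local) blast

lemma smooth_on_differentiable: "smooth_on S f \<Longrightarrow> x \<in> S \<Longrightarrow> f differentiable (at x)"
  unfolding smooth_on_def by (metis Ck_on.simps(2))

lemma smooth_on_derivative: "smooth_on S f \<Longrightarrow> x \<in> S \<Longrightarrow> (f has_derivative fd f x) (at x)"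
  using smooth_on_differentiable frechet_derivative_works by blast

lemma smooth_on_continuous: "smooth_on S f \<Longrightarrow> continuous_on S f"
  unfolding smooth_on_def by (metis Ck_on.simps(1))

lemma smooth_on_fd: "smooth_on S f \<Longrightarrow> smooth_on S (\<lambda>x. fd f x u)"
  unfolding smooth_on_def by (metis Ck_on.simps(2))

lemma smooth_on_const: "smooth_on S (\<lambda>x. c)"
  by (simp add: smooth_on_def Ck_on_const)

lemma smooth_on_ident: "smooth_on S (\<lambda>x. x)"
  by (simp add: smooth_on_def Ck_on_ident)

lemma smooth_on_bounded_linear:
  "bounded_linear L \<Longrightarrow> open S \<Longrightarrow> smooth_on S f \<Longrightarrow> smooth_on S (\<lambda>x. L (f x))"
  by (simp add: smooth_on_def Ck_on_bounded_linear)

lemma smooth_on_add: "open S \<Longrightarrow> smooth_on S f \<Longrightarrow> smooth_on S g \<Longrightarrow> smooth_on S (\<lambda>x. f x + g x)"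
  by (simp add: smooth_on_def Ck_on_add)

lemma smooth_on_minus: "open S \<Longrightarrow> smooth_on S f \<Longrightarrow> smooth_on S (\<lambda>x. - f x)"
  by (rule smooth_on_bounded_linear[OF bounded_linear_minus[OF bounded_linear_ident]])

lemma smooth_on_diff: "open S \<Longrightarrow> smooth_on S f \<Longrightarrow> smooth_on S g \<Longrightarrow> smooth_on S (\<lambda>x. f x - g x)"
  using smooth_on_add[of S f "\<lambda>x. - g x"] smooth_on_minus by auto

lemma smooth_on_sum:
  "open S \<Longrightarrow> (\<And>i. i \<in> I \<Longrightarrow> smooth_on S (f i)) \<Longrightarrow> smooth_on S (\<lambda>x. \<Sum>i\<in>I. f i x)"
  by (simp add: smooth_on_def Ck_on_sum)

lemma smooth_on_bilinear:
  "bounded_bilinear P \<Longrightarrow> open S \<Longrightarrow> smooth_on S f \<Longrightarrow> smooth_on S g \<Longrightarrow> smooth_on S (\<lambda>x. P (f x) (g x))"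
  by (simp add: smooth_on_def Ck_on_bilinear)

lemmas smooth_on_scaleR = smooth_on_bilinear[OF bounded_bilinear_scaleR]
lemmas smooth_on_mult = smooth_on_bilinear[OF bounded_bilinear_mult]
lemmas smooth_on_inner = smooth_on_bilinear[OF bounded_bilinear_inner]

lemma smooth_on_prod:
  fixes f :: "'i \<Rightarrow> 'a::euclidean_space \<Rightarrow> real"
  shows "open S \<Longrightarrow> (\<And>i. i \<in> I \<Longrightarrow> smooth_on S (f i)) \<Longrightarrow> smooth_on S (\<lambda>x. \<Prod>i\<in>I. f i x)"
  by (induction I rule: infinite_finite_induct) (auto intro!: smooth_on_mult smooth_on_const)

lemma smooth_on_compose:
  fixes f :: "'a::euclidean_space \<Rightarrow> 'b::euclidean_space"
  shows "open S \<Longrightarrow> smooth_on T g \<Longrightarrow> smooth_on S f \<Longrightarrow> f ` S \<subseteq> T \<Longrightarrow> smooth_on S (\<lambda>x. g (f x))"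
  unfolding smooth_on_def by (blast intro: Ck_on_compose)

lemma smooth_on_inverse:
  fixes f :: "'a::euclidean_space \<Rightarrow> real"
  shows "open S \<Longrightarrow> smooth_on S f \<Longrightarrow> (\<And>x. x \<in> S \<Longrightarrow> f x \<noteq> 0) \<Longrightarrow> smooth_on S (\<lambda>x. inverse (f x))"
  by (simp add: smooth_on_def Ck_on_inverse)

lemma smooth_on_divide:
  fixes f :: "'a::euclidean_space \<Rightarrow> real"
  shows "open S \<Longrightarrow> smooth_on S f \<Longrightarrow> smooth_on S g \<Longrightarrow> (\<And>x. x \<in> S \<Longrightarrow> g x \<noteq> 0) \<Longrightarrow>
    smooth_on S (\<lambda>x. f x / g x)"
  by (simp add: divide_inverse smooth_on_mult smooth_on_inverse)

lemma smooth_on_Pair: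
  fixes f :: "'a::euclidean_space \<Rightarrow> 'b::real_normed_vector" and g :: "'a \<Rightarrow> 'c::real_normed_vector"
  assumes "open S" "smooth_on S f" "smooth_on S g"
  shows "smooth_on S (\<lambda>x. (f x, g x))"
proof -
  have "smooth_on S (\<lambda>x. (f x, 0) + (0, g x))"
    using assms by (intro smooth_on_add smooth_on_bounded_linear[of "\<lambda>y. (y, 0)"]
        smooth_on_bounded_linear[of "\<lambda>y. (0, y)"] bounded_linear_Pair bounded_linear_ident bounded_linear_zero)
  then show ?thesis by simp
qed

lemmas smooth_on_fst = smooth_on_bounded_linear[OF bounded_linear_fst]
lemmas smooth_on_snd = smooth_on_bounded_linear[OF bounded_linear_snd]

lemma smooth_on_fd_apply:
  fixes f :: "'a::euclidean_space \<Rightarrow> 'b::real_normed_vector"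
  assumes "open S" "smooth_on S f" "smooth_on S w"
  shows "smooth_on S (\<lambda>x. fd f x (w x))"
proof -
  have "smooth_on S (\<lambda>x. \<Sum>b\<in>Basis. (w x \<bullet> b) *\<^sub>R fd f x b)"
    using assms by (intro smooth_on_sum smooth_on_scaleR smooth_on_inner smooth_on_const smooth_on_fd)
  then show ?thesis
    by (rule smooth_on_cong[OF assms(1)])
      (rule linear_expand_Basis[OF linear_frechet_derivative[OF smooth_on_differentiable[OF assms(2)]]])
qed

text \<open>Differentiability is not assumed: both sides choose from the same set of candidate
  derivatives.\<close>

lemma fd_eq_local:
  assumes "open N" "x \<in> N" "\<And>y. y \<in> N \<Longrightarrow> f y = g y"
  shows "fd f x = fd g x"
proof -
  have "(f has_derivative f') (at x) \<longleftrightarrow> (g has_derivative f') (at x)" for f'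
    using assms has_derivative_transform_within_open[of _ f' x UNIV N] by (metis )
  then show ?thesis by (simp add: frechet_derivative_def)
qed

subsection \<open>Symmetry of second derivatives\<close>

text \<open>The mean value theorem is applied once in direction \<open>u\<close> and once in
  direction \<open>v\<close>. The second difference is symmetric in \<open>u\<close> and
  \<open>v\<close>, while the order of differentiation on the right is not.\<close>

lemma second_difference_mvt:
  fixes f :: "'a::euclidean_space \<Rightarrow> real"
  assumes f: "Ck_on 2 (ball x r) f" and s: "0 < s" "s * (norm u + norm v) < r"
  obtains a b where "0 < a" "a < s" "0 < b" "b < s"
    "f (x + s *\<^sub>R u + s *\<^sub>R v) - f (x + s *\<^sub>R u) - f (x + s *\<^sub>R v) + f x
      = s\<^sup>2 * fd (\<lambda>z. fd f z u) (x + a *\<^sub>R u + b *\<^sub>R v) v"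
proof -
  have inb: "x + a *\<^sub>R u + b *\<^sub>R v \<in> ball x r" if "0 \<le> a" "a \<le> s" "0 \<le> b" "b \<le> s" for a b
  proof -
    have "norm (a *\<^sub>R u + b *\<^sub>R v) \<le> a * norm u + b * norm v"
      using that norm_triangle_ineq[of "a *\<^sub>R u" "b *\<^sub>R v"] by simp
    also have "\<dots> \<le> s * norm u + s * norm v"
      using that by (intro add_mono mult_right_mono) auto
    finally show ?thesis using s by (simp add: dist_norm algebra_simps norm_minus_commute)
  qed
  have d1: "(f has_derivative fd f z) (at z)" if "z \<in> ball x r" for z
    using f that by (intro Ck_on_derivative[of 1]) (auto simp: numeral_2_eq_2)
  have d2: "((\<lambda>z. fd f z u) has_derivative fd (\<lambda>z. fd f z u) z) (at z)" if "z \<in> ball x r" for z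
    using f[unfolded numeral_2_eq_2 Ck_on.simps(2)[of "Suc 0"]] that
    by (intro Ck_on_derivative[of 0 "ball x r"]) blast+
  \<comment> \<open>The term with factor 0 is kept so that both summands are instances of one
    differentiation rule, at c = s and c = 0.\<close>
  define F where "F a = f (x + a *\<^sub>R u + s *\<^sub>R v) - f (x + a *\<^sub>R u + 0 *\<^sub>R v)" for a
  have F: "(F has_real_derivative
      fd f (x + a *\<^sub>R u + s *\<^sub>R v) u - fd f (x + a *\<^sub>R u + 0 *\<^sub>R v) u) (at a)"
    if a: "0 \<le> a" "a \<le> s" for a
  proof -
    have "((\<lambda>a. f (x + a *\<^sub>R u + c *\<^sub>R v)) has_real_derivative fd f (x + a *\<^sub>R u + c *\<^sub>R v) u) (at a)"
      if c: "0 \<le> c" "c \<le> s" for c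
    proof -
      have "((\<lambda>a. x + a *\<^sub>R u + c *\<^sub>R v) has_derivative (\<lambda>h. h *\<^sub>R u)) (at a)"
        by (auto intro!: derivative_eq_intros)
      from diff_chain_at[OF this d1[OF inb[OF a c]]]
      have "((\<lambda>a. f (x + a *\<^sub>R u + c *\<^sub>R v)) has_derivative (\<lambda>h. fd f (x + a *\<^sub>R u + c *\<^sub>R v) (h *\<^sub>R u))) (at a)"
        by (simp add: o_def)
      moreover have "linear (fd f (x + a *\<^sub>R u + c *\<^sub>R v))"
        using d1[OF inb[OF a c]] has_derivative_linear by blast
      ultimately show ?thesis
        by (simp add: has_field_derivative_def linear_scale mult.commute[of _ "fd _ _ _"])
    qed
    from DERIV_diff[OF this[of s] this[of 0]] show ?thesis
      using s unfolding F_def by auto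
  qed
  obtain a where a: "0 < a" "a < s" and
    Fa: "F s - F 0 = (s - 0) * (fd f (x + a *\<^sub>R u + s *\<^sub>R v) u - fd f (x + a *\<^sub>R u + 0 *\<^sub>R v) u)"
    using MVT2[OF s(1) F] by auto
  define G where "G b = fd f (x + a *\<^sub>R u + b *\<^sub>R v) u" for b
  have G: "(G has_real_derivative fd (\<lambda>z. fd f z u) (x + a *\<^sub>R u + b *\<^sub>R v) v) (at b)"
    if b: "0 \<le> b" "b \<le> s" for b
  proof -
    have ab: "x + a *\<^sub>R u + b *\<^sub>R v \<in> ball x r" using a b by (intro inb) auto
    have "((\<lambda>b. x + a *\<^sub>R u + b *\<^sub>R v) has_derivative (\<lambda>h. h *\<^sub>R v)) (at b)"
      by (auto intro!: derivative_eq_intros)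
    from diff_chain_at[OF this d2[OF ab]]
    have "(G has_derivative (\<lambda>h. fd (\<lambda>z. fd f z u) (x + a *\<^sub>R u + b *\<^sub>R v) (h *\<^sub>R v))) (at b)"
      by (simp add: o_def G_def[abs_def])
    moreover have "linear (fd (\<lambda>z. fd f z u) (x + a *\<^sub>R u + b *\<^sub>R v))"
      using d2[OF ab] has_derivative_linear by blast
    ultimately show ?thesis
      by (simp add: has_field_derivative_def linear_scale mult.commute[of _ "fd _ _ _"])
  qed
  obtain b where b: "0 < b" "b < s" and
    Gb: "G s - G 0 = (s - 0) * fd (\<lambda>z. fd f z u) (x + a *\<^sub>R u + b *\<^sub>R v) v"
    using MVT2[OF s(1) G] by auto
  show thesis
    by (rule that[OF a b]) (use Fa Gb in \<open>simp add: F_def G_def power2_eq_square\<close>)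
qed

text \<open>Both mixed derivatives, at points close to \<open>x\<close>, equal the same second
  difference divided by s^2; continuity at \<open>x\<close> then forces equality.\<close>

lemma second_derivative_symmetric:
  fixes f :: "'a::euclidean_space \<Rightarrow> real"
  assumes "open S" "x \<in> S" "Ck_on 2 S f"
  shows "fd (\<lambda>z. fd f z u) x v = fd (\<lambda>z. fd f z v) x u"
proof (rule ccontr)
  let ?P = "\<lambda>z. fd (\<lambda>z. fd f z u) z v" and ?Q = "\<lambda>z. fd (\<lambda>z. fd f z v) z u"
  assume ne: "?P x \<noteq> ?Q x"
  \<comment> \<open>Half the gap: a common value cannot lie within \<open>e\<close> of both
    \<open>?P x\<close> and \<open>?Q x\<close>.\<close>
  define e where "e = \<bar>?P x - ?Q x\<bar> / 2"
  have "e > 0" using ne by (simp add: e_def)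
  have "continuous_on S ?P" "continuous_on S ?Q"
    using assms(3) by (auto simp: numeral_2_eq_2)
  then have "isCont ?P x" "isCont ?Q x"
    using assms by (simp_all add: continuous_on_eq_continuous_at)
  then obtain d1 d2 where "d1 > 0" "d2 > 0"
    and P: "\<And>z. dist z x < d1 \<Longrightarrow> dist (?P z) (?P x) < e"
    and Q: "\<And>z. dist z x < d2 \<Longrightarrow> dist (?Q z) (?Q x) < e"
    using \<open>e > 0\<close> unfolding continuous_at_eps_delta by metis
  obtain r0 where "r0 > 0" "ball x r0 \<subseteq> S" using assms open_contains_ball by blast
  define r where "r = min r0 (min d1 d2)"
  have r: "r > 0" "r \<le> d1" "r \<le> d2" "Ck_on 2 (ball x r) f"
    using \<open>r0 > 0\<close> \<open>d1 > 0\<close> \<open>d2 > 0\<close> \<open>ball x r0 \<subseteq> S\<close> assms(3)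
    by (auto simp: r_def intro!: Ck_on_subset[of 2 S])
  \<comment> \<open>Small enough that the parallelogram spanned by s u and s v stays in the ball;
    the summand 1 avoids division by zero when both vectors vanish.\<close>
  define s where "s = r / (2 * (norm u + norm v + 1))"
  have s0: "s > 0" using r by (simp add: s_def add_nonneg_pos)
  have "s * (norm u + norm v) < s * (2 * (norm u + norm v + 1))"
    using s0 by (intro mult_strict_left_mono) (smt (verit) norm_ge_zero)+
  also have "\<dots> = r" by (simp add: s_def) (smt (verit) norm_ge_zero)
  finally have s: "s * (norm u + norm v) < r" "s * (norm v + norm u) < r" by (simp_all add: add.commute)
  have inb: "dist (x + a *\<^sub>R u + b *\<^sub>R v) x < r" if "0 < a" "a < s" "0 < b" "b < s" for a b
  proof -
    have "norm (a *\<^sub>R u + b *\<^sub>R v) \<le> a * norm u + b * norm v"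
      using that norm_triangle_ineq[of "a *\<^sub>R u" "b *\<^sub>R v"] by simp
    also have "\<dots> \<le> s * norm u + s * norm v"
      using that by (intro add_mono mult_right_mono) auto
    finally show ?thesis using s by (simp add: dist_norm algebra_simps)
  qed
  obtain a b where ab: "0 < a" "a < s" "0 < b" "b < s" and 1:
    "f (x + s *\<^sub>R u + s *\<^sub>R v) - f (x + s *\<^sub>R u) - f (x + s *\<^sub>R v) + f x = s\<^sup>2 * ?P (x + a *\<^sub>R u + b *\<^sub>R v)"
    using second_difference_mvt[OF r(4) s0 s(1)] .
  obtain a' b' where ab': "0 < a'" "a' < s" "0 < b'" "b' < s" and 2:
    "f (x + s *\<^sub>R v + s *\<^sub>R u) - f (x + s *\<^sub>R v) - f (x + s *\<^sub>R u) + f x = s\<^sup>2 * ?Q (x + a' *\<^sub>R v + b' *\<^sub>R u)"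
    using second_difference_mvt[OF r(4) s0 s(2)] .
  have "s\<^sup>2 * ?P (x + a *\<^sub>R u + b *\<^sub>R v) = s\<^sup>2 * ?Q (x + a' *\<^sub>R v + b' *\<^sub>R u)"
    using 1 2 by (simp add: algebra_simps)
  then have "?P (x + a *\<^sub>R u + b *\<^sub>R v) = ?Q (x + b' *\<^sub>R u + a' *\<^sub>R v)"
    using s0 by (simp add: add.assoc add.commute[of "a' *\<^sub>R v"])
  moreover have "dist (?P (x + a *\<^sub>R u + b *\<^sub>R v)) (?P x) < e" using inb[OF ab] r by (intro P) auto
  moreover have "dist (?Q (x + b' *\<^sub>R u + a' *\<^sub>R v)) (?Q x) < e"
    using inb[OF ab'(3,4,1,2)] r by (intro Q) auto
  ultimately show False by (auto simp: e_def dist_real_def abs_if split: if_splits)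
qed

subsection \<open>Bump functions\<close>

text \<open>The powers of 1/t are included because the derivative of exp(-1/t) produces them: the
  linear span of this family is closed under differentiation.\<close>

definition flat :: "nat \<Rightarrow> real \<Rightarrow> real" where
  "flat n t = (if t > 0 then inverse t ^ n * exp (- inverse t) else 0)"

lemma flat_limit: "((flat n) \<longlongrightarrow> 0) (at_right 0)"
proof -
  have "((\<lambda>t::real. inverse t ^ n * exp (- inverse t)) \<longlongrightarrow> 0) (at_right 0)"
    using filterlim_compose[OF tendsto_power_div_exp_0[of n] filterlim_inverse_at_top_right]
    by (simp add: exp_minus divide_inverse)
  then show ?thesis
    by (rule Lim_transform_eventually) (auto simp: flat_def eventually_at_right_less intro: eventually_mono[OF eventually_at_right_less[of 0]])
qed

lemma flat_derivative: "(flat n has_real_derivative (flat (n + 2) t - of_nat n * flat (n + 1) t)) (at t)"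
proof -
  consider "t > 0" | "t < 0" | "t = 0" by linarith
  then show ?thesis
  proof cases
    case 1
    have "((\<lambda>t. inverse t ^ n * exp (- inverse t)) has_real_derivative
       (flat (n + 2) t - of_nat n * flat (n + 1) t)) (at t)"
    proof (cases n)
      case 0
      have "((\<lambda>t. exp (- inverse t)) has_real_derivative exp (- inverse t) * inverse t ^ 2) (at t)"
        using 1 by (auto intro!: derivative_eq_intros simp: power2_eq_square)
      then show ?thesis using 0 1 by (simp add: flat_def mult.commute power2_eq_square)
    next
      case (Suc k)
      have i: "(inverse has_real_derivative - (inverse t * inverse t)) (at t)"
        using 1 by (auto intro!: derivative_eq_intros)
      have "((\<lambda>t. inverse t ^ Suc k * exp (- inverse t)) has_real_derivative
        (1 + real k) * (- (inverse t * inverse t) * inverse t ^ k) * exp (- inverse t) +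
        exp (- inverse t) * - (- (inverse t * inverse t)) * inverse t ^ Suc k) (at t)"
        by (rule DERIV_mult[OF DERIV_power_Suc[OF i] DERIV_fun_exp[OF DERIV_minus[OF i]]])
      moreover have "(1 + real k) * (- (inverse t * inverse t) * inverse t ^ k) * exp (- inverse t) +
        exp (- inverse t) * - (- (inverse t * inverse t)) * inverse t ^ Suc k =
        flat (n + 2) t - of_nat n * flat (n + 1) t"
        using 1 Suc by (simp add: flat_def algebra_simps)
      ultimately show ?thesis using Suc by simp
    qed
    then show ?thesis
      by (rule has_field_derivative_transform_within_open[where S = "{0<..}"]) (use 1 in \<open>auto simp: flat_def\<close>)
  next
    case 2
    have "((\<lambda>t. 0) has_real_derivative (flat (n + 2) t - of_nat n * flat (n + 1) t)) (at t)"
      using 2 by (auto simp: flat_def)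
    then show ?thesis
      by (rule has_field_derivative_transform_within_open[where S = "{..<0}"]) (use 2 in \<open>auto simp: flat_def\<close>)
  next
    case 3
    \<comment> \<open>For positive \<open>y\<close> the difference quotient at 0 is
      \<open>flat (Suc n) y\<close>, so differentiability at 0 is again
      \<open>flat_limit\<close>.\<close>
    have "((\<lambda>y. flat n y / y) \<longlongrightarrow> 0) (at_right 0)"
      by (rule Lim_transform_eventually[OF flat_limit[of "Suc n"]])
        (auto simp: flat_def field_simps intro: eventually_mono[OF eventually_at_right_less[of 0]])
    moreover have "((\<lambda>y. flat n y / y) \<longlongrightarrow> 0) (at_left 0)"
      by (rule Lim_transform_eventually[OF tendsto_const])
        (auto simp: flat_def eventually_at_filter)
    ultimately have "((\<lambda>y. flat n y / y) \<longlongrightarrow> 0) (at 0)"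
      using filterlim_split_at by blast
    then show ?thesis using 3 by (simp add: has_field_derivative_iff flat_def)
  qed
qed

lemma smooth_on_flat: "smooth_on UNIV (flat n)"
proof -
  have "Ck_on k UNIV (flat n)" for k
  proof (induction k arbitrary: n)
    case 0
    then show ?case
      using DERIV_isCont[OF flat_derivative] by (simp add: continuous_at_imp_continuous_on)
  next
    case (Suc k)
    show ?case
      by (rule Ck_on_SucI[OF _ flat_derivative[unfolded has_field_derivative_def]])
        (auto simp: diff_conv_add_uminus simp del: add_uminus_conv_diff intro!: Suc Ck_on_const Ck_on_add Ck_on_bilinear[OF bounded_bilinear_mult]
          Ck_on_bounded_linear[OF bounded_linear_minus[OF bounded_linear_ident]])
  qed
  then show ?thesis by (simp add: smooth_on_def)
qed

lemma smooth_bump: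
  fixes a :: "'a::euclidean_space"
  assumes "0 < r"
  obtains b :: "'a \<Rightarrow> real" where "smooth_on UNIV b" "\<And>x. x \<notin> cball a r \<Longrightarrow> b x = 0"
    "\<And>x. x \<in> ball a (r/2) \<Longrightarrow> b x = 1"
proof -
  \<comment> \<open>The squared distance, unlike the distance, is smooth at \<open>a\<close> as
    well.\<close>
  define \<rho> :: "'a \<Rightarrow> real" where "\<rho> x = (x - a) \<bullet> (x - a)" for x
  have \<rho>: "\<rho> x = (dist a x)\<^sup>2" for x by (simp add: \<rho>_def dist_norm power2_norm_eq_inner inner_diff inner_commute)
  \<comment> \<open>The numerator vanishes outside radius r and the second summand of the
    denominator inside radius r/2. They never vanish together, so the quotient is smooth.\<close>
  define b where "b x = flat 0 (r\<^sup>2 - \<rho> x) / (flat 0 (r\<^sup>2 - \<rho> x) + flat 0 (\<rho> x - (r/2)\<^sup>2))" for x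
  have s\<rho>: "smooth_on UNIV \<rho>"
    unfolding \<rho>_def[abs_def] by (intro smooth_on_inner smooth_on_diff smooth_on_ident smooth_on_const open_UNIV)
  have 1: "smooth_on UNIV (\<lambda>x. flat 0 (r\<^sup>2 - \<rho> x))" "smooth_on UNIV (\<lambda>x. flat 0 (\<rho> x - (r/2)\<^sup>2))"
    by (rule smooth_on_compose[OF _ smooth_on_flat];
        intro smooth_on_diff smooth_on_const s\<rho> open_UNIV subset_UNIV)+
  have pos: "flat 0 (r\<^sup>2 - \<rho> x) + flat 0 (\<rho> x - (r/2)\<^sup>2) > 0" for x
  proof (cases "\<rho> x < r\<^sup>2")
    case False
    then have "\<rho> x - (r/2)\<^sup>2 > 0" using assms by (simp add: power_divide) (smt (verit) zero_less_power)
    then show ?thesis using False by (simp add: flat_def)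
  qed (simp add: flat_def add_pos_nonneg)
  show thesis
  proof
    show "smooth_on UNIV b"
      unfolding b_def[abs_def] using pos
      by (intro smooth_on_divide smooth_on_add open_UNIV 1) (metis less_irrefl)
    show "b x = 0" if "x \<notin> cball a r" for x
    proof -
      have "\<rho> x > r\<^sup>2" unfolding \<rho> using that assms by (intro power_strict_mono) auto
      then show ?thesis by (simp add: b_def flat_def)
    qed
    show "b x = 1" if "x \<in> ball a (r/2)" for x
    proof -
      have "\<rho> x < (r/2)\<^sup>2" unfolding \<rho> using that assms by (intro power_strict_mono) auto
      then show ?thesis using pos[of x] by (simp add: b_def flat_def)
    qed
  qed
qed

subsection \<open>Cramer's rule with smooth coefficients\<close>

text \<open>Cramer's rule writes the solution as a quotient of determinants, which are polynomials
  in the coefficients; smooth dependence on \<open>z\<close> is then immediate.\<close>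

lemma smooth_linear_system:
  fixes G :: "'e::euclidean_space \<Rightarrow> 'm::finite \<Rightarrow> 'm \<Rightarrow> real" and w :: "'e \<Rightarrow> 'm \<Rightarrow> real"
  assumes S: "open S" and G: "\<And>i j. smooth_on S (\<lambda>z. G z i j)" and w: "\<And>j. smooth_on S (\<lambda>z. w z j)"
    and inj: "\<And>z x. z \<in> S \<Longrightarrow> (\<And>j. (\<Sum>i\<in>UNIV. x i * G z i j) = 0) \<Longrightarrow> x = (\<lambda>_. 0)"
  obtains u where "\<And>i. smooth_on S (\<lambda>z. u z i)"
    "\<And>z j. z \<in> S \<Longrightarrow> (\<Sum>i\<in>UNIV. u z i * G z i j) = w z j"
proof -
  \<comment> \<open>The indices are exchanged because the unknowns are paired with the first slot of
    \<open>G\<close>.\<close>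
  define A :: "'e \<Rightarrow> real^'m^'m" where "A z = (\<chi> j i. G z i j)" for z
  define B :: "'e \<Rightarrow> real^'m" where "B z = (\<chi> j. w z j)" for z
  define u where "u z k = det (\<chi> i j. if j = k then B z $ i else A z $ i $ j) / det (A z)" for z k
  have nz: "det (A z) \<noteq> 0" if "z \<in> S" for z
  proof -
    have "x = 0" if "A z *v x = 0" for x
    proof -
      have "(\<Sum>i\<in>UNIV. x $ i * G z i j) = 0" for j
        using arg_cong[OF that, of "\<lambda>y. y $ j"] by (simp add: matrix_vector_mult_def A_def mult.commute)
      from inj[OF \<open>z \<in> S\<close> this] show "x = 0" by (auto simp: vec_eq_iff dest: fun_cong)
    qed
    then show ?thesis
      by (metis invertible_det_nz invertible_left_inverse matrix_left_invertible_ker)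
  qed
  have sdet: "smooth_on S (\<lambda>z. det (M z))" if "\<And>i j. smooth_on S (\<lambda>z. M z $ i $ j)" for M :: "'e \<Rightarrow> real^'m^'m"
    unfolding det_def by (intro smooth_on_sum smooth_on_mult smooth_on_const smooth_on_prod S that)
  show thesis
  proof
    fix k
    have "smooth_on S (\<lambda>z. (\<chi> i j. if j = k then B z $ i else A z $ i $ j) $ i $ j)" for i j
      using G w by (cases "j = k") (simp_all add: A_def B_def)
    then show "smooth_on S (\<lambda>z. u z k)"
      unfolding u_def using nz G by (intro smooth_on_divide sdet S) (auto simp: A_def)
  next
    fix z j assume z: "z \<in> S"
    have "A z *v (\<chi> k. u z k) = B z"
      unfolding u_def using cramer[OF nz[OF z]] by blast
    from arg_cong[OF this, of "\<lambda>y. y $ j"] show "(\<Sum>i\<in>UNIV. u z i * G z i j) = w z j"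
      by (simp add: matrix_vector_mult_def A_def B_def mult.commute)
  qed
qed

section \<open>Vector fields on manifolds with bump functions\<close>

text \<open>The last clause says that the support is closed in the whole manifold. It is phrased
  through charts because the slit bundle is given by an atlas and not as a topological space.
  Compact support would be the wrong demand: the bumps used there are constant along fibres.\<close>

definition bump_at ::
    "('p, 'e::euclidean_space) atlas \<Rightarrow> ('p, 'e) chart \<Rightarrow> 'e set \<Rightarrow> ('p \<Rightarrow> real) \<Rightarrow> bool" where
  "bump_at B d N f \<longleftrightarrow> open N \<and> N \<subseteq> chart_image d \<and> (\<forall>z\<in>N. f (chart_inv d z) = 1) \<and>
     smooth_on (chart_image d) (f \<circ> chart_inv d) \<and>
     (\<forall>c\<in>B. \<forall>z\<in>chart_image c. chart_inv c z \<notin> fst d \<longrightarrow>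
        (\<exists>O'. open O' \<and> z \<in> O' \<and> O' \<subseteq> chart_image c \<and> (\<forall>y\<in>O'. f (chart_inv c y) = 0)))"

definition ext_fun :: "('p, 'e) chart \<Rightarrow> ('p \<Rightarrow> real) \<Rightarrow> ('e \<Rightarrow> real) \<Rightarrow> 'p \<Rightarrow> real" where
  "ext_fun d f w q = (if q \<in> fst d then f q * w (snd d q) else 0)"

definition trans_deriv :: "('p, 'e::euclidean_space) chart \<Rightarrow> ('p, 'e) chart \<Rightarrow> 'p \<Rightarrow> 'e \<Rightarrow> 'e" where
  "trans_deriv d c q = fd (snd c \<circ> chart_inv d) (snd d q)"

definition ext_field ::
    "('p, 'e::euclidean_space) atlas \<Rightarrow> ('p, 'e) chart \<Rightarrow> ('p \<Rightarrow> real) \<Rightarrow> ('e \<Rightarrow> 'e) \<Rightarrow> ('p, 'e) field" where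
  "ext_field B d f w q c = (if q \<in> fst d \<and> c \<in> B \<and> q \<in> fst c
     then f q *\<^sub>R trans_deriv d c q (w (snd d q)) else 0)"

lemma fscale_add_fun: "fscale (\<lambda>q. f q + g q) X = fscale f X + fscale g X"
  by (simp add: fscale_def fun_eq_iff scaleR_add_left)

lemma fscale_add: "fscale f (X + Y) = fscale f X + fscale f Y"
  by (simp add: fscale_def fun_eq_iff scaleR_add_right)

lemma fscale_diff: "fscale f (X - Y) = fscale f X - fscale f Y"
  by (simp add: fscale_def fun_eq_iff scaleR_diff_right)

lemma fscale_zero: "fscale f 0 = 0"
  by (simp add: fscale_def fun_eq_iff)

lemma fscale_commute: "fscale f (fscale g X) = fscale g (fscale f X)"
  by (simp add: fscale_def fun_eq_iff)

text \<open>Both the base manifold and its slit tangent bundle are instances, so fields, brackets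
  and 1-forms are treated once. The Hausdorff property enters through
  \<open>bump_exists\<close>.\<close>

locale bump_atlas =
  fixes B :: "('p, 'e::euclidean_space) atlas"
  assumes chart_inj: "d \<in> B \<Longrightarrow> inj_on (snd d) (fst d)"
    and open_image: "d \<in> B \<Longrightarrow> open (chart_image d)"
    and open_overlap: "d \<in> B \<Longrightarrow> c \<in> B \<Longrightarrow> open (snd d ` (fst d \<inter> fst c))"
    and smooth_trans: "d \<in> B \<Longrightarrow> c \<in> B \<Longrightarrow> smooth_on (snd d ` (fst d \<inter> fst c)) (snd c \<circ> chart_inv d)"
    and bump_exists: "d \<in> B \<Longrightarrow> q \<in> fst d \<Longrightarrow> \<exists>N f. snd d q \<in> N \<and> bump_at B d N f"
begin

abbreviation "Q \<equiv> carrier_of B"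
abbreviation "VF \<equiv> vector_fields B"
abbreviation "sm \<equiv> smooth_fun B"
abbreviation "dv \<equiv> deriv_along B"
abbreviation "br \<equiv> bracket B"

section \<open>Charts, coordinate changes and tangent vectors\<close>

lemma chart_inv_left [simp]: "d \<in> B \<Longrightarrow> q \<in> fst d \<Longrightarrow> chart_inv d (snd d q) = q"
  unfolding chart_inv_def by (simp add: chart_inj)

lemma chart_inv_right [simp]: "z \<in> chart_image d \<Longrightarrow> snd d (chart_inv d z) = z"
  unfolding chart_inv_def chart_image_def by (rule f_inv_into_f)

lemma chart_inv_in [simp]: "z \<in> chart_image d \<Longrightarrow> chart_inv d z \<in> fst d"
  unfolding chart_inv_def chart_image_def by (rule inv_into_into)

lemma chart_in_image [simp]: "q \<in> fst d \<Longrightarrow> snd d q \<in> chart_image d"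
  unfolding chart_image_def by blast

lemma overlap_iff: "d \<in> B \<Longrightarrow> z \<in> snd d ` (fst d \<inter> fst c) \<longleftrightarrow> z \<in> chart_image d \<and> chart_inv d z \<in> fst c"
  by (auto simp: chart_image_def)

lemma carrier_iff: "q \<in> Q \<longleftrightarrow> (\<exists>d\<in>B. q \<in> fst d)"
  by (auto simp: carrier_of_def)

lemma chart_inv_carrier [simp]: "d \<in> B \<Longrightarrow> z \<in> chart_image d \<Longrightarrow> chart_inv d z \<in> Q"
  unfolding carrier_iff by (rule bexI[of _ d], rule chart_inv_in)

lemma trans_derivative:
  assumes "d \<in> B" "c \<in> B" "q \<in> fst d" "q \<in> fst c"
  shows "((snd c \<circ> chart_inv d) has_derivative trans_deriv d c q) (at (snd d q))"
  unfolding trans_deriv_def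
  by (rule smooth_on_derivative[OF smooth_trans]) (use assms in auto)

lemma trans_deriv_linear:
  assumes "d \<in> B" "c \<in> B" "q \<in> fst d" "q \<in> fst c"
  shows "linear (trans_deriv d c q)"
  using trans_derivative[OF assms] by (rule has_derivative_linear)

lemma fd_change_chart:
  assumes d: "d \<in> B" and c: "c \<in> B" and q: "q \<in> fst d" "q \<in> fst c"
    and F: "((F \<circ> chart_inv c) has_derivative F') (at (snd c q))"
  shows "((F \<circ> chart_inv d) has_derivative (\<lambda>v. F' (trans_deriv d c q v))) (at (snd d q))"
proof -
  let ?O = "snd d ` (fst d \<inter> fst c)"
  have "((F \<circ> chart_inv c) has_derivative F') (at ((snd c \<circ> chart_inv d) (snd d q)))"
    using F d q by simp
  from diff_chain_at[OF trans_derivative[OF d c q] this]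
  have "((F \<circ> chart_inv c \<circ> (snd c \<circ> chart_inv d)) has_derivative (\<lambda>v. F' (trans_deriv d c q v))) (at (snd d q))"
    by (simp add: o_def)
  then show ?thesis
    by (rule has_derivative_transform_within_open[of _ _ _ _ ?O])
      (use d c q open_overlap in \<open>auto simp: overlap_iff\<close>)
qed

lemma trans_deriv_self: "d \<in> B \<Longrightarrow> q \<in> fst d \<Longrightarrow> trans_deriv d d q v = v"
proof -
  assume d: "d \<in> B" "q \<in> fst d"
  have "((snd d \<circ> chart_inv d) has_derivative (\<lambda>v. v)) (at (snd d q))"
    by (rule has_derivative_transform_within_open[OF has_derivative_ident, of "chart_image d"])
      (use d open_image in auto)
  then show ?thesis
    using frechet_derivative_at unfolding trans_deriv_def by metis
qed

lemma trans_deriv_comp: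
  assumes "d \<in> B" "c \<in> B" "b \<in> B" "q \<in> fst d" "q \<in> fst c" "q \<in> fst b"
  shows "trans_deriv c b q (trans_deriv d c q v) = trans_deriv d b q v"
proof -
  have "((snd b \<circ> chart_inv d) has_derivative (\<lambda>v. trans_deriv c b q (trans_deriv d c q v))) (at (snd d q))"
    by (rule fd_change_chart[OF _ _ _ _ trans_derivative]) (use assms in auto)
  then show ?thesis
    using frechet_derivative_at unfolding trans_deriv_def by metis
qed

lemma tangent_space_iff: "v \<in> tangent_space B q \<longleftrightarrow>
   (\<forall>d\<in>B. \<forall>c\<in>B. q \<in> fst d \<longrightarrow> q \<in> fst c \<longrightarrow> v c = trans_deriv d c q (v d)) \<and>
   (\<forall>c. \<not> (c \<in> B \<and> q \<in> fst c) \<longrightarrow> v c = 0)"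
  by (simp add: tangent_space_def trans_deriv_def)

lemma tangent_trans:
  "v \<in> tangent_space B q \<Longrightarrow> d \<in> B \<Longrightarrow> c \<in> B \<Longrightarrow> q \<in> fst d \<Longrightarrow> q \<in> fst c \<Longrightarrow> v c = trans_deriv d c q (v d)"
  unfolding tangent_space_iff by blast

lemma tangent_eqI:
  assumes "v \<in> tangent_space B q" "w \<in> tangent_space B q" "d \<in> B" "q \<in> fst d" "v d = w d"
  shows "v = w"
  using assms unfolding tangent_space_iff fun_eq_iff by metis

lemma vf_tangent: "X \<in> VF \<Longrightarrow> X q \<in> tangent_space B q"
  by (simp add: vector_fields_def)

lemma vf_trans: "X \<in> VF \<Longrightarrow> d \<in> B \<Longrightarrow> c \<in> B \<Longrightarrow> q \<in> fst d \<Longrightarrow> q \<in> fst c \<Longrightarrow>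
    X q c = trans_deriv d c q (X q d)"
  using vf_tangent[of X q] unfolding tangent_space_iff by blast

lemma vf_outside: "X \<in> VF \<Longrightarrow> \<not> (c \<in> B \<and> q \<in> fst c) \<Longrightarrow> X q c = 0"
  using vf_tangent[of X q] unfolding tangent_space_iff by blast

lemma vf_outside_carrier: "X \<in> VF \<Longrightarrow> q \<notin> Q \<Longrightarrow> X q = 0"
  using vf_outside[of X _ q] unfolding carrier_iff by (auto simp: fun_eq_iff)

lemma vf_point_eqI:
  "X \<in> VF \<Longrightarrow> Y \<in> VF \<Longrightarrow> d \<in> B \<Longrightarrow> q \<in> fst d \<Longrightarrow> X q d = Y q d \<Longrightarrow> X q = Y q"
  using tangent_eqI vf_tangent by blast

lemma vf_eqI: "X \<in> VF \<Longrightarrow> Y \<in> VF \<Longrightarrow> (\<And>q. q \<in> Q \<Longrightarrow> X q = Y q) \<Longrightarrow> X = Y"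
  using vf_outside_carrier by (metis ext)

lemma vf_smooth: "X \<in> VF \<Longrightarrow> d \<in> B \<Longrightarrow> smooth_on (chart_image d) (field_in d X)"
  by (simp add: vector_fields_def)

lemma vfI:
  assumes "\<And>q. X q \<in> tangent_space B q" "\<And>d. d \<in> B \<Longrightarrow> smooth_on (chart_image d) (field_in d X)"
  shows "X \<in> VF"
  using assms by (simp add: vector_fields_def)

lemma smI: "(\<And>d. d \<in> B \<Longrightarrow> smooth_on (chart_image d) (f \<circ> chart_inv d)) \<Longrightarrow> sm f"
  by (simp add: smooth_fun_def)

lemma smD: "sm f \<Longrightarrow> d \<in> B \<Longrightarrow> smooth_on (chart_image d) (f \<circ> chart_inv d)"
  by (simp add: smooth_fun_def)

lemma smooth_change_chart:
  assumes "d \<in> B" "c \<in> B" "smooth_on (chart_image d) G"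
  shows "smooth_on (snd c ` (fst c \<inter> fst d)) (\<lambda>y. G (snd d (chart_inv c y)))"
proof -
  have "(snd d \<circ> chart_inv c) ` snd c ` (fst c \<inter> fst d) \<subseteq> chart_image d"
    using assms by auto
  from smooth_on_compose[OF open_overlap assms(3) smooth_trans this] assms(1,2)
  show ?thesis by (simp add: o_def)
qed

subsection \<open>Extension by zero\<close>

lemma bump_sm:
  assumes d: "d \<in> B" and f: "bump_at B d N f"
  shows "smooth_on (chart_image d) (f \<circ> chart_inv d)"
  using f by (simp add: bump_at_def)

text \<open>Near a point of the domain of \<open>d\<close> this is a product of smooth functions in
  changed coordinates; near any other point the bump is zero.\<close>

lemma sm_ext_fun:
  assumes d: "d \<in> B" and f: "bump_at B d N f" and w: "smooth_on (chart_image d) w"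
  shows "sm (ext_fun d f w)"
proof (rule smI, rule smooth_on_local)
  fix c z assume c: "c \<in> B" and z: "z \<in> chart_image c"
  let ?O = "snd c ` (fst c \<inter> fst d)"
  show "\<exists>O' g. open O' \<and> z \<in> O' \<and> smooth_on O' g \<and> (\<forall>y\<in>O'. (ext_fun d f w \<circ> chart_inv c) y = g y)"
  proof (cases "chart_inv c z \<in> fst d")
    case True
    let ?g = "\<lambda>y. (f \<circ> chart_inv d) (snd d (chart_inv c y)) * w (snd d (chart_inv c y))"
    have "smooth_on ?O ?g"
      by (intro smooth_on_mult open_overlap c d smooth_change_chart bump_sm[OF d f] w)
    moreover have "\<forall>y\<in>?O. (ext_fun d f w \<circ> chart_inv c) y = ?g y"
      using c d by (auto simp: overlap_iff ext_fun_def)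
    ultimately show ?thesis
      using True z c d by (intro exI[of _ ?O] exI[of _ ?g] conjI open_overlap) (auto simp: overlap_iff)
  next
    case False
    then obtain O' where "open O'" "z \<in> O'" "\<forall>y\<in>O'. f (chart_inv c y) = 0"
      using f c z unfolding bump_at_def by meson
    then show ?thesis
      by (intro exI[of _ O'] exI[of _ "\<lambda>_. 0"]) (auto simp: ext_fun_def smooth_on_const)
  qed
qed

lemma vf_ext_field:
  assumes d: "d \<in> B" and f: "bump_at B d N f" and w: "smooth_on (chart_image d) w"
  shows "ext_field B d f w \<in> VF"
proof (rule vfI)
  fix q show "ext_field B d f w q \<in> tangent_space B q"
    unfolding tangent_space_iff ext_field_def
    using d by (auto simp: trans_deriv_comp linear_scale[OF trans_deriv_linear] linear_0[OF trans_deriv_linear])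
next
  fix c assume c: "c \<in> B"
  let ?O = "snd c ` (fst c \<inter> fst d)" and ?P = "snd d ` (fst d \<inter> fst c)"
  show "smooth_on (chart_image c) (field_in c (ext_field B d f w))"
  proof (rule smooth_on_local)
    fix z assume z: "z \<in> chart_image c"
    show "\<exists>O' g. open O' \<and> z \<in> O' \<and> smooth_on O' g \<and> (\<forall>y\<in>O'. field_in c (ext_field B d f w) y = g y)"
    proof (cases "chart_inv c z \<in> fst d")
      case True
      let ?h = "\<lambda>x. (f \<circ> chart_inv d) x *\<^sub>R fd (snd c \<circ> chart_inv d) x (w x)"
      let ?g = "\<lambda>y. ?h (snd d (chart_inv c y))"
      have sub: "?P \<subseteq> chart_image d" by auto
      have sh: "smooth_on ?P ?h"
        using smooth_on_subset[OF bump_sm[OF d f] sub] smooth_on_subset[OF w sub]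
        by (intro smooth_on_scaleR smooth_on_fd_apply open_overlap smooth_trans c d)
      have "smooth_on ?O ?g"
      proof -
        have "(snd d \<circ> chart_inv c) ` ?O \<subseteq> ?P" using c d by auto
        from smooth_on_compose[OF open_overlap[OF c d] sh smooth_trans[OF c d] this]
        show ?thesis by (simp add: o_def)
      qed
      moreover have "\<forall>y\<in>?O. field_in c (ext_field B d f w) y = ?g y"
        using c d by (auto simp: overlap_iff ext_field_def field_in_def trans_deriv_def)
      ultimately show ?thesis
        using True z c d by (intro exI[of _ ?O] exI[of _ ?g] conjI open_overlap) (auto simp: overlap_iff)
    next
      case False
      then obtain O' where "open O'" "z \<in> O'" "\<forall>y\<in>O'. f (chart_inv c y) = 0"
        using f c z unfolding bump_at_def by meson
      then show ?thesis
        by (intro exI[of _ O'] exI[of _ "\<lambda>_. 0"]) (auto simp: ext_field_def field_in_def smooth_on_const)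
    qed
  qed
qed

lemma ext_field_at: "d \<in> B \<Longrightarrow> q \<in> fst d \<Longrightarrow> ext_field B d f w q d = f q *\<^sub>R w (snd d q)"
  by (simp add: ext_field_def trans_deriv_self)

lemma bump_one: "bump_at B d N f \<Longrightarrow> z \<in> N \<Longrightarrow> f (chart_inv d z) = 1"
  by (simp add: bump_at_def)

lemma bump_subset: "bump_at B d N f \<Longrightarrow> N \<subseteq> chart_image d"
  by (simp add: bump_at_def)

lemma bump_open: "bump_at B d N f \<Longrightarrow> open N"
  by (simp add: bump_at_def)

subsection \<open>Smooth functions and vector fields as a ring and a module\<close>

lemma sm_cong: "(\<And>q. q \<in> Q \<Longrightarrow> f q = g q) \<Longrightarrow> sm f \<longleftrightarrow> sm g"
proof -
  assume eq: "\<And>q. q \<in> Q \<Longrightarrow> f q = g q"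
  have "sm f" if "sm g" "\<And>q. q \<in> Q \<Longrightarrow> f q = g q" for f g
    by (rule smI, rule smooth_on_cong[OF open_image smD[OF that(1)]])
      (use that(2) in simp_all)
  from this[of f g] this[of g f] show ?thesis using eq by auto
qed

lemma sm_const: "sm (\<lambda>q. c)"
  by (rule smI) (simp add: o_def smooth_on_const)

lemma sm_add: "sm f \<Longrightarrow> sm g \<Longrightarrow> sm (\<lambda>q. f q + g q)"
  using smooth_on_add[OF open_image smD smD] by (intro smI) (simp add: o_def)

lemma sm_diff: "sm f \<Longrightarrow> sm g \<Longrightarrow> sm (\<lambda>q. f q - g q)"
  using smooth_on_diff[OF open_image smD smD] by (intro smI) (simp add: o_def)

lemma sm_minus: "sm f \<Longrightarrow> sm (\<lambda>q. - f q)"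
  using smooth_on_minus[OF open_image smD] by (intro smI) (simp add: o_def)

lemma sm_mult: "sm f \<Longrightarrow> sm g \<Longrightarrow> sm (\<lambda>q. f q * g q)"
  using smooth_on_mult[OF open_image smD smD] by (intro smI) (simp add: o_def)

lemmas sm_intros = sm_const sm_add sm_diff sm_minus sm_mult

lemma vf_zero: "0 \<in> VF"
  by (rule vfI) (auto simp: tangent_space_iff field_in_def linear_0[OF trans_deriv_linear] smooth_on_const)

lemma vf_add: "X \<in> VF \<Longrightarrow> Y \<in> VF \<Longrightarrow> X + Y \<in> VF"
proof (rule vfI)
  assume X: "X \<in> VF" and Y: "Y \<in> VF"
  show "(X + Y) q \<in> tangent_space B q" for q
    unfolding tangent_space_iff
  proof (intro conjI ballI impI allI)
    fix d c assume "d \<in> B" "c \<in> B" "q \<in> fst d" "q \<in> fst c"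
    then show "(X + Y) q c = trans_deriv d c q ((X + Y) q d)"
      using vf_trans[OF X, of d c q] vf_trans[OF Y, of d c q] by (simp add: linear_add[OF trans_deriv_linear])
  qed (simp add: vf_outside X Y)
  show "smooth_on (chart_image d) (field_in d (X + Y))" if "d \<in> B" for d
    using smooth_on_add[OF open_image vf_smooth[OF X] vf_smooth[OF Y]] that by (simp add: field_in_def)
qed

lemma vf_fscale: "sm f \<Longrightarrow> X \<in> VF \<Longrightarrow> fscale f X \<in> VF"
proof (rule vfI)
  assume f: "sm f" and X: "X \<in> VF"
  show "fscale f X q \<in> tangent_space B q" for q
    unfolding tangent_space_iff
  proof (intro conjI ballI impI allI)
    fix d c assume "d \<in> B" "c \<in> B" "q \<in> fst d" "q \<in> fst c"
    then show "fscale f X q c = trans_deriv d c q (fscale f X q d)"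
      using vf_trans[OF X, of d c q] by (simp add: fscale_def linear_scale[OF trans_deriv_linear])
  qed (simp add: vf_outside X fscale_def)
  show "smooth_on (chart_image d) (field_in d (fscale f X))" if "d \<in> B" for d
    using smooth_on_scaleR[OF open_image smD[OF f] vf_smooth[OF X]] that
    by (simp add: field_in_def fscale_def o_def)
qed

lemma vf_minus: "X \<in> VF \<Longrightarrow> - X \<in> VF"
proof -
  assume "X \<in> VF"
  then have "fscale (\<lambda>_. -1) X \<in> VF" by (intro vf_fscale sm_const)
  moreover have "fscale (\<lambda>_. -1) X = - X" by (simp add: fun_eq_iff fscale_def)
  ultimately show ?thesis by simp
qed

lemma vf_diff: "X \<in> VF \<Longrightarrow> Y \<in> VF \<Longrightarrow> X - Y \<in> VF"
  using vf_add[OF _ vf_minus, of X Y] by simp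

lemma vf_sum: "(\<And>i. i \<in> I \<Longrightarrow> X i \<in> VF) \<Longrightarrow> (\<Sum>i\<in>I. X i) \<in> VF"
  by (induction I rule: infinite_finite_induct) (auto intro: vf_zero vf_add)

text \<open>Serves to assemble local solutions: the chart in which \<open>U\<close> is known to be
  smooth may differ from the one in which smoothness is tested, so the neighbourhood is pulled back
  through the coordinate change.\<close>

lemma vf_glue:
  assumes U: "\<And>q. q \<in> Q \<Longrightarrow> \<exists>W\<in>VF. \<exists>d\<in>B. \<exists>N. open N \<and> N \<subseteq> chart_image d \<and> q \<in> fst d \<and> snd d q \<in> N \<and>
      (\<forall>z\<in>N. U (chart_inv d z) = W (chart_inv d z))"
    and U0: "\<And>q. q \<notin> Q \<Longrightarrow> U q = 0"
  shows "U \<in> VF"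
proof (rule vfI)
  fix q show "U q \<in> tangent_space B q"
  proof (cases "q \<in> Q")
    case True
    then obtain W d N where "W \<in> VF" "d \<in> B" "q \<in> fst d" "snd d q \<in> N"
      "\<forall>z\<in>N. U (chart_inv d z) = W (chart_inv d z)"
      using U by metis
    then have "U q = W q" by force
    then show ?thesis using vf_tangent \<open>W \<in> VF\<close> by simp
  next
    case False
    then show ?thesis using U0 vf_tangent[OF vf_zero, of q] by simp
  qed
next
  fix c assume c: "c \<in> B"
  show "smooth_on (chart_image c) (field_in c U)"
  proof (rule smooth_on_local)
    fix z assume z: "z \<in> chart_image c"
    then have "chart_inv c z \<in> Q" using c by simp
    then obtain W d N where W: "W \<in> VF" and d: "d \<in> B" and q: "chart_inv c z \<in> fst d"
      and N: "open N" "N \<subseteq> chart_image d" "snd d (chart_inv c z) \<in> N"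
      and eq: "\<forall>z\<in>N. U (chart_inv d z) = W (chart_inv d z)"
      using U by metis
    let ?O = "snd c ` (fst c \<inter> fst d)"
    let ?O' = "?O \<inter> (snd d \<circ> chart_inv c) -` N"
    have "open ?O'"
      by (rule continuous_open_preimage[OF smooth_on_continuous[OF smooth_trans[OF c d]]
            open_overlap[OF c d] N(1)])
    moreover have "z \<in> ?O'" using z q N c by (simp add: overlap_iff)
    moreover have "smooth_on ?O' (field_in c W)"
      by (rule smooth_on_subset[OF vf_smooth[OF W c]]) (auto simp: c)
    moreover have "field_in c U y = field_in c W y" if y: "y \<in> ?O'" for y
    proof -
      have "y \<in> ?O" "snd d (chart_inv c y) \<in> N" using y by auto
      then have "U (chart_inv c y) = W (chart_inv c y)"
        using eq c d by (metis chart_inv_left overlap_iff)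
      then show ?thesis by (simp add: field_in_def)
    qed
    ultimately show "\<exists>O' g. open O' \<and> z \<in> O' \<and> smooth_on O' g \<and> (\<forall>y\<in>O'. field_in c U y = g y)"
      by blast
  qed
qed

subsection \<open>Derivations and the Lie bracket\<close>

text \<open>The chart hidden in \<open>deriv_along\<close> is an arbitrary choice; the chain rule
  and the transformation law of \<open>X\<close> compensate each other.\<close>

lemma dv_chart:
  assumes X: "X \<in> VF" and f: "sm f" and d: "d \<in> B" "q \<in> fst d"
  shows "dv X f q = fd (f \<circ> chart_inv d) (snd d q) (X q d)"
proof -
  define c where "c = (SOME c. c \<in> B \<and> q \<in> fst c)"
  have c: "c \<in> B" "q \<in> fst c" using someI[of "\<lambda>c. c \<in> B \<and> q \<in> fst c" d] d by (auto simp: c_def)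
  have "((f \<circ> chart_inv d) has_derivative fd (f \<circ> chart_inv d) (snd d q)) (at (snd d q))"
    by (rule smooth_on_derivative[OF smD[OF f d(1)]]) (use d in auto)
  from fd_change_chart[OF c(1) d(1) c(2) d(2) this]
  have "fd (f \<circ> chart_inv c) (snd c q) v = fd (f \<circ> chart_inv d) (snd d q) (trans_deriv c d q v)" for v
    using frechet_derivative_at by metis
  then show ?thesis
    using vf_trans[OF X c(1) d(1) c(2) d(2)] by (simp add: deriv_along_def c_def[symmetric] Let_def)
qed

lemma fd_chart:
  assumes f: "sm f" and d: "d \<in> B" "q \<in> fst d"
  shows "((f \<circ> chart_inv d) has_derivative fd (f \<circ> chart_inv d) (snd d q)) (at (snd d q))"
  by (rule smooth_on_derivative[OF smD[OF f d(1)]]) (use d in auto)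

lemma sm_dv:
  assumes X: "X \<in> VF" and f: "sm f"
  shows "sm (dv X f)"
proof (rule smI)
  fix d assume d: "d \<in> B"
  have "smooth_on (chart_image d) (\<lambda>z. fd (f \<circ> chart_inv d) z (field_in d X z))"
    by (intro smooth_on_fd_apply open_image d smD f vf_smooth X)
  then show "smooth_on (chart_image d) (dv X f \<circ> chart_inv d)"
    by (rule smooth_on_cong[OF open_image[OF d]])
      (use d in \<open>simp add: field_in_def dv_chart[OF X f d]\<close>)
qed

text \<open>Identities between functions hold only on the carrier, so they cannot be rewritten under
  \<open>dv\<close> as equalities of functions; this rule replaces such rewriting
  throughout.\<close>

lemma dv_cong:
  assumes X: "X \<in> VF" and f: "sm f" and q: "q \<in> Q" and eq: "\<And>q. q \<in> Q \<Longrightarrow> f q = g q"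
  shows "dv X f q = dv X g q"
proof -
  obtain d where d: "d \<in> B" "q \<in> fst d" using q by (auto simp: carrier_iff)
  have g: "sm g" using sm_cong[of f g] eq f by simp
  have "fd (f \<circ> chart_inv d) (snd d q) = fd (g \<circ> chart_inv d) (snd d q)"
    by (rule fd_eq_local[OF open_image[OF d(1)]]) (use d in \<open>simp_all add: eq\<close>)
  then show ?thesis by (simp add: dv_chart[OF X f d] dv_chart[OF X g d])
qed

lemma dv_add_field:
  assumes "X \<in> VF" "Y \<in> VF" "sm f" "q \<in> Q"
  shows "dv (X + Y) f q = dv X f q + dv Y f q"
proof -
  obtain d where d: "d \<in> B" "q \<in> fst d" using assms by (auto simp: carrier_iff)
  show ?thesis
    using assms d has_derivative_linear[OF fd_chart[OF assms(3) d]]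
    by (simp add: dv_chart vf_add linear_add)
qed

lemma dv_fscale:
  assumes "X \<in> VF" "sm g" "sm f" "q \<in> Q"
  shows "dv (fscale g X) f q = g q * dv X f q"
proof -
  obtain d where d: "d \<in> B" "q \<in> fst d" using assms by (auto simp: carrier_iff)
  show ?thesis
    using assms d has_derivative_linear[OF fd_chart[OF assms(3) d]]
    by (simp add: dv_chart vf_fscale linear_scale) (simp add: fscale_def linear_scale)
qed

lemma dv_zero_field: "sm f \<Longrightarrow> q \<in> Q \<Longrightarrow> dv 0 f q = 0"
  using dv_add_field[OF vf_zero vf_zero, of f q] by simp

lemma dv_minus_field:
  assumes "X \<in> VF" "sm f" "q \<in> Q"
  shows "dv (- X) f q = - dv X f q"
  using dv_add_field[of X "- X" f q] dv_zero_field[of f q] assms by (simp add: vf_minus)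

lemma dv_diff_field:
  assumes "X \<in> VF" "Y \<in> VF" "sm f" "q \<in> Q"
  shows "dv (X - Y) f q = dv X f q - dv Y f q"
  using dv_add_field[of X "- Y" f q] assms by (simp add: vf_minus dv_minus_field)

lemma dv_const: "q \<in> Q \<Longrightarrow> X \<in> VF \<Longrightarrow> dv X (\<lambda>_. c) q = 0"
  by (auto simp: carrier_iff dv_chart[OF _ sm_const] o_def)

lemma dv_add:
  assumes X: "X \<in> VF" and f: "sm f" and g: "sm g" and q: "q \<in> Q"
  shows "dv X (\<lambda>q. f q + g q) q = dv X f q + dv X g q"
proof -
  obtain d where d: "d \<in> B" "q \<in> fst d" using q by (auto simp: carrier_iff)
  show ?thesis
    using fun_cong[OF frechet_derivative_at[OF has_derivative_add[OF fd_chart[OF f d] fd_chart[OF g d]], symmetric], of "X q d"] d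
    by (simp add: dv_chart[OF X _ d] f g sm_add o_def)
qed

lemma dv_mult:
  assumes X: "X \<in> VF" and f: "sm f" and g: "sm g" and q: "q \<in> Q"
  shows "dv X (\<lambda>q. f q * g q) q = f q * dv X g q + dv X f q * g q"
proof -
  obtain d where d: "d \<in> B" "q \<in> fst d" using q by (auto simp: carrier_iff)
  show ?thesis
    using fun_cong[OF frechet_derivative_at[OF has_derivative_mult[OF fd_chart[OF f d] fd_chart[OF g d]], symmetric], of "X q d"] d
    by (simp add: dv_chart[OF X _ d] f g sm_mult o_def)
qed

lemma dv_cmult:
  assumes X: "X \<in> VF" and f: "sm f" and q: "q \<in> Q"
  shows "dv X (\<lambda>q. c * f q) q = c * dv X f q"
  using dv_mult[OF X sm_const f q, of c] dv_const[OF q X] by simp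

lemma dv_minus:
  assumes X: "X \<in> VF" and f: "sm f" and q: "q \<in> Q"
  shows "dv X (\<lambda>q. - f q) q = - dv X f q"
  using dv_cmult[OF X f q, of "-1"] by simp

lemma dv_diff:
  assumes X: "X \<in> VF" and f: "sm f" and g: "sm g" and q: "q \<in> Q"
  shows "dv X (\<lambda>q. f q - g q) q = dv X f q - dv X g q"
  using dv_add[OF X f sm_minus[OF g] q] dv_minus[OF X g q] by simp

text \<open>Coordinate functions, cut off by a bump that is 1 near the point, already read off every
  component.\<close>

lemma vector_separation:
  assumes d: "d \<in> B" "q \<in> fst d"
    and eq: "\<And>f. sm f \<Longrightarrow> fd (f \<circ> chart_inv d) (snd d q) v = fd (f \<circ> chart_inv d) (snd d q) w"
  shows "v = w"
proof (rule euclidean_eqI)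
  fix b :: 'e assume "b \<in> Basis"
  obtain N f where N: "snd d q \<in> N" and f: "bump_at B d N f" using bump_exists[OF d] by blast
  have sf: "sm (ext_fun d f (\<lambda>z. z \<bullet> b))"
    by (rule sm_ext_fun[OF d(1) f]) (intro smooth_on_inner smooth_on_ident smooth_on_const open_image d)
  have "((ext_fun d f (\<lambda>z. z \<bullet> b) \<circ> chart_inv d) has_derivative (\<lambda>v. v \<bullet> b)) (at (snd d q))"
    by (rule has_derivative_transform_within_open[OF _ bump_open[OF f] N, of "\<lambda>z. z \<bullet> b"])
      (use bump_subset[OF f] bump_one[OF f] in \<open>auto intro!: derivative_eq_intros simp: ext_fun_def subset_iff\<close>)
  then have "fd (ext_fun d f (\<lambda>z. z \<bullet> b) \<circ> chart_inv d) (snd d q) = (\<lambda>v. v \<bullet> b)"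
    using frechet_derivative_at by metis
  then show "v \<bullet> b = w \<bullet> b" using eq[OF sf] by metis
qed

lemma vf_separation:
  assumes X: "X \<in> VF" and Y: "Y \<in> VF"
    and eq: "\<And>f q. sm f \<Longrightarrow> q \<in> Q \<Longrightarrow> dv X f q = dv Y f q"
  shows "X = Y"
proof (rule vf_eqI[OF X Y])
  fix q assume q: "q \<in> Q"
  then obtain d where d: "d \<in> B" "q \<in> fst d" by (auto simp: carrier_iff)
  have "X q d = Y q d"
  proof (rule vector_separation[OF d])
    fix f assume f: "sm f"
    from eq[OF f q] show "fd (f \<circ> chart_inv d) (snd d q) (X q d) = fd (f \<circ> chart_inv d) (snd d q) (Y q d)"
      by (simp add: dv_chart[OF X f d] dv_chart[OF Y f d])
  qed
  then show "X q = Y q" using X Y d vf_point_eqI by blast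
qed

text \<open>In coordinates X(Y f) is a second derivative of \<open>f\<close> in the directions X and
  Y plus the first derivative of \<open>f\<close> applied to the derivative of Y along X. The
  second-order terms cancel by symmetry.\<close>

lemma bracket_chart:
  assumes X: "X \<in> VF" and Y: "Y \<in> VF" and f: "sm f" and d: "d \<in> B" "q \<in> fst d"
  shows "fd (f \<circ> chart_inv d) (snd d q) (br X Y q d) = dv X (dv Y f) q - dv Y (dv X f) q"
proof -
  let ?F = "f \<circ> chart_inv d" and ?z = "snd d q" and ?S = "chart_image d"
  have S: "open ?S" "?z \<in> ?S" using d open_image by auto
  have F: "smooth_on ?S ?F" using smD f d by blast
  have key: "dv X (dv Y f) q = fd (\<lambda>z. fd ?F z (Y q d)) ?z (X q d) + fd ?F ?z (fd (field_in d Y) ?z (X q d))"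
    if X: "X \<in> VF" and Y: "Y \<in> VF" for X Y
  proof -
    \<comment> \<open>The direction of differentiation moves with \<open>z\<close>; expanded over
      the basis, the expression becomes accessible to the product rule. Linearity \<open>l\<close>
      later folds the sum back.\<close>
    have e: "(\<lambda>z. \<Sum>b\<in>Basis. (field_in d Y z \<bullet> b) *\<^sub>R fd ?F z b) z = (dv Y f \<circ> chart_inv d) z" if z: "z \<in> ?S" for z
      using linear_expand_Basis[OF linear_frechet_derivative[OF smooth_on_differentiable[OF F z]],
          of "Y (chart_inv d z) d"] z d
      by (simp add: dv_chart[OF Y f d(1)] field_in_def)
    have l: "linear (\<lambda>v. fd (\<lambda>z. fd ?F z v) ?z (X q d))"
    proof (rule linearI)
      have df: "((\<lambda>z. fd ?F z u) has_derivative fd (\<lambda>z. fd ?F z u) ?z) (at ?z)" for u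
        by (rule smooth_on_derivative[OF smooth_on_fd[OF F] S(2)])
      have lf: "linear (fd ?F z)" if "z \<in> ?S" for z
        by (rule linear_frechet_derivative[OF smooth_on_differentiable[OF F that]])
      show "fd (\<lambda>z. fd ?F z (u + v)) ?z (X q d) = fd (\<lambda>z. fd ?F z u) ?z (X q d) + fd (\<lambda>z. fd ?F z v) ?z (X q d)" for u v
      proof -
        have "((\<lambda>z. fd ?F z (u + v)) has_derivative (\<lambda>w. fd (\<lambda>z. fd ?F z u) ?z w + fd (\<lambda>z. fd ?F z v) ?z w)) (at ?z)"
          by (rule has_derivative_transform_within_open[OF has_derivative_add[OF df[of u] df[of v]] S])
            (simp add: linear_add[OF lf])
        from fun_cong[OF frechet_derivative_at[OF this, symmetric]] show ?thesis by simp
      qed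
      show "fd (\<lambda>z. fd ?F z (r *\<^sub>R u)) ?z (X q d) = r *\<^sub>R fd (\<lambda>z. fd ?F z u) ?z (X q d)" for r u
      proof -
        have "((\<lambda>z. fd ?F z (r *\<^sub>R u)) has_derivative (\<lambda>w. r *\<^sub>R fd (\<lambda>z. fd ?F z u) ?z w)) (at ?z)"
          by (rule has_derivative_transform_within_open[OF has_derivative_scaleR_right[OF df[of u]] S])
            (simp add: linear_scale[OF lf])
        from fun_cong[OF frechet_derivative_at[OF this, symmetric]] show ?thesis by simp
      qed
    qed
    have "((\<lambda>z. \<Sum>b\<in>Basis. (field_in d Y z \<bullet> b) *\<^sub>R fd ?F z b) has_derivative
        (\<lambda>v. \<Sum>b\<in>Basis. (field_in d Y ?z \<bullet> b) *\<^sub>R fd (\<lambda>z. fd ?F z b) ?z v + (fd (field_in d Y) ?z v \<bullet> b) *\<^sub>R fd ?F ?z b)) (at ?z)"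
      by (intro has_derivative_sum has_derivative_scaleR
          bounded_linear.has_derivative[OF bounded_linear_inner_left]
          smooth_on_derivative[OF vf_smooth[OF Y d(1)] S(2)]
          smooth_on_derivative[OF smooth_on_fd[OF F] S(2)])
    then have "((dv Y f \<circ> chart_inv d) has_derivative
        (\<lambda>v. \<Sum>b\<in>Basis. (field_in d Y ?z \<bullet> b) *\<^sub>R fd (\<lambda>z. fd ?F z b) ?z v + (fd (field_in d Y) ?z v \<bullet> b) *\<^sub>R fd ?F ?z b)) (at ?z)"
      by (rule has_derivative_transform_within_open[OF _ S e])
    then have "dv X (dv Y f) q = (\<Sum>b\<in>Basis. (Y q d \<bullet> b) *\<^sub>R fd (\<lambda>z. fd ?F z b) ?z (X q d)
        + (fd (field_in d Y) ?z (X q d) \<bullet> b) *\<^sub>R fd ?F ?z b)"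
      using d by (simp add: dv_chart[OF X sm_dv[OF Y f] d] frechet_derivative_at[symmetric] field_in_def)
    also have "\<dots> = fd (\<lambda>z. fd ?F z (Y q d)) ?z (X q d) + fd ?F ?z (fd (field_in d Y) ?z (X q d))"
      using linear_expand_Basis[OF l, of "Y q d"]
        linear_expand_Basis[OF linear_frechet_derivative[OF smooth_on_differentiable[OF F S(2)]], of "fd (field_in d Y) ?z (X q d)"]
      by (simp add: sum.distrib)
    finally show ?thesis .
  qed
  have "Ck_on 2 ?S ?F" using F by (simp add: smooth_on_def)
  from second_derivative_symmetric[OF S this]
  have "fd (\<lambda>z. fd ?F z (Y q d)) ?z (X q d) = fd (\<lambda>z. fd ?F z (X q d)) ?z (Y q d)" .
  then show ?thesis
    using linear_frechet_derivative[OF smooth_on_differentiable[OF F S(2)]] d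
    by (simp add: key X Y bracket_def linear_diff)
qed

text \<open>The transformation law needs no second derivatives of coordinate changes: by
  \<open>bracket_chart\<close> the components in any two charts act on functions in the same way,
  and such vectors are separated.\<close>

lemma vf_br:
  assumes X: "X \<in> VF" and Y: "Y \<in> VF"
  shows "br X Y \<in> VF"
proof (rule vfI)
  fix q show "br X Y q \<in> tangent_space B q"
    unfolding tangent_space_iff
  proof (intro conjI ballI impI allI)
    fix d c assume d: "d \<in> B" "q \<in> fst d" and c: "c \<in> B" "q \<in> fst c"
    show "br X Y q c = trans_deriv d c q (br X Y q d)"
    proof (rule vector_separation[OF c])
      fix f assume f: "sm f"
      from fd_change_chart[OF d(1) c(1) d(2) c(2) fd_chart[OF f c]]
      have "fd (f \<circ> chart_inv c) (snd c q) (trans_deriv d c q v) = fd (f \<circ> chart_inv d) (snd d q) v" for v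
        using frechet_derivative_at by metis
      then show "fd (f \<circ> chart_inv c) (snd c q) (br X Y q c) =
          fd (f \<circ> chart_inv c) (snd c q) (trans_deriv d c q (br X Y q d))"
        by (simp add: bracket_chart[OF X Y f] d c)
    qed
  next
    fix c assume "\<not> (c \<in> B \<and> q \<in> fst c)"
    then show "br X Y q c = 0" by (auto simp: bracket_def)
  qed
next
  fix d assume d: "d \<in> B"
  have "smooth_on (chart_image d) (\<lambda>z. fd (field_in d Y) z (field_in d X z) - fd (field_in d X) z (field_in d Y z))"
    by (intro smooth_on_diff smooth_on_fd_apply open_image d vf_smooth X Y)
  then show "smooth_on (chart_image d) (field_in d (br X Y))"
    by (rule smooth_on_cong[OF open_image[OF d]]) (simp add: d field_in_def bracket_def)
qed

lemma dv_br:
  assumes X: "X \<in> VF" and Y: "Y \<in> VF" and f: "sm f" and q: "q \<in> Q"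
  shows "dv (br X Y) f q = dv X (dv Y f) q - dv Y (dv X f) q"
proof -
  obtain d where d: "d \<in> B" "q \<in> fst d" using q by (auto simp: carrier_iff)
  show ?thesis using bracket_chart[OF X Y f d] dv_chart[OF vf_br[OF X Y] f d] by simp
qed

lemmas vf_intros = vf_zero vf_add vf_minus vf_diff vf_fscale vf_br
lemma br_anti:
  assumes "X \<in> VF" "Y \<in> VF"
  shows "br X Y = - br Y X"
  by (rule vf_separation) (use assms in \<open>simp_all add: vf_intros dv_minus_field dv_br\<close>)

lemma br_add_right:
  assumes "X \<in> VF" "Y \<in> VF" "Z \<in> VF"
  shows "br X (Y + Z) = br X Y + br X Z"
proof (rule vf_separation)
  fix f q assume f: "sm f" and q: "q \<in> Q"
  have "dv X (dv (Y + Z) f) q = dv X (\<lambda>q. dv Y f q + dv Z f q) q"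
    by (rule dv_cong) (use assms f q in \<open>simp_all add: vf_intros sm_dv dv_add_field\<close>)
  then show "dv (br X (Y + Z)) f q = dv (br X Y + br X Z) f q"
    using assms f q by (simp add: vf_intros dv_br dv_add_field sm_dv dv_add)
qed (use assms in \<open>simp_all add: vf_intros\<close>)

lemma br_add_left:
  assumes "X \<in> VF" "Y \<in> VF" "Z \<in> VF"
  shows "br (X + Y) Z = br X Z + br Y Z"
  using br_add_right[of Z X Y] br_anti[of "X + Y" Z] br_anti[of X Z] br_anti[of Y Z] assms
  by (simp add: vf_add)

lemma br_zero_right: "X \<in> VF \<Longrightarrow> br X 0 = 0"
  using br_add_right[OF _ vf_zero vf_zero, of X] by simp

lemma br_zero_left: "X \<in> VF \<Longrightarrow> br 0 X = 0"
  using br_add_left[OF vf_zero vf_zero, of X] by simp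

lemma br_minus_right: "X \<in> VF \<Longrightarrow> Y \<in> VF \<Longrightarrow> br X (- Y) = - br X Y"
  using br_add_right[of X Y "- Y"] br_zero_right[of X] by (simp add: vf_minus eq_neg_iff_add_eq_0 add.commute)

lemma br_minus_left: "X \<in> VF \<Longrightarrow> Y \<in> VF \<Longrightarrow> br (- X) Y = - br X Y"
  using br_add_left[of X "- X" Y] br_zero_left[of Y] by (simp add: vf_minus eq_neg_iff_add_eq_0 add.commute)

lemma br_diff_right:
  assumes "X \<in> VF" "Y \<in> VF" "Z \<in> VF"
  shows "br X (Y - Z) = br X Y - br X Z"
  using br_add_right[of X Y "- Z"] assms by (simp add: br_minus_right vf_minus)

lemma br_diff_left:
  assumes "X \<in> VF" "Y \<in> VF" "Z \<in> VF"
  shows "br (X - Y) Z = br X Z - br Y Z"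
  using br_add_left[of X "- Y" Z] assms by (simp add: br_minus_left vf_minus)

lemma br_fscale_right:
  assumes "X \<in> VF" "Y \<in> VF" "sm g"
  shows "br X (fscale g Y) = fscale (dv X g) Y + fscale g (br X Y)"
proof (rule vf_separation)
  fix f q assume f: "sm f" and q: "q \<in> Q"
  have "dv X (dv (fscale g Y) f) q = dv X (\<lambda>q. g q * dv Y f q) q"
    by (rule dv_cong) (use assms f q in \<open>simp_all add: vf_intros sm_dv dv_fscale\<close>)
  then show "dv (br X (fscale g Y)) f q = dv (fscale (dv X g) Y + fscale g (br X Y)) f q"
    using assms f q by (simp add: vf_intros dv_br dv_add_field sm_dv dv_mult dv_fscale algebra_simps)
qed (use assms in \<open>simp_all add: vf_intros sm_dv\<close>)

lemma br_fscale_left: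
  assumes "X \<in> VF" "Y \<in> VF" "sm g"
  shows "br (fscale g X) Y = fscale g (br X Y) - fscale (dv Y g) X"
proof (rule vf_separation)
  fix f q assume f: "sm f" and q: "q \<in> Q"
  have "dv Y (dv (fscale g X) f) q = dv Y (\<lambda>q. g q * dv X f q) q"
    by (rule dv_cong) (use assms f q in \<open>simp_all add: vf_intros sm_dv dv_fscale\<close>)
  then show "dv (br (fscale g X) Y) f q = dv (fscale g (br X Y) - fscale (dv Y g) X) f q"
    using assms f q by (simp add: vf_intros dv_br dv_diff_field sm_dv dv_mult dv_fscale algebra_simps)
qed (use assms in \<open>simp_all add: vf_intros sm_dv\<close>)

lemma br_jacobi:
  assumes "X \<in> VF" "Y \<in> VF" "Z \<in> VF"
  shows "br X (br Y Z) = br (br X Y) Z + br Y (br X Z)"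
proof (rule vf_separation)
  fix f q assume f: "sm f" and q: "q \<in> Q"
  have D: "dv U (dv (br V W) f) q = dv U (dv V (dv W f)) q - dv U (dv W (dv V f)) q"
    if "U \<in> VF" "V \<in> VF" "W \<in> VF" for U V W
  proof -
    have "dv U (dv (br V W) f) q = dv U (\<lambda>q. dv V (dv W f) q - dv W (dv V f) q) q"
      by (rule dv_cong) (use that f q in \<open>simp_all add: vf_intros sm_dv dv_br\<close>)
    then show ?thesis using that f q by (simp add: dv_diff sm_dv)
  qed
  show "dv (br X (br Y Z)) f q = dv (br (br X Y) Z + br Y (br X Z)) f q"
    using assms f q by (simp add: vf_intros dv_br dv_add_field sm_dv D)
qed (use assms in \<open>simp_all add: vf_intros\<close>)

lemmas br_simps = br_add_right br_add_left br_zero_right br_zero_left br_minus_right br_minus_left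
  br_diff_right br_diff_left

lemma dv_dv_add:
  assumes "Z \<in> VF" "X \<in> VF" "Y \<in> VF" "sm f" "q \<in> Q"
  shows "dv Z (dv (X + Y) f) q = dv Z (dv X f) q + dv Z (dv Y f) q"
proof -
  have "dv Z (dv (X + Y) f) q = dv Z (\<lambda>q. dv X f q + dv Y f q) q"
    by (rule dv_cong) (use assms in \<open>simp_all add: sm_dv vf_add dv_add_field\<close>)
  then show ?thesis using assms by (simp add: dv_add sm_dv)
qed

lemma dv_dv_fscale:
  assumes "Z \<in> VF" "X \<in> VF" "sm g" "sm f" "q \<in> Q"
  shows "dv Z (dv (fscale g X) f) q = g q * dv Z (dv X f) q + dv Z g q * dv X f q"
proof -
  have "dv Z (dv (fscale g X) f) q = dv Z (\<lambda>q. g q * dv X f q) q"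
    by (rule dv_cong) (use assms in \<open>simp_all add: sm_dv vf_fscale dv_fscale\<close>)
  then show ?thesis using assms by (simp add: dv_mult sm_dv)
qed

lemma dv_dv_zero:
  assumes "Z \<in> VF" "sm f" "q \<in> Q"
  shows "dv Z (dv 0 f) q = 0"
  using dv_dv_add[OF assms(1) vf_zero vf_zero assms(2,3)] by simp

lemma fscale_cong: "X \<in> VF \<Longrightarrow> (\<And>q. q \<in> Q \<Longrightarrow> f q = g q) \<Longrightarrow> fscale f X = fscale g X"
  using vf_outside_carrier[of X] by (simp add: fscale_def fun_eq_iff) (metis zero_fun_apply)

subsection \<open>Tensorial functionals\<close>

text \<open>This is a smooth 1-form, seen as a functional linear over the smooth functions;
  equations are demanded only where values are meaningful.\<close>

definition tensorial :: "(('p, 'e) field \<Rightarrow> 'p \<Rightarrow> real) \<Rightarrow> bool" where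
  "tensorial \<theta> \<longleftrightarrow> (\<forall>X\<in>VF. sm (\<theta> X)) \<and>
     (\<forall>X\<in>VF. \<forall>Y\<in>VF. \<forall>q\<in>Q. \<theta> (X + Y) q = \<theta> X q + \<theta> Y q) \<and>
     (\<forall>f. \<forall>X\<in>VF. \<forall>q\<in>Q. sm f \<longrightarrow> \<theta> (fscale f X) q = f q * \<theta> X q)"

lemma tensorialI:
  assumes "\<And>X. X \<in> VF \<Longrightarrow> sm (\<theta> X)"
    "\<And>X Y q. X \<in> VF \<Longrightarrow> Y \<in> VF \<Longrightarrow> q \<in> Q \<Longrightarrow> \<theta> (X + Y) q = \<theta> X q + \<theta> Y q"
    "\<And>f X q. X \<in> VF \<Longrightarrow> sm f \<Longrightarrow> q \<in> Q \<Longrightarrow> \<theta> (fscale f X) q = f q * \<theta> X q"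
  shows "tensorial \<theta>"
  using assms by (simp add: tensorial_def)

lemma tensorial_sm: "tensorial \<theta> \<Longrightarrow> X \<in> VF \<Longrightarrow> sm (\<theta> X)"
  by (simp add: tensorial_def)

lemma tensorial_add: "tensorial \<theta> \<Longrightarrow> X \<in> VF \<Longrightarrow> Y \<in> VF \<Longrightarrow> q \<in> Q \<Longrightarrow> \<theta> (X + Y) q = \<theta> X q + \<theta> Y q"
  by (simp add: tensorial_def)

lemma tensorial_fscale: "tensorial \<theta> \<Longrightarrow> sm f \<Longrightarrow> X \<in> VF \<Longrightarrow> q \<in> Q \<Longrightarrow> \<theta> (fscale f X) q = f q * \<theta> X q"
  by (simp add: tensorial_def)

lemma tensorial_zero: "tensorial \<theta> \<Longrightarrow> q \<in> Q \<Longrightarrow> \<theta> 0 q = 0"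
  using tensorial_add[OF _ vf_zero vf_zero, of \<theta> q] by simp

lemma tensorial_minus: "tensorial \<theta> \<Longrightarrow> X \<in> VF \<Longrightarrow> q \<in> Q \<Longrightarrow> \<theta> (- X) q = - \<theta> X q"
  using tensorial_add[of \<theta> X "- X" q] tensorial_zero[of \<theta> q] by (simp add: vf_minus)

lemma tensorial_diff:
  "tensorial \<theta> \<Longrightarrow> X \<in> VF \<Longrightarrow> Y \<in> VF \<Longrightarrow> q \<in> Q \<Longrightarrow> \<theta> (X - Y) q = \<theta> X q - \<theta> Y q"
  using tensorial_add[of \<theta> X "- Y" q] tensorial_minus[of \<theta> Y q] by (simp add: vf_minus)

lemma tensorial_sum:
  assumes "tensorial \<theta>" "\<And>i. i \<in> I \<Longrightarrow> X i \<in> VF" "q \<in> Q"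
  shows "\<theta> (\<Sum>i\<in>I. X i) q = (\<Sum>i\<in>I. \<theta> (X i) q)"
  using assms(2)
  by (induction I rule: infinite_finite_induct)
    (auto simp: tensorial_zero[OF assms(1,3)] tensorial_add[OF assms(1) _ _ assms(3)] vf_sum)

text \<open>\<open>X\<close> is no global combination of frame fields, but its product with the
  square of a bump is. At points where the bump is 1, linearity over functions removes that
  factor.\<close>

lemma tensorial_expand:
  assumes t: "tensorial \<theta>" and d: "d \<in> B" and f: "bump_at B d N f" and X: "X \<in> VF" and z: "z \<in> N"
  shows "\<theta> X (chart_inv d z) = (\<Sum>b\<in>Basis. (X (chart_inv d z) d \<bullet> b) * \<theta> (ext_field B d f (\<lambda>_. b)) (chart_inv d z))"
proof -
  let ?q = "chart_inv d z" and ?e = "\<lambda>b. ext_field B d f (\<lambda>_. b)"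
  let ?g = "\<lambda>b. ext_fun d f (\<lambda>z. field_in d X z \<bullet> b)"
  have z': "z \<in> chart_image d" using bump_subset[OF f] z by auto
  then have q: "?q \<in> Q" using d by simp
  have sg: "sm (?g b)" for b
    by (rule sm_ext_fun[OF d f]) (intro smooth_on_inner vf_smooth X d smooth_on_const open_image)
  have e: "?e b \<in> VF" for b
    by (rule vf_ext_field[OF d f smooth_on_const])
  have sf: "sm (ext_fun d f (\<lambda>_. 1))"
    by (rule sm_ext_fun[OF d f smooth_on_const])
  let ?f = "ext_fun d f (\<lambda>_. 1)"
  \<comment> \<open>One factor of the bump makes the coefficient global, the other makes the frame
    field global.\<close>
  have eq: "fscale (\<lambda>q. ?f q * ?f q) X = (\<Sum>b\<in>Basis. fscale (?g b) (?e b))"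
  proof (rule vf_eqI)
    fix p assume p: "p \<in> Q"
    show "fscale (\<lambda>q. ?f q * ?f q) X p = (\<Sum>b\<in>Basis. fscale (?g b) (?e b)) p"
    proof (cases "p \<in> fst d")
      case True
      have s: "(\<Sum>b\<in>I. fscale (?g b) (?e b)) p d = (\<Sum>b\<in>I. fscale (?g b) (?e b) p d)" for I :: "'e set"
        by (induction I rule: infinite_finite_induct) auto
      have "(\<Sum>b\<in>Basis. fscale (?g b) (?e b)) p d = (\<Sum>b\<in>Basis. (f p * f p) *\<^sub>R (X p d \<bullet> b) *\<^sub>R b)"
        using True d unfolding s by (intro sum.cong) (auto simp: fscale_def ext_fun_def ext_field_at field_in_def)
      also have "\<dots> = fscale (\<lambda>q. ?f q * ?f q) X p d"
        using True by (simp only: scaleR_sum_right[symmetric] euclidean_representation) (simp add: fscale_def ext_fun_def)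
      finally show ?thesis
        by (intro vf_point_eqI[OF _ _ d True]) (use sf sg e X in \<open>auto intro!: vf_fscale vf_sum sm_mult\<close>)
    next
      case False
      have "(\<Sum>b\<in>I. fscale (?g b) (?e b)) p = 0" for I :: "'e set"
        using False by (induction I rule: infinite_finite_induct) (auto simp: fscale_def ext_fun_def fun_eq_iff)
      then show ?thesis using False by (simp add: fscale_def ext_fun_def fun_eq_iff)
    qed
  qed (use sf sg e X in \<open>auto intro!: vf_fscale vf_sum sm_mult\<close>)
  have "\<theta> X ?q = \<theta> (fscale (\<lambda>q. ?f q * ?f q) X) ?q"
    using tensorial_fscale[OF t sm_mult[OF sf sf] X q] bump_one[OF f z] z' by (simp add: ext_fun_def)
  also have "\<dots> = (\<Sum>b\<in>Basis. ?g b ?q * \<theta> (?e b) ?q)"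
    unfolding eq by (simp add: tensorial_sum[OF t _ q] vf_fscale sg e tensorial_fscale[OF t sg e q])
  finally show ?thesis
    using bump_one[OF f z] z' by (simp add: ext_fun_def field_in_def)
qed

lemma tensorial_point:
  assumes t: "tensorial \<theta>" and X: "X \<in> VF" "Y \<in> VF" and q: "q \<in> Q" and eq: "X q = Y q"
  shows "\<theta> X q = \<theta> Y q"
proof -
  obtain d where d: "d \<in> B" "q \<in> fst d" using q by (auto simp: carrier_iff)
  obtain N f where "snd d q \<in> N" "bump_at B d N f" using bump_exists[OF d] by blast
  from tensorial_expand[OF t d(1) this(2) X(1) this(1)] tensorial_expand[OF t d(1) this(2) X(2) this(1)]
  show ?thesis using d eq by simp
qed

section \<open>Frames and the representation of 1-forms\<close>

definition bump_fun :: "('p, 'e) chart \<Rightarrow> 'p \<Rightarrow> 'p \<Rightarrow> real" where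
  "bump_fun d q = (SOME f. \<exists>N. snd d q \<in> N \<and> bump_at B d N f)"

definition local_frame :: "('p, 'e) chart \<Rightarrow> 'p \<Rightarrow> 'e \<Rightarrow> ('p, 'e) field" where
  "local_frame d q u = ext_field B d (bump_fun d q) (\<lambda>_. u)"

lemma bump_fun:
  assumes "d \<in> B" "q \<in> fst d"
  obtains N where "snd d q \<in> N" "bump_at B d N (bump_fun d q)"
proof -
  have "\<exists>f N. snd d q \<in> N \<and> bump_at B d N f" using bump_exists[OF assms] by blast
  from someI_ex[OF this] show thesis using that by (auto simp: bump_fun_def)
qed

lemma local_frame:
  assumes "d \<in> B" "q \<in> fst d"
  shows "local_frame d q u \<in> VF" "local_frame d q u q d = u"
proof -
  obtain N where N: "snd d q \<in> N" "bump_at B d N (bump_fun d q)" using bump_fun[OF assms] .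
  show "local_frame d q u \<in> VF"
    unfolding local_frame_def by (rule vf_ext_field[OF assms(1) N(2) smooth_on_const])
  show "local_frame d q u q d = u"
    using bump_one[OF N(2,1)] assms by (simp add: local_frame_def ext_field_at)
qed

text \<open>A frame chosen anew at each point has, at that point, the same value as one fixed frame
  near \<open>z\<close>. This allows smoothness to be checked for quantities built from pointwise
  choices.\<close>

lemma local_frame_near:
  assumes "d \<in> B" "bump_at B d N f" "z \<in> N"
  shows "local_frame d (chart_inv d z) u (chart_inv d z) = ext_field B d f (\<lambda>_. u) (chart_inv d z)"
proof -
  have z: "z \<in> chart_image d" using bump_subset[OF assms(2)] assms(3) by blast
  show ?thesis
    by (rule vf_point_eqI[OF local_frame(1) vf_ext_field[OF assms(1,2) smooth_on_const], of _ _ d])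
      (use z assms bump_one[OF assms(2,3)] in \<open>auto simp: local_frame(2) ext_field_at\<close>)
qed

lemma tensorial_expand_frame:
  assumes t: "tensorial \<theta>" and d: "d \<in> B" and X: "X \<in> VF" and q: "q \<in> fst d"
  shows "\<theta> X q = (\<Sum>b\<in>Basis. (X q d \<bullet> b) * \<theta> (local_frame d q b) q)"
proof -
  obtain N where N: "snd d q \<in> N" "bump_at B d N (bump_fun d q)" using bump_fun[OF d q] .
  from tensorial_expand[OF t d N(2) X N(1)] show ?thesis using d q by (simp add: local_frame_def)
qed

text \<open>The linear system for the components is solved by Cramer's rule in each chart; by nondegeneracy
  the local solutions agree.\<close>

theorem riesz:
  fixes \<omega> :: "('p, 'e) field \<Rightarrow> ('p, 'e) field \<Rightarrow> 'p \<Rightarrow> real" and fr :: "'m::finite \<Rightarrow> 'e"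
  assumes fr: "bij_betw fr UNIV Basis"
    and t1: "\<And>X. X \<in> VF \<Longrightarrow> tensorial (\<omega> X)" and t2: "\<And>Y. Y \<in> VF \<Longrightarrow> tensorial (\<lambda>X. \<omega> X Y)"
    and nd: "\<And>X q. X \<in> VF \<Longrightarrow> q \<in> Q \<Longrightarrow> (\<And>Y. Y \<in> VF \<Longrightarrow> \<omega> X Y q = 0) \<Longrightarrow> X q = 0"
    and t: "tensorial \<theta>"
  obtains U where "U \<in> VF" "\<And>Y q. Y \<in> VF \<Longrightarrow> q \<in> Q \<Longrightarrow> \<omega> U Y q = \<theta> Y q"
proof -
  have exp: "\<theta> X q = (\<Sum>i\<in>UNIV. (X q d \<bullet> fr i) * \<theta> (local_frame d q (fr i)) q)"
    if "tensorial \<theta>" "d \<in> B" "X \<in> VF" "q \<in> fst d" for \<theta> X q d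
    using tensorial_expand_frame[OF that]
      sum.reindex_bij_betw[OF fr, of "\<lambda>b. (X q d \<bullet> b) * \<theta> (local_frame d q b) q"] by simp
  have comb: "(\<Sum>i\<in>UNIV. x i *\<^sub>R fr i) \<bullet> fr j = x j" for x j
  proof -
    have "fr i \<bullet> fr j = (if i = j then 1 else 0)" for i
    proof -
      have "fr i \<in> Basis" "fr j \<in> Basis" "inj fr" using fr by (auto simp: bij_betw_def)
      then show ?thesis by (auto simp: inner_Basis inj_eq)
    qed
    then show ?thesis by (simp add: inner_sum_left if_distrib[where f = "\<lambda>y. _ * y"] sum.delta cong: if_cong)
  qed
  have unique: "U q = W q"
    if "U \<in> VF" "W \<in> VF" "q \<in> Q" "\<And>Y. Y \<in> VF \<Longrightarrow> \<omega> U Y q = \<omega> W Y q" for U W q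
  proof -
    have "(U - W) q = 0"
      by (rule nd[OF vf_diff[OF that(1,2)] that(3)]) (use that in \<open>simp add: tensorial_diff[OF t2]\<close>)
    then show ?thesis by simp
  qed
  have local: "\<exists>W\<in>VF. \<exists>N. open N \<and> N \<subseteq> chart_image d \<and> snd d q \<in> N \<and>
      (\<forall>z\<in>N. \<forall>Y\<in>VF. \<omega> W Y (chart_inv d z) = \<theta> Y (chart_inv d z))"
    if d: "d \<in> B" and q: "q \<in> fst d" for d q
  proof -
    let ?S = "chart_image d"
    \<comment> \<open>The Gram matrix at \<open>z\<close> uses the frame centred at \<open>z\<close>
      itself, which makes it defined on the whole chart image although each bump is 1 only on a
      small set.\<close>
    define G where "G z i j = \<omega> (local_frame d (chart_inv d z) (fr i)) (local_frame d (chart_inv d z) (fr j)) (chart_inv d z)" for z i j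
    define w where "w z j = \<theta> (local_frame d (chart_inv d z) (fr j)) (chart_inv d z)" for z j
    have inQ: "chart_inv d z \<in> Q" if "z \<in> ?S" for z using that d by simp
    have nearby: "\<exists>N f. open N \<and> z \<in> N \<and> bump_at B d N f" if "z \<in> ?S" for z
      using bump_exists[OF d chart_inv_in[OF that]] that bump_open unfolding chart_inv_right[OF that] by blast
    have sG: "smooth_on ?S (\<lambda>z. G z i j)" for i j
    proof (rule smooth_on_local)
      fix z assume z: "z \<in> ?S"
      obtain N f where N: "open N" "z \<in> N" and f: "bump_at B d N f" using nearby[OF z] by blast
      let ?e = "\<lambda>i. ext_field B d f (\<lambda>_. fr i)"
      have e: "?e i \<in> VF" for i by (rule vf_ext_field[OF d f smooth_on_const])
      have "G y i j = \<omega> (?e i) (?e j) (chart_inv d y)" if y: "y \<in> N" for y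
      proof -
        have y': "y \<in> ?S" using bump_subset[OF f] y by blast
        note lf = local_frame(1)[OF d chart_inv_in[OF y']]
        have "G y i j = \<omega> (?e i) (local_frame d (chart_inv d y) (fr j)) (chart_inv d y)"
          unfolding G_def by (rule tensorial_point[OF t2[OF lf] lf e inQ[OF y'] local_frame_near[OF d f y]])
        also have "\<dots> = \<omega> (?e i) (?e j) (chart_inv d y)"
          by (rule tensorial_point[OF t1[OF e] lf e inQ[OF y'] local_frame_near[OF d f y]])
        finally show ?thesis .
      qed
      moreover have "smooth_on N (\<omega> (?e i) (?e j) \<circ> chart_inv d)"
        by (rule smooth_on_subset[OF smD[OF tensorial_sm[OF t1[OF e] e] d] bump_subset[OF f]])
      ultimately show "\<exists>N g. open N \<and> z \<in> N \<and> smooth_on N g \<and> (\<forall>y\<in>N. G y i j = g y)"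
        using N by (intro exI[of _ N] exI[of _ "\<omega> (?e i) (?e j) \<circ> chart_inv d"]) auto
    qed
    have sw: "smooth_on ?S (\<lambda>z. w z j)" for j
    proof (rule smooth_on_local)
      fix z assume z: "z \<in> ?S"
      obtain N f where N: "open N" "z \<in> N" and f: "bump_at B d N f" using nearby[OF z] by blast
      let ?e = "ext_field B d f (\<lambda>_. fr j)"
      have e: "?e \<in> VF" by (rule vf_ext_field[OF d f smooth_on_const])
      have "w y j = \<theta> ?e (chart_inv d y)" if y: "y \<in> N" for y
      proof -
        have y': "y \<in> ?S" using bump_subset[OF f] y by blast
        show ?thesis unfolding w_def
          by (rule tensorial_point[OF t local_frame(1)[OF d chart_inv_in[OF y']] e inQ[OF y'] local_frame_near[OF d f y]])
      qed
      moreover have "smooth_on N (\<theta> ?e \<circ> chart_inv d)"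
        by (rule smooth_on_subset[OF smD[OF tensorial_sm[OF t e] d] bump_subset[OF f]])
      ultimately show "\<exists>N g. open N \<and> z \<in> N \<and> smooth_on N g \<and> (\<forall>y\<in>N. w y j = g y)"
        using N by (intro exI[of _ N] exI[of _ "\<theta> ?e \<circ> chart_inv d"]) auto
    qed
    have comps: "\<omega> W Y (chart_inv d z) = (\<Sum>j\<in>UNIV. (Y (chart_inv d z) d \<bullet> fr j) * (\<Sum>i\<in>UNIV. x i * G z i j))"
      if z: "z \<in> ?S" and W: "W \<in> VF" "W (chart_inv d z) d = (\<Sum>i\<in>UNIV. x i *\<^sub>R fr i)" and Y: "Y \<in> VF" for W Y z x
    proof -
      have p: "chart_inv d z \<in> fst d" using z by simp
      have "\<omega> W Y (chart_inv d z) = (\<Sum>j\<in>UNIV. (Y (chart_inv d z) d \<bullet> fr j) * \<omega> W (local_frame d (chart_inv d z) (fr j)) (chart_inv d z))"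
        by (rule exp[OF t1[OF W(1)] d Y p])
      also have "\<dots> = (\<Sum>j\<in>UNIV. (Y (chart_inv d z) d \<bullet> fr j) * (\<Sum>i\<in>UNIV. x i * G z i j))"
        unfolding exp[OF t2[OF local_frame(1)[OF d p]] d W(1) p] W(2) comb G_def ..
      finally show ?thesis .
    qed
    \<comment> \<open>A kernel vector of the Gram matrix yields a field that pairs to zero with
      every field at the point, against nondegeneracy.\<close>
    have inj: "x = (\<lambda>_. 0)" if z: "z \<in> ?S" and 0: "\<And>j. (\<Sum>i\<in>UNIV. x i * G z i j) = 0" for z x
    proof -
      have p: "chart_inv d z \<in> fst d" using z by simp
      let ?W = "local_frame d (chart_inv d z) (\<Sum>i\<in>UNIV. x i *\<^sub>R fr i)"
      have "?W (chart_inv d z) = 0"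
        by (rule nd[OF local_frame(1)[OF d p] inQ[OF z]])
          (use 0 in \<open>simp add: comps[OF z local_frame(1)[OF d p] local_frame(2)[OF d p]]\<close>)
      then have "(\<Sum>i\<in>UNIV. x i *\<^sub>R fr i) = 0"
        using local_frame(2)[OF d p, of "\<Sum>i\<in>UNIV. x i *\<^sub>R fr i"] by simp
      then show ?thesis using comb[of x] by (auto simp: fun_eq_iff)
    qed
    have "\<exists>u. (\<forall>i. smooth_on ?S (\<lambda>z. u z i)) \<and> (\<forall>z\<in>?S. \<forall>j. (\<Sum>i\<in>UNIV. u z i * G z i j) = w z j)"
    proof (rule smooth_linear_system[OF open_image[OF d] sG sw])
      fix u :: "'e \<Rightarrow> 'm \<Rightarrow> real"
      assume "\<And>i. smooth_on ?S (\<lambda>z. u z i)" "\<And>z j. z \<in> ?S \<Longrightarrow> (\<Sum>i\<in>UNIV. u z i * G z i j) = w z j"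
      then show ?thesis by (intro exI[of _ u] conjI allI ballI)
    qed (rule inj)
    then obtain u where u: "\<And>i. smooth_on ?S (\<lambda>z. u z i)"
      "\<And>z j. z \<in> ?S \<Longrightarrow> (\<Sum>i\<in>UNIV. u z i * G z i j) = w z j"
      by blast
    obtain N f where N: "snd d q \<in> N" and f: "bump_at B d N f" using bump_exists[OF d q] by blast
    let ?W = "ext_field B d f (\<lambda>z. \<Sum>i\<in>UNIV. u z i *\<^sub>R fr i)"
    have W: "?W \<in> VF"
      by (rule vf_ext_field[OF d f]) (intro smooth_on_sum smooth_on_scaleR u smooth_on_const open_image d)
    have "\<omega> ?W Y (chart_inv d z) = \<theta> Y (chart_inv d z)" if z: "z \<in> N" and Y: "Y \<in> VF" for z Y
    proof -
      have z': "z \<in> ?S" using bump_subset[OF f] z by blast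
      have "?W (chart_inv d z) d = (\<Sum>i\<in>UNIV. u z i *\<^sub>R fr i)"
        using z' d bump_one[OF f z] by (simp add: ext_field_at)
      from comps[OF z' W this Y] show ?thesis
        using exp[OF t d Y chart_inv_in[OF z']] by (simp add: u(2)[OF z'] w_def)
    qed
    then show ?thesis using W N bump_open[OF f] bump_subset[OF f] by blast
  qed
  define good where "good q W d N \<longleftrightarrow> W \<in> VF \<and> d \<in> B \<and> open N \<and> N \<subseteq> chart_image d \<and> q \<in> fst d \<and>
      snd d q \<in> N \<and> (\<forall>z\<in>N. \<forall>Y\<in>VF. \<omega> W Y (chart_inv d z) = \<theta> Y (chart_inv d z))" for q W d N
  have "\<exists>W d N. good q W d N" if "q \<in> Q" for q
    using local that unfolding carrier_iff good_def by meson
  then obtain W d N where good: "\<And>q. q \<in> Q \<Longrightarrow> good q (W q) (d q) (N q)"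
    by metis
  then have W: "\<And>q. q \<in> Q \<Longrightarrow> W q \<in> VF" "\<And>q. q \<in> Q \<Longrightarrow> d q \<in> B"
    "\<And>q. q \<in> Q \<Longrightarrow> open (N q)" "\<And>q. q \<in> Q \<Longrightarrow> N q \<subseteq> chart_image (d q)"
    "\<And>q. q \<in> Q \<Longrightarrow> q \<in> fst (d q)" "\<And>q. q \<in> Q \<Longrightarrow> snd (d q) q \<in> N q"
    "\<And>q z Y. q \<in> Q \<Longrightarrow> z \<in> N q \<Longrightarrow> Y \<in> VF \<Longrightarrow> \<omega> (W q) Y (chart_inv (d q) z) = \<theta> Y (chart_inv (d q) z)"
    unfolding good_def by simp_all
  \<comment> \<open>At \<open>q\<close> the value is taken from a solution valid near
    \<open>q\<close>. Pointwise uniqueness shows that around \<open>q\<close> the single field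
    \<open>W q\<close> gives all these values, so \<open>U\<close> is smooth.\<close>
  define U where "U q = (if q \<in> Q then W q q else 0)" for q
  have at: "\<omega> (W q) Y q = \<theta> Y q" if "q \<in> Q" "Y \<in> VF" for q Y
    using W(7)[OF that(1) W(6)[OF that(1)] that(2)] W(2,5)[OF that(1)] by simp
  have near: "U (chart_inv (d q) z) = W q (chart_inv (d q) z)" if q: "q \<in> Q" and z: "z \<in> N q" for q z
  proof -
    let ?p = "chart_inv (d q) z"
    have p: "?p \<in> Q" using W(2,4)[OF q] z by (simp add: subset_iff)
    have "W ?p ?p = W q ?p"
      by (rule unique[OF W(1)[OF p] W(1)[OF q] p]) (simp add: at[OF p] W(7)[OF q z])
    then show ?thesis using p by (simp add: U_def)
  qed
  have U: "U \<in> VF"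
  proof (rule vf_glue)
    fix q assume q: "q \<in> Q"
    show "\<exists>W\<in>VF. \<exists>d\<in>B. \<exists>N. open N \<and> N \<subseteq> chart_image d \<and> q \<in> fst d \<and> snd d q \<in> N \<and>
      (\<forall>z\<in>N. U (chart_inv d z) = W (chart_inv d z))"
      by (intro bexI[of _ "W q"] bexI[of _ "d q"] exI[of _ "N q"] conjI ballI near W q)
  qed (simp add: U_def)
  show thesis
  proof (rule that[OF U])
    fix Y q assume Y: "Y \<in> VF" and q: "q \<in> Q"
    have "\<omega> U Y q = \<omega> (W q) Y q"
      by (rule tensorial_point[OF t2[OF Y] U W(1)[OF q] q]) (simp add: U_def q)
    then show "\<omega> U Y q = \<theta> Y q" using at[OF q Y] by simp
  qed
qed

end

section \<open>The slit tangent bundle\<close>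

locale manifold =
  fixes M :: "'p topology" and A :: "('p, 'e::euclidean_space) atlas"
  assumes manifold: "smooth_manifold M A"
begin

lemma openin_chart: "c \<in> A \<Longrightarrow> openin M (fst c)"
  using manifold by (simp add: smooth_manifold_def)

lemma open_chart_image: "c \<in> A \<Longrightarrow> open (chart_image c)"
  using manifold by (simp add: smooth_manifold_def)

lemma chart_homeo: "c \<in> A \<Longrightarrow> homeomorphic_map (subtopology M (fst c)) (top_of_set (chart_image c)) (snd c)"
  using manifold by (simp add: smooth_manifold_def)

lemma topspace_chart: "c \<in> A \<Longrightarrow> topspace (subtopology M (fst c)) = fst c"
  using openin_subset[OF openin_chart[of c]] by auto

lemma open_chart_map:
  assumes c: "c \<in> A" and U: "openin M U" "U \<subseteq> fst c"
  shows "open (snd c ` U)"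
proof -
  have "openin (subtopology M (fst c)) U"
    using U by (metis inf.absorb1 openin_subtopology_Int)
  then have "openin (top_of_set (chart_image c)) (snd c ` U)"
    using homeomorphic_imp_open_map[OF chart_homeo[OF c]] by (simp add: open_map_def)
  then show ?thesis using open_chart_image[OF c] openin_open_trans by blast
qed

lemma inj_chart: "c \<in> A \<Longrightarrow> inj_on (snd c) (fst c)"
  using homeomorphic_imp_injective_map[OF chart_homeo] topspace_chart by metis

text \<open>The preimage \<open>K\<close> of a closed coordinate ball is compact, hence closed in
  the Hausdorff space \<open>M\<close>. Its complement is therefore open in every other chart, and
  the function vanishes there.\<close>

lemma manifold_bump:
  assumes c: "c \<in> A" and q: "q \<in> fst c"
  shows "\<exists>N f. snd c q \<in> N \<and> bump_at A c N f"
proof -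
  have inv: "chart_inv c (snd c p) = p" if "p \<in> fst c" for p
    using inj_chart[OF c] that by (simp add: chart_inv_def)
  have inv2: "snd c (chart_inv c z) = z" "chart_inv c z \<in> fst c" if "z \<in> chart_image c" for z
    using that inv by (auto simp: chart_image_def)
  have "snd c q \<in> chart_image c" using q by (auto simp: chart_image_def)
  then obtain r where r: "r > 0" "cball (snd c q) r \<subseteq> chart_image c"
    using open_chart_image[OF c] open_contains_cball by blast
  let ?D = "cball (snd c q) r"
  obtain b :: "'e \<Rightarrow> real" where b: "smooth_on UNIV b" "\<And>x. x \<notin> ?D \<Longrightarrow> b x = 0"
    "\<And>x. x \<in> ball (snd c q) (r/2) \<Longrightarrow> b x = 1"
    by (rule smooth_bump[OF r(1), of "snd c q"]) (blast intro: that)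
  define f where "f p = (if p \<in> fst c then b (snd c p) else 0)" for p
  define K where "K = chart_inv c ` ?D"
  have K: "K \<subseteq> fst c" "snd c ` K = ?D"
    using r inv2 by (auto simp: K_def image_image subset_iff)
  have "compactin (top_of_set (chart_image c)) (snd c ` K)"
    using r K by (simp add: compactin_subtopology)
  then have "compactin (subtopology M (fst c)) K"
    using homeomorphic_map_compactness[OF chart_homeo[OF c], of K] K openin_subset[OF openin_chart[OF c]] by auto
  then have "compactin M K" by (simp add: compactin_subtopology)
  then have Kc: "closedin M K"
    using manifold by (intro compactin_imp_closedin) (auto simp: smooth_manifold_def)
  have fK: "f p = 0" if "p \<notin> K" for p
  proof -
    have "snd c p \<notin> ?D" if "p \<in> fst c"
      using \<open>p \<notin> K\<close> inv[OF that] by (metis K_def imageI)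
    then show ?thesis using b(2) by (auto simp: f_def)
  qed
  have "bump_at A c (ball (snd c q) (r/2)) f"
    unfolding bump_at_def
  proof (intro conjI ballI impI)
    have sub: "ball (snd c q) (r/2) \<subseteq> ?D" using r by auto
    then show "ball (snd c q) (r/2) \<subseteq> chart_image c" using r by blast
    then show "f (chart_inv c z) = 1" if "z \<in> ball (snd c q) (r/2)" for z
      using that b(3) inv2 by (auto simp: f_def subset_iff)
    show "smooth_on (chart_image c) (f \<circ> chart_inv c)"
      by (rule smooth_on_cong[OF open_chart_image[OF c] smooth_on_subset[OF b(1)]])
        (auto simp: f_def inv2)
  next
    fix c' z assume c': "c' \<in> A" and z: "z \<in> chart_image c'" "chart_inv c' z \<notin> fst c"
    have inv': "chart_inv c' (snd c' p) = p" if "p \<in> fst c'" for p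
      using inj_chart[OF c'] that by (simp add: chart_inv_def)
    let ?O = "snd c' ` (fst c' - K)"
    have "open ?O"
      by (rule open_chart_map[OF c' openin_diff[OF openin_chart[OF c'] Kc]]) auto
    moreover have "z \<in> ?O"
      using z K inv' by (auto simp: chart_image_def)
    moreover have "?O \<subseteq> chart_image c'" by (auto simp: chart_image_def)
    moreover have "\<forall>y\<in>?O. f (chart_inv c' y) = 0" using inv' fK by auto
    ultimately show "\<exists>O'. open O' \<and> z \<in> O' \<and> O' \<subseteq> chart_image c' \<and> (\<forall>y\<in>O'. f (chart_inv c' y) = 0)"
      by blast
  qed auto
  then show ?thesis using r(1) by (intro exI[of _ "ball (snd c q) (r/2)"] exI[of _ f]) simp
qed

sublocale base: bump_atlas A
proof
  show "open (snd d ` (fst d \<inter> fst c))" if "d \<in> A" "c \<in> A" for d c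
    using that by (intro open_chart_map openin_Int openin_chart) auto
  show "smooth_on (snd d ` (fst d \<inter> fst c)) (snd c \<circ> chart_inv d)" if "d \<in> A" "c \<in> A" for d c
    using manifold that by (simp add: smooth_manifold_def)
qed (use inj_chart open_chart_image manifold_bump in auto)

section \<open>Charts of the slit tangent bundle and their coordinate changes\<close>

definition slit_chart :: "('p, 'e) chart \<Rightarrow> (('p, 'e) tpoint, 'e \<times> 'e) chart" where
  "slit_chart c = ({(p, v). p \<in> fst c \<and> v \<in> tangent_space A p \<and> v \<noteq> 0}, \<lambda>(p, v). (snd c p, v c))"

lemma slit_atlas_eq: "slit_atlas A = slit_chart ` A"
  unfolding slit_atlas_def tangent_atlas_def image_image
  by (rule image_cong) (auto simp: slit_chart_def induced_chart_def)

lemma slit_chart_dom: "q \<in> fst (slit_chart c) \<longleftrightarrow> fst q \<in> fst c \<and> snd q \<in> tangent_space A (fst q) \<and> snd q \<noteq> 0"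
  by (cases q) (simp add: slit_chart_def)

lemma slit_chart_map: "snd (slit_chart c) q = (snd c (fst q), snd q c)"
  by (cases q) (simp add: slit_chart_def)

lemma zero_tangent: "0 \<in> tangent_space A p"
  using base.vf_tangent[OF base.vf_zero, of p] by simp

lemma tangent_zero_iff:
  "v \<in> tangent_space A p \<Longrightarrow> c \<in> A \<Longrightarrow> p \<in> fst c \<Longrightarrow> v c = 0 \<longleftrightarrow> v = 0"
  using base.tangent_eqI[OF _ zero_tangent, of v p c] by auto

lemma tangent_exists:
  assumes c: "c \<in> A" "p \<in> fst c"
  obtains v where "v \<in> tangent_space A p" "v c = w"
proof
  show "base.local_frame c p w p \<in> tangent_space A p" by (rule base.vf_tangent[OF base.local_frame(1)[OF c]])
  show "base.local_frame c p w p c = w" by (rule base.local_frame(2)[OF c])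
qed

text \<open>Every nonzero component vector belongs to a nonzero tangent vector, so overlaps contain
  full slit fibres.\<close>

lemma slit_overlap:
  assumes c: "c \<in> A"
  shows "snd (slit_chart c) ` (fst (slit_chart c) \<inter> fst (slit_chart c')) =
    (snd c ` (fst c \<inter> fst c')) \<times> (- {0})" (is "?L = ?R")
proof
  show "?L \<subseteq> ?R" using tangent_zero_iff[OF _ c] by (auto simp: slit_chart_dom slit_chart_map)
  show "?R \<subseteq> ?L"
  proof
    fix z assume "z \<in> ?R"
    then obtain p y where z: "z = (snd c p, y)" and p: "p \<in> fst c" "p \<in> fst c'" and y: "y \<noteq> 0" by auto
    obtain v where v: "v \<in> tangent_space A p" "v c = y" using tangent_exists[OF c p(1)] .
    then have "v \<noteq> 0" using y by auto
    then show "z \<in> ?L"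
      unfolding z using v p by (intro image_eqI[of _ _ "(p, v)"]) (auto simp: slit_chart_dom slit_chart_map)
  qed
qed

lemma slit_image: "c \<in> A \<Longrightarrow> chart_image (slit_chart c) = chart_image c \<times> (- {0})"
  using slit_overlap[of c c] by (simp add: chart_image_def)

lemma slit_inj: "c \<in> A \<Longrightarrow> inj_on (snd (slit_chart c)) (fst (slit_chart c))"
proof (rule inj_onI)
  fix q q' assume c: "c \<in> A" and q: "q \<in> fst (slit_chart c)" "q' \<in> fst (slit_chart c)"
    and eq: "snd (slit_chart c) q = snd (slit_chart c) q'"
  have 1: "fst q = fst q'"
    using inj_onD[OF inj_chart[OF c]] q eq by (auto simp: slit_chart_dom slit_chart_map)
  then have "snd q = snd q'"
    using base.tangent_eqI[of "snd q" "fst q" "snd q'" c] q eq c by (auto simp: slit_chart_dom slit_chart_map)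
  with 1 show "q = q'" by (simp add: prod_eq_iff)
qed

lemma slit_chart_inv:
  assumes c: "c \<in> A" and z: "x \<in> chart_image c" "y \<noteq> 0"
  shows "fst (chart_inv (slit_chart c) (x, y)) = chart_inv c x"
    "snd (chart_inv (slit_chart c) (x, y)) \<in> tangent_space A (chart_inv c x)"
    "snd (chart_inv (slit_chart c) (x, y)) c = y"
proof -
  obtain v where v: "v \<in> tangent_space A (chart_inv c x)" "v c = y"
    using tangent_exists[OF c base.chart_inv_in[OF z(1)]] .
  let ?q = "(chart_inv c x, v)"
  have "?q \<in> fst (slit_chart c)" using z v c by (auto simp: slit_chart_dom)
  moreover have "snd (slit_chart c) ?q = (x, y)" using z v by (simp add: slit_chart_map)
  ultimately have "chart_inv (slit_chart c) (x, y) = ?q"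
    using slit_inj[OF c] unfolding chart_inv_def by (metis inv_into_f_f)
  then show "fst (chart_inv (slit_chart c) (x, y)) = chart_inv c x"
    "snd (chart_inv (slit_chart c) (x, y)) \<in> tangent_space A (chart_inv c x)"
    "snd (chart_inv (slit_chart c) (x, y)) c = y" using v by auto
qed

lemma slit_trans:
  assumes c: "c \<in> A" and c': "c' \<in> A" and x: "x \<in> snd c ` (fst c \<inter> fst c')" and y: "y \<noteq> 0"
  shows "(snd (slit_chart c') \<circ> chart_inv (slit_chart c)) (x, y) =
    ((snd c' \<circ> chart_inv c) x, fd (snd c' \<circ> chart_inv c) x y)"
proof -
  have x': "x \<in> chart_image c" "chart_inv c x \<in> fst c'" using x unfolding base.overlap_iff[OF c] by simp_all
  note i = slit_chart_inv[OF c x'(1) y]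
  have "snd (chart_inv (slit_chart c) (x, y)) c' = trans_deriv c c' (chart_inv c x) y"
    using base.tangent_trans[OF i(2) c c' base.chart_inv_in[OF x'(1)] x'(2)] i(3) by simp
  then show ?thesis using i(1) x'(1) by (simp add: slit_chart_map trans_deriv_def)
qed

lemma smooth_on_tangent_map:
  fixes \<phi> :: "'e \<Rightarrow> 'e"
  assumes U: "open U" and \<phi>: "smooth_on U \<phi>"
  shows "smooth_on (U \<times> UNIV) (\<lambda>z. (\<phi> (fst z), fd \<phi> (fst z) (snd z)))"
proof -
  have O: "open (U \<times> (UNIV :: 'e set))" using U by (intro open_Times) auto
  have c: "smooth_on (U \<times> (UNIV :: 'e set)) (\<lambda>z. g (fst z))" if "smooth_on U g" for g :: "'e \<Rightarrow> 'e"
    by (rule smooth_on_compose[OF O that smooth_on_fst[OF O smooth_on_ident]]) auto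
  have "smooth_on (U \<times> UNIV) (\<lambda>z. \<Sum>b\<in>Basis. (snd z \<bullet> b) *\<^sub>R fd \<phi> (fst z) b)"
    by (intro smooth_on_sum smooth_on_scaleR smooth_on_inner smooth_on_snd smooth_on_ident smooth_on_const O
        c smooth_on_fd \<phi>)
  then have "smooth_on (U \<times> UNIV) (\<lambda>z. fd \<phi> (fst z) (snd z))"
    by (rule smooth_on_cong[OF O])
      (auto intro!: linear_expand_Basis linear_frechet_derivative smooth_on_differentiable[OF \<phi>])
  then show ?thesis by (intro smooth_on_Pair O c \<phi>)
qed

text \<open>Coordinate changes are pairs of a base change and its derivative acting on the fibre. A
  point of the bundle leaves a chart only when its base point does, so a base bump composed with the
  projection satisfies \<open>bump_at\<close>.\<close>

sublocale bump_atlas "slit_atlas A"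
proof
  fix d assume "d \<in> slit_atlas A"
  then obtain c where c: "c \<in> A" "d = slit_chart c" unfolding slit_atlas_eq by blast
  show "inj_on (snd d) (fst d)" using slit_inj c by simp
  show "open (chart_image d)"
    using c by (auto simp: slit_image intro!: open_Times open_chart_image)
  show "open (snd d ` (fst d \<inter> fst d'))" "smooth_on (snd d ` (fst d \<inter> fst d')) (snd d' \<circ> chart_inv d)"
    if d': "d' \<in> slit_atlas A" for d'
  proof -
    obtain c' where c': "c' \<in> A" "d' = slit_chart c'" using d' unfolding slit_atlas_eq by blast
    let ?U = "snd c ` (fst c \<inter> fst c')"
    have U: "snd d ` (fst d \<inter> fst d') = ?U \<times> (- {0})" using slit_overlap c c' by simp
    have oU: "open ?U" by (rule base.open_overlap[OF c(1) c'(1)])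
    show 1: "open (snd d ` (fst d \<inter> fst d'))"
      unfolding U using oU by (intro open_Times) auto
    have "smooth_on (?U \<times> - {0}) (\<lambda>z. ((snd c' \<circ> chart_inv c) (fst z), fd (snd c' \<circ> chart_inv c) (fst z) (snd z)))"
      by (rule smooth_on_subset[OF smooth_on_tangent_map[OF oU base.smooth_trans[OF c(1) c'(1)]]]) auto
    then show "smooth_on (snd d ` (fst d \<inter> fst d')) (snd d' \<circ> chart_inv d)"
      unfolding U
    proof (rule smooth_on_cong[OF 1[unfolded U]])
      fix z :: "'e \<times> 'e" assume "z \<in> ?U \<times> - {0}"
      then have z: "fst z \<in> ?U" "snd z \<noteq> 0" by auto
      show "(snd d' \<circ> chart_inv d) z = ((snd c' \<circ> chart_inv c) (fst z), fd (snd c' \<circ> chart_inv c) (fst z) (snd z))"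
        using slit_trans[OF c(1) c'(1) z] c c' by simp
    qed
  qed
  show "\<exists>N f. snd d q \<in> N \<and> bump_at (slit_atlas A) d N f" if q: "q \<in> fst d" for q
  proof -
    have "fst q \<in> fst c" using q c by (simp add: slit_chart_dom)
    then obtain N f where N: "snd c (fst q) \<in> N" and f: "bump_at A c N f"
      using base.bump_exists[OF c(1)] by blast
    have f': "open N" "N \<subseteq> chart_image c" "\<And>z. z \<in> N \<Longrightarrow> f (chart_inv c z) = 1"
      "smooth_on (chart_image c) (f \<circ> chart_inv c)"
      using f by (auto simp: bump_at_def)
    have "bump_at (slit_atlas A) d (N \<times> - {0}) (f \<circ> fst)"
      unfolding bump_at_def
    proof (intro conjI ballI impI)
      show "open (N \<times> - {0::'e})" using f' by (intro open_Times) auto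
      show "N \<times> - {0} \<subseteq> chart_image d" using f' c by (auto simp: slit_image)
      show "(f \<circ> fst) (chart_inv d z) = 1" if "z \<in> N \<times> - {0}" for z
      proof -
        have z: "fst z \<in> N" "fst z \<in> chart_image c" "snd z \<noteq> 0" using that f' by auto
        show ?thesis using f'(3)[OF z(1)] slit_chart_inv(1)[OF c(1) z(2,3)] c by simp
      qed
      have O: "open (chart_image c \<times> - {0::'e})" using open_chart_image c by (intro open_Times) auto
      have "smooth_on (chart_image c \<times> - {0::'e}) (\<lambda>z. (f \<circ> chart_inv c) (fst z))"
        by (rule smooth_on_compose[OF O f'(4) smooth_on_fst[OF O smooth_on_ident]]) auto
      then show "smooth_on (chart_image d) ((f \<circ> fst) \<circ> chart_inv d)"
        unfolding c slit_image[OF c(1)]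
      proof (rule smooth_on_cong[OF O])
        fix z :: "'e \<times> 'e" assume "z \<in> chart_image c \<times> - {0}"
        then have z: "fst z \<in> chart_image c" "snd z \<noteq> 0" by auto
        show "(f \<circ> fst \<circ> chart_inv (slit_chart c)) z = (f \<circ> chart_inv c) (fst z)"
          using slit_chart_inv(1)[OF c(1) z] by simp
      qed
    next
      fix d' z assume "d' \<in> slit_atlas A" and z: "z \<in> chart_image d'" "chart_inv d' z \<notin> fst d"
      then obtain c' where c': "c' \<in> A" "d' = slit_chart c'" unfolding slit_atlas_eq by blast
      obtain x y where xy: "z = (x, y)" "x \<in> chart_image c'" "y \<noteq> 0"
        using z c' by (auto simp: slit_image)
      note i = slit_chart_inv[OF c'(1) xy(2,3)]
      have "snd (chart_inv d' z) \<noteq> 0" using i(3) xy c' by auto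
      then have "chart_inv c' x \<notin> fst c"
        using i z c c' xy by (auto simp: slit_chart_dom)
      then obtain O' where O': "open O'" "x \<in> O'" "O' \<subseteq> chart_image c'" "\<forall>y\<in>O'. f (chart_inv c' y) = 0"
        using f c'(1) xy(2) unfolding bump_at_def by meson
      show "\<exists>O'. open O' \<and> z \<in> O' \<and> O' \<subseteq> chart_image d' \<and> (\<forall>y\<in>O'. (f \<circ> fst) (chart_inv d' y) = 0)"
      proof (intro exI[of _ "O' \<times> - {0}"] conjI ballI)
        show "open (O' \<times> - {0::'e})" using O' by (intro open_Times) auto
        show "z \<in> O' \<times> - {0}" using O' xy by simp
        show "O' \<times> - {0} \<subseteq> chart_image d'" using O' c' by (auto simp: slit_image)
        show "(f \<circ> fst) (chart_inv d' y) = 0" if "y \<in> O' \<times> - {0}" for y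
        proof -
          have y: "fst y \<in> O'" "fst y \<in> chart_image c'" "snd y \<noteq> 0" using that O' by auto
          then show ?thesis using bspec[OF O'(4) y(1)] slit_chart_inv(1)[OF c'(1) y(2,3)] c' by simp
        qed
      qed
    qed
    moreover have "snd d q \<in> N \<times> - {0}"
      using N q c tangent_zero_iff[OF _ c(1)] by (auto simp: slit_chart_dom slit_chart_map)
    ultimately show ?thesis by (intro exI[of _ "N \<times> - {0}"] exI[of _ "f \<circ> fst"] conjI)
  qed
qed

text \<open>The Jacobian is block triangular with equal diagonal blocks; its remaining block,
  containing second derivatives of the base change, does not affect \<open>J\<close> or
  \<open>C\<close>. Equality of the diagonal blocks makes \<open>J\<close> independent of the
  chart.\<close>

lemma slit_trans_deriv:
  assumes c: "c \<in> A" and c': "c' \<in> A" and q: "q \<in> fst (slit_chart c)" "q \<in> fst (slit_chart c')"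
  shows "fst (trans_deriv (slit_chart c) (slit_chart c') q u) = trans_deriv c c' (fst q) (fst u)"
    "trans_deriv (slit_chart c) (slit_chart c') q (0, b) = (0, trans_deriv c c' (fst q) b)"
proof -
  let ?\<phi> = "snd c' \<circ> chart_inv c" and ?\<Psi> = "snd (slit_chart c') \<circ> chart_inv (slit_chart c)"
  let ?U = "snd c ` (fst c \<inter> fst c')"
  define x y where "x = snd c (fst q)" and "y = snd q c"
  have xy: "snd (slit_chart c) q = (x, y)" by (simp add: slit_chart_map x_def y_def)
  have xU: "x \<in> ?U" "y \<noteq> 0" using q tangent_zero_iff[OF _ c] by (auto simp: slit_chart_dom x_def y_def)
  have O: "open (?U \<times> - {0::'e})" using base.open_overlap[OF c c'] by (intro open_Times) auto
  have sl: "slit_chart c \<in> slit_atlas A" "slit_chart c' \<in> slit_atlas A" using c c' by (auto simp: slit_atlas_eq)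
  have D\<phi>: "(?\<phi> has_derivative trans_deriv c c' (fst q)) (at x)"
    unfolding x_def by (rule base.trans_derivative[OF c c']) (use q in \<open>auto simp: slit_chart_dom\<close>)
  have D\<Psi>: "(?\<Psi> has_derivative trans_deriv (slit_chart c) (slit_chart c') q) (at (x, y))"
    unfolding xy[symmetric] by (rule trans_derivative[OF sl q])
  have "((\<lambda>z. fst (?\<Psi> z)) has_derivative (\<lambda>u. trans_deriv c c' (fst q) (fst u))) (at (x, y))"
  proof (rule has_derivative_transform_within_open[OF _ O])
    have "(fst has_derivative fst) (at (x, y))" by (auto intro!: derivative_eq_intros)
    from diff_chain_at[OF this, of ?\<phi>] D\<phi>
    show "(?\<phi> \<circ> fst has_derivative (\<lambda>u. trans_deriv c c' (fst q) (fst u))) (at (x, y))"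
      by (simp add: o_def)
    show "(?\<phi> \<circ> fst) z = fst (?\<Psi> z)" if "z \<in> ?U \<times> - {0}" for z
    proof -
      have z: "fst z \<in> ?U" "snd z \<noteq> 0" using that by auto
      show ?thesis using slit_trans[OF c c' z] by simp
    qed
  qed (use xU in auto)
  moreover have "((\<lambda>z. fst (?\<Psi> z)) has_derivative (\<lambda>u. fst (trans_deriv (slit_chart c) (slit_chart c') q u))) (at (x, y))"
    by (rule has_derivative_fst[OF D\<Psi>])
  ultimately have "(\<lambda>u. trans_deriv c c' (fst q) (fst u)) = (\<lambda>u. fst (trans_deriv (slit_chart c) (slit_chart c') q u))"
    by (rule has_derivative_unique)
  from fun_cong[OF this, of u]
  show "fst (trans_deriv (slit_chart c) (slit_chart c') q u) = trans_deriv c c' (fst q) (fst u)" by simp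
  have bl: "bounded_linear (trans_deriv c c' (fst q))" using D\<phi> by (rule has_derivative_bounded_linear)
  have fdx: "fd ?\<phi> x = trans_deriv c c' (fst q)" by (simp add: trans_deriv_def x_def)
  \<comment> \<open>Along a fixed fibre the coordinate change is linear, hence its own derivative
    there.\<close>
  have "((\<lambda>y'. ?\<Psi> (x, y')) has_derivative (\<lambda>b. (0, trans_deriv c c' (fst q) b))) (at y)"
  proof (rule has_derivative_transform_within_open[of _ _ _ _ "- {0}"])
    show "((\<lambda>y'. (?\<phi> x, trans_deriv c c' (fst q) y')) has_derivative (\<lambda>b. (0, trans_deriv c c' (fst q) b))) (at y)"
      by (intro has_derivative_Pair has_derivative_const bounded_linear_imp_has_derivative bl)
  qed (use xU slit_trans[OF c c' xU(1)] fdx in \<open>auto simp del: o_apply\<close>)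
  moreover have "((\<lambda>y'. ?\<Psi> (x, y')) has_derivative (\<lambda>b. trans_deriv (slit_chart c) (slit_chart c') q (0, b))) (at y)"
  proof -
    have "((\<lambda>y'. (x, y')) has_derivative (\<lambda>b. (0, b))) (at y)" by (auto intro!: derivative_eq_intros)
    from diff_chain_at[OF this D\<Psi>] show ?thesis by (simp add: o_def)
  qed
  ultimately have "(\<lambda>b. (0, trans_deriv c c' (fst q) b)) = (\<lambda>b. trans_deriv (slit_chart c) (slit_chart c') q (0, b))"
    by (rule has_derivative_unique)
  from fun_cong[OF this, of b]
  show "trans_deriv (slit_chart c) (slit_chart c') q (0, b) = (0, trans_deriv c c' (fst q) b)" by simp
qed

section \<open>The almost tangent structure, the Liouville field and their brackets\<close>

abbreviation "C \<equiv> liouville (slit_atlas A)"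

lemma vf_J:
  assumes X: "X \<in> VF" shows "J X \<in> VF"
proof (rule vfI)
  fix q show "J X q \<in> tangent_space (slit_atlas A) q"
    unfolding tangent_space_iff
  proof (intro conjI ballI impI allI)
    fix d d' assume d: "d \<in> slit_atlas A" "q \<in> fst d" and d': "d' \<in> slit_atlas A" "q \<in> fst d'"
    obtain c c' where c: "c \<in> A" "d = slit_chart c" and c': "c' \<in> A" "d' = slit_chart c'"
      using d(1) d'(1) unfolding slit_atlas_eq by blast
    show "J X q d' = trans_deriv d d' q (J X q d)"
      using slit_trans_deriv[OF c(1) c'(1), of q] vf_trans[OF X d(1) d'(1) d(2) d'(2)] d d' c c'
      by (simp add: J_def)
  qed (simp add: J_def vf_outside[OF X] zero_prod_def)
next
  fix d assume d: "d \<in> slit_atlas A"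
  have "smooth_on (chart_image d) (\<lambda>z. (0, fst (field_in d X z)))"
    by (intro smooth_on_Pair smooth_on_const smooth_on_fst open_image d vf_smooth X)
  then show "smooth_on (chart_image d) (field_in d (J X))"
    by (simp add: J_def field_in_def)
qed

lemma vf_C: "C \<in> VF"
proof (rule vfI)
  fix q show "C q \<in> tangent_space (slit_atlas A) q"
    unfolding tangent_space_iff
  proof (intro conjI ballI impI allI)
    fix d d' assume d: "d \<in> slit_atlas A" "q \<in> fst d" and d': "d' \<in> slit_atlas A" "q \<in> fst d'"
    obtain c c' where c: "c \<in> A" "d = slit_chart c" and c': "c' \<in> A" "d' = slit_chart c'"
      using d(1) d'(1) unfolding slit_atlas_eq by blast
    have "snd q c' = trans_deriv c c' (fst q) (snd q c)"
      by (rule base.tangent_trans) (use d d' c c' in \<open>auto simp: slit_chart_dom\<close>)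
    then show "C q d' = trans_deriv d d' q (C q d)"
      using slit_trans_deriv(2)[OF c(1) c'(1), of q] d d' c c'
      by (simp add: liouville_def slit_chart_map)
  qed (auto simp: liouville_def)
next
  fix d assume d: "d \<in> slit_atlas A"
  have "smooth_on (chart_image d) (\<lambda>z. (0, snd z))"
    by (intro smooth_on_Pair smooth_on_const smooth_on_snd smooth_on_ident open_image d)
  then show "smooth_on (chart_image d) (field_in d C)"
    by (rule smooth_on_cong[OF open_image[OF d]]) (simp add: liouville_def field_in_def d)
qed

lemma J_add: "J (X + Y) = J X + J Y"
  by (simp add: J_def fun_eq_iff)

lemma J_minus: "J (- X) = - J X"
  by (simp add: J_def fun_eq_iff)

lemma J_diff: "J (X - Y) = J X - J Y"
  by (simp add: J_def fun_eq_iff)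

lemma J_zero: "J 0 = 0"
  by (simp add: J_def fun_eq_iff zero_prod_def)

lemma J_fscale: "J (fscale f X) = fscale f (J X)"
  by (simp add: J_def fun_eq_iff fscale_def)

lemma J_J: "J (J X) = 0"
  by (simp add: J_def fun_eq_iff zero_prod_def)

lemma J_C: "J C = 0"
  by (simp add: J_def fun_eq_iff liouville_def zero_prod_def)

lemmas J_simps = J_add J_minus J_diff J_zero J_fscale J_J J_C

lemma field_derivative:
  "X \<in> VF \<Longrightarrow> d \<in> slit_atlas A \<Longrightarrow> q \<in> fst d \<Longrightarrow>
    (field_in d X has_derivative fd (field_in d X) (snd d q)) (at (snd d q))"
  by (rule smooth_on_derivative[OF vf_smooth]) auto

lemma fd_field_J:
  assumes "X \<in> VF" "d \<in> slit_atlas A" "q \<in> fst d"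
  shows "fd (field_in d (J X)) (snd d q) v = (0, fst (fd (field_in d X) (snd d q) v))"
proof -
  have "field_in d (J X) = (\<lambda>z. (0, fst (field_in d X z)))" by (simp add: field_in_def J_def)
  then show ?thesis
    using fun_cong[OF frechet_derivative_at[OF has_derivative_Pair[OF has_derivative_const[of 0]
          has_derivative_fst[OF field_derivative[OF assms]]], symmetric]] by simp
qed

lemma fd_field_C:
  assumes "d \<in> slit_atlas A" "q \<in> fst d"
  shows "fd (field_in d C) (snd d q) v = (0, snd v)"
proof -
  have "(field_in d C has_derivative (\<lambda>v. (0, snd v))) (at (snd d q))"
    by (rule has_derivative_transform_within_open[of "\<lambda>z. (0, snd z)" _ _ _ "chart_image d"])
      (use assms open_image in \<open>auto intro!: derivative_eq_intros simp: field_in_def liouville_def\<close>)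
  from frechet_derivative_at[OF this] show ?thesis by metis
qed

lemma vf_components_eqI:
  assumes "\<And>q d. d \<in> slit_atlas A \<Longrightarrow> q \<in> fst d \<Longrightarrow> X q d = Y q d" "X \<in> VF" "Y \<in> VF"
  shows "X = Y"
  by (rule vf_eqI[OF assms(2,3)]) (metis carrier_iff vf_point_eqI assms)

text \<open>The Nijenhuis tensor of \<open>J\<close> vanishes, because \<open>J\<close> has constant
  coefficients in induced charts; its fourth term drops by J^2 = 0.\<close>

lemma br_J_J:
  assumes "X \<in> VF" "Y \<in> VF"
  shows "br (J X) (J Y) = J (br (J X) Y) + J (br X (J Y))"
proof (rule vf_components_eqI)
  fix q d assume d: "d \<in> slit_atlas A" "q \<in> fst d"
  show "br (J X) (J Y) q d = (J (br (J X) Y) + J (br X (J Y))) q d"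
    using d fd_field_J[OF assms(1) d] fd_field_J[OF assms(2) d] by (simp add: bracket_def J_def)
qed (use assms in \<open>simp_all add: vf_intros vf_J\<close>)

text \<open>The Lie derivative of \<open>J\<close> along \<open>C\<close> is -J: coefficients stay
  constant while \<partial>/\<partial>y scales with weight -1.\<close>

lemma br_C_J:
  assumes "X \<in> VF"
  shows "br C (J X) = J (br C X) - J X"
proof (rule vf_components_eqI)
  fix q d assume d: "d \<in> slit_atlas A" "q \<in> fst d"
  show "br C (J X) q d = (J (br C X) - J X) q d"
    using d fd_field_J[OF assms(1) d] fd_field_C[OF d] by (simp add: bracket_def J_def)
qed (use assms in \<open>simp_all add: vf_intros vf_J vf_C\<close>)

text \<open>The base component of \<open>S\<close> is \<open>y\<close>, so its derivative along
  \<open>V\<close> is the fibre component of \<open>V\<close>; the base component of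
  \<open>V\<close> is identically zero and contributes nothing.\<close>

lemma J_br_spray:
  assumes V: "V \<in> VF" "J V = 0" and S: "S \<in> VF" "J S = C"
  shows "J (br V S) = V"
proof (rule vf_components_eqI)
  fix q d assume d: "d \<in> slit_atlas A" "q \<in> fst d"
  have V0: "fst (V q d) = 0" for q d using fun_cong[OF fun_cong[OF V(2)], of q d] by (simp add: J_def zero_prod_def)
  have S1: "fst (field_in d S z) = snd z" if "z \<in> chart_image d" for z
    using fun_cong[OF fun_cong[OF S(2)], of "chart_inv d z" d] d that by (simp add: J_def liouville_def field_in_def)
  have "((\<lambda>z. fst (field_in d S z)) has_derivative snd) (at (snd d q))"
    by (rule has_derivative_transform_within_open[of snd _ _ _ "chart_image d"])
      (use d open_image S1 in \<open>auto intro!: derivative_eq_intros\<close>)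
  from has_derivative_unique[OF this has_derivative_fst[OF field_derivative[OF S(1) d]]]
  have DS: "fst (fd (field_in d S) (snd d q) v) = snd v" for v by metis
  have "((\<lambda>z. fst (field_in d V z)) has_derivative (\<lambda>v. 0)) (at (snd d q))"
    using V0 by (simp add: field_in_def)
  from has_derivative_unique[OF this has_derivative_fst[OF field_derivative[OF V(1) d]]]
  have DV: "fst (fd (field_in d V) (snd d q) v) = 0" for v by metis
  show "J (br V S) q d = V q d"
    using d V0[of q d] by (simp add: bracket_def J_def DS DV prod_eq_iff)
qed (use assms in \<open>simp_all add: vf_intros vf_J\<close>)

text \<open>Homogeneity is given on the full tangent bundle, whose charts differ from the slit ones
  as objects. Their coordinate maps coincide and their inverses agree on the slit image, so the
  derivatives agree.\<close>

lemma dv_C_slit: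
  assumes E: "sm E" and h: "\<And>q. q \<in> carrier_of (tangent_atlas A) \<Longrightarrow>
     deriv_along (tangent_atlas A) (liouville (tangent_atlas A)) E q = 2 * E q" and q: "q \<in> Q"
  shows "dv C E q = 2 * E q"
proof -
  define t where "t = (SOME t. t \<in> tangent_atlas A \<and> q \<in> fst t)"
  obtain c0 where "c0 \<in> A" "q \<in> fst (slit_chart c0)" using q unfolding slit_atlas_eq carrier_of_def by blast
  then have ex: "induced_chart A c0 \<in> tangent_atlas A \<and> q \<in> fst (induced_chart A c0)"
    by (cases q) (auto simp: tangent_atlas_def induced_chart_def slit_chart_def)
  then have qt: "q \<in> carrier_of (tangent_atlas A)" by (auto simp: carrier_of_def)
  have t: "t \<in> tangent_atlas A" "q \<in> fst t" using someI[of "\<lambda>t. t \<in> tangent_atlas A \<and> q \<in> fst t", OF ex] by (auto simp: t_def)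
  obtain c where c: "c \<in> A" "t = induced_chart A c" using t by (auto simp: tangent_atlas_def)
  let ?d = "slit_chart c"
  have "snd q \<noteq> 0" using \<open>q \<in> fst (slit_chart c0)\<close> by (simp add: slit_chart_dom)
  then have d: "?d \<in> slit_atlas A" "q \<in> fst ?d" using c t(2)
    by (auto simp: slit_atlas_eq slit_chart_dom induced_chart_def)
  have sndt: "snd t = snd ?d" by (simp add: c induced_chart_def slit_chart_def)
  have inj: "inj_on (snd t) (fst t)"
  proof (rule inj_onI)
    fix r r' assume r: "r \<in> fst t" "r' \<in> fst t" "snd t r = snd t r'"
    have 1: "fst r = fst r'"
      using inj_onD[OF inj_chart[OF c(1)]] r by (auto simp: c induced_chart_def)
    then have "snd r = snd r'"
      using base.tangent_eqI[of "snd r" "fst r" "snd r'" c] r c(1) by (auto simp: c(2) induced_chart_def)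
    with 1 show "r = r'" by (simp add: prod_eq_iff)
  qed
  have inv: "chart_inv t z = chart_inv ?d z" if "z \<in> chart_image ?d" for z
  proof -
    have "chart_inv ?d z \<in> fst t"
      using chart_inv_in[OF that] by (auto simp: slit_chart_dom c induced_chart_def case_prod_beta)
    then show ?thesis
      using inj sndt chart_inv_right[OF that] unfolding chart_inv_def by (metis inv_into_f_f)
  qed
  have "fd (E \<circ> chart_inv t) (snd t q) = fd (E \<circ> chart_inv ?d) (snd ?d q)"
    unfolding sndt by (rule fd_eq_local[OF open_image[OF d(1)]]) (use d inv in auto)
  moreover have "liouville (tangent_atlas A) q t = C q ?d"
    using t d sndt by (simp add: liouville_def)
  ultimately have "deriv_along (tangent_atlas A) (liouville (tangent_atlas A)) E q = dv C E q"
    using d dv_chart[OF vf_C E d]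
    by (simp add: deriv_along_def[of "tangent_atlas A"] Let_def t_def[symmetric])
  then show ?thesis using h[OF qt] by simp
qed

end

section \<open>Finsler manifolds\<close>

text \<open>Cramer's rule runs over a finite index type; the sum type enumerates the basis of the
  model space of the slit bundle.\<close>

definition pair_frame :: "'n + 'n \<Rightarrow> (real^'n) \<times> (real^'n)" where
  "pair_frame s = (case s of Inl i \<Rightarrow> (axis i 1, 0) | Inr i \<Rightarrow> (0, axis i 1))"

lemma pair_frame: "bij_betw (pair_frame :: 'n::finite + 'n \<Rightarrow> _) UNIV Basis"
proof -
  have "inj (pair_frame :: 'n + 'n \<Rightarrow> _)"
    by (auto intro!: injI simp: pair_frame_def axis_eq_axis axis_eq_0_iff split: sum.splits)
  moreover have "range (pair_frame :: 'n + 'n \<Rightarrow> _) = Basis"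
  proof -
    have "range (pair_frame :: 'n + 'n \<Rightarrow> _) = range (\<lambda>i. pair_frame (Inl i)) \<union> range (\<lambda>i. pair_frame (Inr i))"
      by (auto simp: UNIV_sum image_Un image_image)
    also have "\<dots> = Basis"
      by (auto simp: pair_frame_def Basis_prod_def Basis_vec_def)
    finally show ?thesis .
  qed
  ultimately show ?thesis by (simp add: bij_betw_def)
qed

locale finsler =
  fixes M :: "'p topology" and A :: "('p, real^'n) atlas" and E :: "('p, real^'n) tpoint \<Rightarrow> real"
  assumes finsler: "finsler_manifold M A E"
begin

sublocale manifold M A
  using finsler by unfold_locales (simp add: finsler_manifold_def)

lemma sm_E: "sm E"
  using finsler by (simp add: finsler_manifold_def)

lemma dv_C_E: "q \<in> Q \<Longrightarrow> dv C E q = 2 * E q"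
  by (rule dv_C_slit[OF sm_E]) (use finsler in \<open>simp_all add: finsler_manifold_def\<close>)

lemma dv_dv_C_E: "X \<in> VF \<Longrightarrow> q \<in> Q \<Longrightarrow> dv X (dv C E) q = 2 * dv X E q"
  using dv_cong[of X "dv C E" q "\<lambda>q. 2 * E q"] by (simp add: sm_dv vf_C sm_E dv_C_E dv_cmult)

section \<open>The fundamental 2-form and its nondegeneracy\<close>

abbreviation "\<Omega> \<equiv> Omega A E"
abbreviation "\<theta> X \<equiv> dv (J X) E"

lemma Omega_eq: "\<Omega> X Y q = dv X (\<theta> Y) q - dv Y (\<theta> X) q - \<theta> (br X Y) q"
  by (simp add: Omega_def ext_deriv_def dJ_def)

lemmas vf_rules = vf_intros vf_J vf_C
lemmas sm_rules = sm_intros sm_dv sm_E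

lemma sm_Omega: "X \<in> VF \<Longrightarrow> Y \<in> VF \<Longrightarrow> sm (\<Omega> X Y)"
proof -
  assume "X \<in> VF" "Y \<in> VF"
  then have "sm (\<lambda>q. dv X (\<theta> Y) q - dv Y (\<theta> X) q - \<theta> (br X Y) q)"
    by (intro sm_rules vf_rules)
  then show ?thesis by (simp add: Omega_eq[abs_def])
qed

lemma Omega_anti: "X \<in> VF \<Longrightarrow> Y \<in> VF \<Longrightarrow> q \<in> Q \<Longrightarrow> \<Omega> X Y q = - \<Omega> Y X q"
  using br_anti[of X Y] by (simp add: Omega_eq J_minus dv_minus_field vf_rules sm_E)

text \<open>The term with the derivative of \<open>f\<close> along Y arises once from
  differentiating \<theta>(f X) and once from the bracket, with opposite signs.\<close>

lemma tensorial_Omega_left: "Y \<in> VF \<Longrightarrow> tensorial (\<lambda>X. \<Omega> X Y)"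
proof (rule tensorialI)
  assume Y: "Y \<in> VF"
  fix X assume X: "X \<in> VF"
  show "sm (\<Omega> X Y)" using X Y by (rule sm_Omega)
  fix q assume q: "q \<in> Q"
  show "\<Omega> (X + X') Y q = \<Omega> X Y q + \<Omega> X' Y q" if "X' \<in> VF" for X'
    using X Y q that
    by (simp add: Omega_eq J_add br_add_left dv_add_field dv_dv_add vf_rules sm_rules)
  show "\<Omega> (fscale f X) Y q = f q * \<Omega> X Y q" if "sm f" for f
    using X Y q that
    by (simp add: Omega_eq J_diff J_fscale br_fscale_left dv_fscale dv_diff_field dv_dv_fscale vf_rules sm_rules algebra_simps)
qed

lemma tensorial_Omega_right: "X \<in> VF \<Longrightarrow> tensorial (\<Omega> X)"
proof (rule tensorialI)
  assume X: "X \<in> VF"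
  note t = tensorial_Omega_left[OF X]
  fix Y assume Y: "Y \<in> VF"
  show "sm (\<Omega> X Y)" using X Y by (rule sm_Omega)
  fix q assume q: "q \<in> Q"
  show "\<Omega> X (Y + Y') q = \<Omega> X Y q + \<Omega> X Y' q" if "Y' \<in> VF" for Y'
    using X Y q that tensorial_add[OF t Y that q]
    by (simp add: Omega_anti[of X] vf_rules)
  show "\<Omega> X (fscale f Y) q = f q * \<Omega> X Y q" if "sm f" for f
    using X Y q that tensorial_fscale[OF t that Y q]
    by (simp add: Omega_anti[of X] vf_rules)
qed

lemmas Omega_left = tensorial_add[OF tensorial_Omega_left] tensorial_fscale[OF tensorial_Omega_left]
  tensorial_zero[OF tensorial_Omega_left] tensorial_minus[OF tensorial_Omega_left]
  tensorial_diff[OF tensorial_Omega_left]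
lemmas Omega_right = tensorial_add[OF tensorial_Omega_right] tensorial_fscale[OF tensorial_Omega_right]
  tensorial_zero[OF tensorial_Omega_right] tensorial_minus[OF tensorial_Omega_right]
  tensorial_diff[OF tensorial_Omega_right]

lemma Omega_nondegenerate:
  "X \<in> VF \<Longrightarrow> q \<in> Q \<Longrightarrow> (\<And>Y. Y \<in> VF \<Longrightarrow> \<Omega> X Y q = 0) \<Longrightarrow> X q = 0"
  using finsler unfolding finsler_manifold_def maximal_rank_def by blast

lemma Omega_eqI:
  assumes X: "X \<in> VF" and Y: "Y \<in> VF"
    and eq: "\<And>Z q. Z \<in> VF \<Longrightarrow> q \<in> Q \<Longrightarrow> \<Omega> X Z q = \<Omega> Y Z q"
  shows "X = Y"
proof (rule vf_eqI[OF X Y])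
  fix q assume q: "q \<in> Q"
  have "(X - Y) q = 0"
    by (rule Omega_nondegenerate[OF vf_diff[OF X Y] q]) (use eq q X Y in \<open>simp add: Omega_left\<close>)
  then show "X q = Y q" by simp
qed

lemma Omega_riesz:
  assumes "tensorial \<phi>"
  obtains U where "U \<in> VF" "\<And>Y q. Y \<in> VF \<Longrightarrow> q \<in> Q \<Longrightarrow> \<Omega> U Y q = \<phi> Y q"
proof (rule riesz[where \<omega> = \<Omega> and \<theta> = \<phi>, OF pair_frame tensorial_Omega_right tensorial_Omega_left])
  show "X q = 0" if "X \<in> VF" "q \<in> Q" "\<And>Y. Y \<in> VF \<Longrightarrow> \<Omega> X Y q = 0" for X q
    using that by (rule Omega_nondegenerate)
qed (use assms that in blast)+

subsection \<open>The canonical spray\<close>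

abbreviation "S \<equiv> canonical_spray A E"

lemma spray: "S \<in> VF" "Y \<in> VF \<Longrightarrow> q \<in> Q \<Longrightarrow> \<Omega> S Y q = - dv Y E q"
proof -
  have "tensorial (\<lambda>Y q. - dv Y E q)"
    by (rule tensorialI) (auto intro!: sm_rules simp: dv_add_field dv_fscale sm_E)
  then obtain U where U: "U \<in> VF" "\<And>Y q. Y \<in> VF \<Longrightarrow> q \<in> Q \<Longrightarrow> \<Omega> U Y q = - dv Y E q"
    by (rule Omega_riesz) blast
  have "S \<in> VF \<and> (\<forall>Y\<in>VF. \<forall>q\<in>Q. \<Omega> S Y q = - dv Y E q)"
    unfolding canonical_spray_def
  proof (rule theI[of _ U])
    show "U \<in> VF \<and> (\<forall>Y\<in>VF. \<forall>q\<in>Q. \<Omega> U Y q = - dv Y E q)" using U by blast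
    show "W = U" if "W \<in> VF \<and> (\<forall>Y\<in>VF. \<forall>q\<in>Q. \<Omega> W Y q = - dv Y E q)" for W
      by (rule Omega_eqI) (use that U in auto)
  qed
  then show "S \<in> VF" "Y \<in> VF \<Longrightarrow> q \<in> Q \<Longrightarrow> \<Omega> S Y q = - dv Y E q" by auto
qed

lemma Omega_J_left:
  assumes "X \<in> VF" "Y \<in> VF" "q \<in> Q"
  shows "\<Omega> (J X) Y q = dv (J X) (\<theta> Y) q - \<theta> (br (J X) Y) q"
  using assms by (simp add: Omega_eq J_simps dv_dv_zero sm_E)

text \<open>\<theta> kills vertical fields, and the bracket of two of them is vertical.\<close>

lemma Omega_J_J: "X \<in> VF \<Longrightarrow> Y \<in> VF \<Longrightarrow> q \<in> Q \<Longrightarrow> \<Omega> (J X) (J Y) q = 0"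
  by (simp add: Omega_J_left vf_rules J_simps br_J_J dv_dv_zero dv_zero_field sm_E)

text \<open>In coordinates this is the symmetry of the fibre Hessian of \<open>E\<close>; here
  integrability of \<open>J\<close> converts the commutator of \<open>J X\<close> and
  \<open>J Y\<close> into the two \<theta>-terms.\<close>

lemma Omega_J_sym:
  assumes "X \<in> VF" "Y \<in> VF" "q \<in> Q"
  shows "\<Omega> (J X) Y q = \<Omega> (J Y) X q"
proof -
  have "dv (br (J X) (J Y)) E q = dv (J X) (dv (J Y) E) q - dv (J Y) (dv (J X) E) q"
    using assms by (simp add: dv_br vf_rules sm_E)
  moreover have "br (J X) (J Y) = J (br (J X) Y) - J (br (J Y) X)"
    using br_J_J[OF assms(1,2)] br_anti[of X "J Y"] assms by (simp add: vf_rules J_minus)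
  ultimately show ?thesis using assms by (simp add: Omega_J_left dv_diff_field vf_rules sm_E)
qed

text \<open>C E = 2 E contributes 2 \<theta>(Y), and the weight -1 of \<open>J\<close> takes one
  \<theta>(Y) away.\<close>

lemma Omega_C:
  assumes "Y \<in> VF" "q \<in> Q"
  shows "\<Omega> C Y q = \<theta> Y q"
proof -
  have "dv (br C (J Y)) E q = dv C (\<theta> Y) q - dv (J Y) (dv C E) q"
    using assms by (simp add: dv_br vf_rules sm_E)
  moreover have "dv (br C (J Y)) E q = \<theta> (br C Y) q - \<theta> Y q"
    using assms by (simp add: br_C_J dv_diff_field vf_rules sm_E)
  ultimately show ?thesis
    using assms by (simp add: Omega_eq J_C dv_dv_zero dv_dv_C_E vf_rules sm_E)
qed

text \<open>\<Omega>(J S, Y) = \<Omega>(J Y, S) = dE(J Y) = \<theta>(Y), which is what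
  \<open>C\<close> represents.\<close>

lemma J_S: "J S = C"
proof (rule Omega_eqI)
  fix Y q assume "Y \<in> VF" "q \<in> Q"
  then show "\<Omega> (J S) Y q = \<Omega> C Y q"
    using Omega_J_sym[of S Y q] Omega_anti[of "J Y" S q] by (simp add: spray vf_rules Omega_C)
qed (simp_all add: vf_rules spray)

section \<open>Closedness and homogeneity of the fundamental 2-form\<close>

lemma theta_simps:
  "X \<in> VF \<Longrightarrow> Y \<in> VF \<Longrightarrow> q \<in> Q \<Longrightarrow> \<theta> (X + Y) q = \<theta> X q + \<theta> Y q"
  "X \<in> VF \<Longrightarrow> q \<in> Q \<Longrightarrow> \<theta> (- X) q = - \<theta> X q"
  by (simp_all add: J_simps dv_add_field dv_minus_field vf_rules sm_E)

lemma dv_Omega: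
  assumes "X \<in> VF" "Y \<in> VF" "Z \<in> VF" "q \<in> Q"
  shows "dv X (\<Omega> Y Z) q = dv X (dv Y (\<theta> Z)) q - dv X (dv Z (\<theta> Y)) q - dv X (\<theta> (br Y Z)) q"
  using assms by (simp add: Omega_eq[abs_def] dv_diff sm_rules vf_rules)

lemma Omega_closed:
  assumes "X \<in> VF" "Y \<in> VF" "Z \<in> VF" "q \<in> Q"
  shows "dv X (\<Omega> Y Z) q + dv Y (\<Omega> Z X) q + dv Z (\<Omega> X Y) q =
    \<Omega> (br X Y) Z q + \<Omega> (br Y Z) X q + \<Omega> (br Z X) Y q"
proof -
  have "br (br X Y) Z + br (br Y Z) X + br (br Z X) Y = 0"
    using br_jacobi[OF assms(1-3)] br_anti[of "br Y Z" X] br_anti[of "br Z X" Y] br_anti[of Z X] assms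
    by (simp add: vf_rules br_simps)
  then have "\<theta> (br (br X Y) Z + br (br Y Z) X + br (br Z X) Y) q = 0"
    using assms by (simp add: J_zero dv_zero_field sm_E)
  then have "\<theta> (br (br X Y) Z) q + \<theta> (br (br Y Z) X) q + \<theta> (br (br Z X) Y) q = 0"
    using assms by (simp add: theta_simps vf_rules)
  then show ?thesis
    using assms by (simp add: dv_Omega) (simp add: Omega_eq dv_br vf_rules sm_rules)
qed

text \<open>Cartan's formula: since \<Omega> is closed, its Lie derivative along \<open>C\<close> is
  d(i_C \<Omega>) = d\<theta> = \<Omega>.\<close>

lemma Lie_C_Omega:
  assumes "X \<in> VF" "Y \<in> VF" "q \<in> Q"
  shows "dv C (\<Omega> X Y) q = \<Omega> X Y q + \<Omega> (br C X) Y q + \<Omega> X (br C Y) q"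
proof -
  have "dv X (\<Omega> Y C) q = dv X (\<lambda>q. - \<theta> Y q) q"
    by (rule dv_cong) (use assms Omega_anti[of Y C] in \<open>simp_all add: vf_rules sm_Omega Omega_C\<close>)
  moreover have "dv Y (\<Omega> C X) q = dv Y (\<theta> X) q"
    by (rule dv_cong) (use assms in \<open>simp_all add: vf_rules sm_Omega Omega_C\<close>)
  moreover have "\<Omega> (br X Y) C q = - \<theta> (br X Y) q"
    using assms Omega_anti[of "br X Y" C q] by (simp add: vf_rules Omega_C)
  moreover have "\<Omega> (br Y C) X q = \<Omega> X (br C Y) q"
    using assms Omega_anti[of "br Y C" X q] br_anti[of Y C] by (simp add: vf_rules Omega_right)
  ultimately show ?thesis
    using Omega_closed[OF vf_C assms(1,2,3)] assms
    by (simp add: dv_minus sm_rules vf_rules) (simp add: Omega_eq)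
qed

text \<open>Contracting \<Omega> with [C, S] gives the Lie derivative of -dE along \<open>C\<close>,
  which is -2 dE, minus the contraction of \<Omega> with \<open>S\<close>, which is -dE. What
  remains is -dE.\<close>

lemma br_C_S: "br C S = S"
proof (rule Omega_eqI)
  fix Y q assume Y: "Y \<in> VF" and q: "q \<in> Q"
  have "dv C (\<Omega> S Y) q = dv C (\<lambda>q. - dv Y E q) q"
    by (rule dv_cong) (use Y q in \<open>simp_all add: vf_rules sm_Omega spray\<close>)
  also have "\<dots> = - dv C (dv Y E) q"
    using Y q by (simp add: dv_minus vf_rules sm_rules)
  finally show "\<Omega> (br C S) Y q = \<Omega> S Y q"
    using Lie_C_Omega[OF spray(1) Y q] Y q dv_br[OF vf_C Y sm_E q]
    by (simp add: spray vf_rules dv_dv_C_E)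
qed (simp_all add: vf_rules spray)

subsection \<open>The Barthel connection\<close>

abbreviation "\<Gamma> \<equiv> barthel A E"
abbreviation "h \<equiv> hor \<Gamma>"
abbreviation "v \<equiv> ver \<Gamma>"

definition vertical :: "('p, real^'n) tfield \<Rightarrow> bool" where
  "vertical V \<longleftrightarrow> V \<in> VF \<and> J V = 0"

lemma vertical_vf: "vertical V \<Longrightarrow> V \<in> VF"
  by (simp add: vertical_def)

lemma vertical_J: "X \<in> VF \<Longrightarrow> vertical (J X)"
  by (simp add: vertical_def vf_rules J_simps)

lemma vertical_lift: "vertical V \<Longrightarrow> J (br V S) = V"
  using J_br_spray[OF _ _ spray(1) J_S] by (simp add: vertical_def)

lemma vertical_obtain:
  assumes "vertical V" obtains X where "X \<in> VF" "V = J X"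
  using vertical_lift[OF assms] that[of "br V S"] vertical_vf[OF assms] by (simp add: vf_rules spray)

lemma vertical_zero: "vertical 0"
  by (simp add: vertical_def vf_rules J_simps)

lemma vertical_add: "vertical V \<Longrightarrow> vertical W \<Longrightarrow> vertical (V + W)"
  by (simp add: vertical_def vf_rules J_simps)

lemma vertical_diff: "vertical V \<Longrightarrow> vertical W \<Longrightarrow> vertical (V - W)"
  by (simp add: vertical_def vf_rules J_simps)

lemma vertical_fscale: "sm f \<Longrightarrow> vertical V \<Longrightarrow> vertical (fscale f V)"
  by (simp add: vertical_def vf_rules J_simps fscale_zero)

lemma vertical_C: "vertical C"
  by (simp add: vertical_def vf_rules J_simps)

lemma vertical_br:
  assumes "vertical V" "vertical W" shows "vertical (br V W)"
proof -
  obtain X Y where "X \<in> VF" "V = J X" "Y \<in> VF" "W = J Y"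
    using assms vertical_obtain by metis
  then show ?thesis by (simp add: vertical_def vf_rules br_J_J J_simps)
qed

lemmas vertical_rules = vertical_zero vertical_add vertical_diff vertical_fscale vertical_C vertical_br vertical_J

lemma barthel_eq: "\<Gamma> X = br (J X) S - J (br X S)"
  by (simp add: barthel_def)

lemma vf_barthel: "X \<in> VF \<Longrightarrow> \<Gamma> X \<in> VF"
  by (simp add: barthel_eq vf_rules spray)

lemma barthel_add: "X \<in> VF \<Longrightarrow> Y \<in> VF \<Longrightarrow> \<Gamma> (X + Y) = \<Gamma> X + \<Gamma> Y"
  by (simp add: barthel_eq J_simps br_simps vf_rules spray)

lemma barthel_fscale: "X \<in> VF \<Longrightarrow> sm f \<Longrightarrow> \<Gamma> (fscale f X) = fscale f (\<Gamma> X)"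
  by (simp add: barthel_eq J_simps br_fscale_left vf_rules spray fscale_diff)

lemma J_barthel: "X \<in> VF \<Longrightarrow> J (\<Gamma> X) = J X"
  by (simp add: barthel_eq J_simps vertical_lift vertical_J)

lemma barthel_vertical: "vertical V \<Longrightarrow> \<Gamma> V = - V"
  using vertical_lift[of V] by (simp add: barthel_eq vertical_def br_simps spray)

lemma ver_eq: "v X = fscale (\<lambda>_. 1/2) (X - \<Gamma> X)"
  by (simp add: ver_def)

lemma hor_eq: "h X = X - v X"
proof -
  have "fscale (\<lambda>_. 1/2) (X + \<Gamma> X) + fscale (\<lambda>_. 1/2) (X - \<Gamma> X) = X"
    by (simp add: fscale_def fun_eq_iff scaleR_add_right[symmetric])
  then show ?thesis by (simp add: hor_def ver_def eq_diff_eq)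
qed

lemma barthel_ver: "\<Gamma> X = X - fscale (\<lambda>_. 2) (v X)"
  by (simp add: ver_eq fscale_def fun_eq_iff)

lemma vf_ver: "X \<in> VF \<Longrightarrow> v X \<in> VF"
  by (simp add: ver_eq vf_rules vf_barthel sm_const)

lemma vf_hor: "X \<in> VF \<Longrightarrow> h X \<in> VF"
  by (simp add: hor_eq vf_rules vf_ver)

lemma vertical_ver: "X \<in> VF \<Longrightarrow> vertical (v X)"
  by (simp add: vertical_def vf_ver) (simp add: ver_eq J_simps J_barthel fscale_zero)

lemma ver_add: "X \<in> VF \<Longrightarrow> Y \<in> VF \<Longrightarrow> v (X + Y) = v X + v Y"
  by (simp add: ver_eq barthel_add fscale_add[symmetric] algebra_simps)

lemma ver_fscale: "X \<in> VF \<Longrightarrow> sm f \<Longrightarrow> v (fscale f X) = fscale f (v X)"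
  by (simp add: ver_eq barthel_fscale fscale_diff fscale_commute[of f])

lemma ver_vertical: "vertical V \<Longrightarrow> v V = V"
  by (simp add: ver_eq barthel_vertical) (simp add: fscale_def fun_eq_iff scaleR_add_right[symmetric])

lemma ver_zero: "v 0 = 0"
  by (rule ver_vertical[OF vertical_zero])

lemma ver_minus: "X \<in> VF \<Longrightarrow> v (- X) = - v X"
  using ver_add[of X "- X"] ver_zero by (simp add: vf_rules eq_neg_iff_add_eq_0 add.commute)

lemma ver_diff: "X \<in> VF \<Longrightarrow> Y \<in> VF \<Longrightarrow> v (X - Y) = v X - v Y"
  using ver_add[of X "- Y"] by (simp add: vf_rules ver_minus)

lemma ver_ver: "X \<in> VF \<Longrightarrow> v (v X) = v X"
  by (simp add: ver_vertical vertical_ver)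

lemma ver_hor: "X \<in> VF \<Longrightarrow> v (h X) = 0"
  by (simp add: hor_eq ver_diff vf_ver ver_ver)

lemma hor_vertical: "vertical V \<Longrightarrow> h V = 0"
  by (simp add: hor_eq ver_vertical)

lemma J_ver: "X \<in> VF \<Longrightarrow> J (v X) = 0"
  using vertical_ver by (simp add: vertical_def)

lemma J_hor: "X \<in> VF \<Longrightarrow> J (h X) = J X"
  by (simp add: hor_eq J_simps J_ver)

lemma hor_add: "X \<in> VF \<Longrightarrow> Y \<in> VF \<Longrightarrow> h (X + Y) = h X + h Y"
  by (simp add: hor_eq ver_add)

lemma hor_diff: "X \<in> VF \<Longrightarrow> Y \<in> VF \<Longrightarrow> h (X - Y) = h X - h Y"
  by (simp add: hor_eq ver_diff)

lemma hor_fscale: "X \<in> VF \<Longrightarrow> sm f \<Longrightarrow> h (fscale f X) = fscale f (h X)"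
  by (simp add: hor_eq ver_fscale fscale_diff)

text \<open>The difference is vertical by the condition on \<open>J\<close>, and \<open>v\<close> is
  the identity on vertical fields. Later equalities of fields are checked on these two
  parts.\<close>

lemma split_eqI:
  assumes "X \<in> VF" "Y \<in> VF" "J X = J Y" "v X = v Y"
  shows "X = Y"
proof -
  have "vertical (X - Y)" using assms by (simp add: vertical_def vf_rules J_simps)
  from ver_vertical[OF this] show ?thesis using assms by (simp add: ver_diff)
qed

lemma hor_lift: "X \<in> VF \<Longrightarrow> h (br (J X) S) = h X"
  by (rule split_eqI) (simp_all add: vf_hor vf_rules spray J_hor ver_hor vertical_lift vertical_J)

text \<open>\<open>J\<close> has weight -1 and \<open>S\<close> weight +1 under \<open>C\<close>, so
  \<Gamma> = [J, S] has weight 0.\<close>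

lemma br_C_barthel: "X \<in> VF \<Longrightarrow> br C (\<Gamma> X) = \<Gamma> (br C X)"
proof -
  assume X: "X \<in> VF"
  have "br C (br (J X) S) = br (J (br C X)) S"
    using br_jacobi[of C "J X" S] X by (simp add: vf_rules spray br_C_S br_C_J br_simps)
  moreover have "br C (J (br X S)) = J (br (br C X) S)"
    using br_C_J[of "br X S"] br_jacobi[of C X S] X by (simp add: vf_rules spray br_C_S J_simps)
  ultimately show ?thesis
    using X by (simp add: barthel_eq br_diff_right vf_rules spray)
qed

lemma br_C_ver: "X \<in> VF \<Longrightarrow> br C (v X) = v (br C X)"
proof -
  assume X: "X \<in> VF"
  \<comment> \<open>The derivative of a constant is known to vanish only on the carrier; elsewhere
    the field itself is zero.\<close>
  have "fscale (dv C (\<lambda>_. 1/2)) (X - \<Gamma> X) = fscale (\<lambda>_. 0) (X - \<Gamma> X)"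
    by (rule fscale_cong) (use X in \<open>simp_all add: vf_rules vf_barthel dv_const\<close>)
  then have "fscale (dv C (\<lambda>_. 1/2)) (X - \<Gamma> X) = 0" by (simp add: fscale_def fun_eq_iff)
  then show ?thesis
    using X by (simp add: ver_eq br_fscale_right vf_rules vf_barthel sm_const br_simps br_C_barthel)
qed

text \<open>The left side will be the derivative of \<open>C\<close> in a horizontal direction, so
  this is the horizontal half of D C = v.\<close>

lemma ver_br_hor_C: "X \<in> VF \<Longrightarrow> v (br (h X) C) = 0"
proof -
  assume X: "X \<in> VF"
  have "br C (h X) = h (br C X)" using X by (simp add: hor_eq br_simps vf_rules vf_ver br_C_ver)
  then show ?thesis
    using X br_anti[of "h X" C] by (simp add: vf_rules vf_hor ver_minus ver_hor)
qed

subsection \<open>The vertical metric\<close>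

text \<open>\<open>br W S\<close> is an explicit preimage of \<open>W\<close> under
  \<open>J\<close>. It replaces the arbitrary preimage in \<open>vertical_metric\<close>, so
  smoothness of \<open>G\<close> follows from that of \<Omega>.\<close>

definition G :: "('p, real^'n) tfield \<Rightarrow> ('p, real^'n) tfield \<Rightarrow> ('p, real^'n) tpoint \<Rightarrow> real" where
  "G V W = \<Omega> V (br W S)"

lemma sm_G: "vertical V \<Longrightarrow> vertical W \<Longrightarrow> sm (G V W)"
  by (simp add: G_def sm_Omega vertical_vf vf_rules spray)

lemma Omega_same_J:
  assumes "vertical V" "X \<in> VF" "Y \<in> VF" "J X = J Y" "q \<in> Q"
  shows "\<Omega> V X q = \<Omega> V Y q"
proof -
  obtain V' where V': "V' \<in> VF" "V = J V'" using vertical_obtain[OF assms(1)] .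
  have "vertical (X - Y)" using assms by (simp add: vertical_def vf_rules J_simps)
  then obtain Z where "Z \<in> VF" "X - Y = J Z" using vertical_obtain by blast
  then have "\<Omega> V (X - Y) q = 0" using V' assms by (simp add: Omega_J_J)
  then show ?thesis using assms by (simp add: Omega_right vertical_vf)
qed

lemma G_J: "vertical V \<Longrightarrow> X \<in> VF \<Longrightarrow> q \<in> Q \<Longrightarrow> G V (J X) q = \<Omega> V X q"
  unfolding G_def by (rule Omega_same_J) (simp_all add: vertical_lift vertical_J vf_rules spray)

lemma vertical_metric_eq:
  assumes "vertical V" "vertical W" "q \<in> Q"
  shows "vertical_metric A E V W q = G V W q"
proof -
  define \<xi> where "\<xi> = (SOME \<xi>. \<xi> \<in> VF \<and> J \<xi> = W)"
  have "br W S \<in> VF \<and> J (br W S) = W" using assms by (simp add: vertical_lift vertical_vf vf_rules spray)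
  then have "\<xi> \<in> VF \<and> J \<xi> = W" unfolding \<xi>_def by (rule someI[where P = "\<lambda>\<xi>. \<xi> \<in> VF \<and> J \<xi> = W"])
  then show ?thesis
    unfolding vertical_metric_def \<xi>_def[symmetric] using G_J[of V \<xi> q] assms by simp
qed

lemma G_sym:
  assumes "vertical V" "vertical W" "q \<in> Q" shows "G V W q = G W V q"
proof -
  obtain X Y where "X \<in> VF" "V = J X" "Y \<in> VF" "W = J Y"
    using assms vertical_obtain by metis
  then show ?thesis using assms by (simp add: G_J vertical_J Omega_J_sym)
qed

lemma G_left:
  assumes "vertical U" "vertical V" "q \<in> Q"
  shows "vertical W \<Longrightarrow> G (V + W) U q = G V U q + G W U q"
    "vertical W \<Longrightarrow> G (V - W) U q = G V U q - G W U q"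
    "sm f \<Longrightarrow> G (fscale f V) U q = f q * G V U q" "G 0 U q = 0"
  using assms by (simp_all add: G_def Omega_left vertical_vf vf_rules spray)

lemma G_right:
  assumes "vertical U" "vertical V" "q \<in> Q"
  shows "vertical W \<Longrightarrow> G U (V + W) q = G U V q + G U W q"
    "vertical W \<Longrightarrow> G U (V - W) q = G U V q - G U W q"
    "sm f \<Longrightarrow> G U (fscale f V) q = f q * G U V q" "G U 0 q = 0"
  using assms by (simp_all add: G_sym[of U] vertical_rules G_left)

lemma G_eqI:
  assumes V: "vertical V" and W: "vertical W"
    and eq: "\<And>U q. vertical U \<Longrightarrow> q \<in> Q \<Longrightarrow> G V U q = G W U q"
  shows "V = W"
  using assms by (intro Omega_eqI) (auto simp: G_J[symmetric] vertical_J vertical_vf)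

lemma dv_G_left:
  assumes "vertical V" "vertical W" "vertical U" "X \<in> VF" "q \<in> Q"
  shows "dv X (G (V + W) U) q = dv X (G V U) q + dv X (G W U) q"
    "sm f \<Longrightarrow> dv X (G (fscale f V) U) q = f q * dv X (G V U) q + dv X f q * G V U q"
proof -
  have "dv X (G (V + W) U) q = dv X (\<lambda>q. G V U q + G W U q) q"
    by (rule dv_cong) (use assms in \<open>simp_all add: sm_G vertical_rules G_left\<close>)
  then show "dv X (G (V + W) U) q = dv X (G V U) q + dv X (G W U) q"
    using assms by (simp add: dv_add sm_G)
  assume f: "sm f"
  have "dv X (G (fscale f V) U) q = dv X (\<lambda>q. f q * G V U q) q"
    by (rule dv_cong) (use assms f in \<open>simp_all add: sm_G vertical_rules G_left\<close>)
  then show "dv X (G (fscale f V) U) q = f q * dv X (G V U) q + dv X f q * G V U q"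
    using assms f by (simp add: dv_mult sm_G)
qed

lemma dv_G_sym:
  "vertical V \<Longrightarrow> vertical W \<Longrightarrow> X \<in> VF \<Longrightarrow> q \<in> Q \<Longrightarrow> dv X (G V W) q = dv X (G W V) q"
  by (rule dv_cong) (simp_all add: sm_G G_sym)

lemma dv_G_right:
  assumes "vertical V" "vertical W" "vertical U" "X \<in> VF" "q \<in> Q"
  shows "dv X (G U (V + W)) q = dv X (G U V) q + dv X (G U W) q"
    "sm f \<Longrightarrow> dv X (G U (fscale f V)) q = f q * dv X (G U V) q + dv X f q * G U V q"
  using assms dv_G_left[of V W U X q] by (simp_all add: dv_G_sym[of U] vertical_rules G_sym[of U])

section \<open>The Levi-Civita connection of the vertical metric\<close>

definition koszul :: "('p, real^'n) tfield \<Rightarrow> ('p, real^'n) tfield \<Rightarrow> ('p, real^'n) tfield \<Rightarrow>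
    ('p, real^'n) tpoint \<Rightarrow> real" where
  "koszul V W U q = (dv V (G W U) q + dv W (G V U) q - dv U (G V W) q
     + G (br V W) U q - G (br V U) W q - G (br W U) V q) / 2"

lemma koszul_add3:
  assumes "vertical V" "vertical W" "vertical U" "vertical U'" "q \<in> Q"
  shows "koszul V W (U + U') q = koszul V W U q + koszul V W U' q"
  using assms by (simp add: koszul_def vertical_rules vertical_vf br_simps dv_add_field sm_G
    dv_G_right G_left G_right field_simps)

text \<open>Derivatives of \<open>f\<close> along \<open>V\<close> and \<open>W\<close> come from
  the first two terms and are cancelled by those of the last two brackets.\<close>

lemma koszul_fscale3:
  assumes "vertical V" "vertical W" "vertical U" "sm f" "q \<in> Q"
  shows "koszul V W (fscale f U) q = f q * koszul V W U q"
  using assms G_sym[of W U q] G_sym[of V U q]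
  by (simp add: koszul_def vertical_rules vertical_vf vf_rules br_fscale_right dv_fscale sm_G sm_rules
    dv_G_right G_left G_right field_simps)

lemma sm_koszul:
  assumes "vertical V" "vertical W" "vertical U" shows "sm (koszul V W U)"
proof -
  have "sm (\<lambda>q. (1/2) * (dv V (G W U) q + dv W (G V U) q - dv U (G V W) q
     + G (br V W) U q - G (br V U) W q - G (br W U) V q))"
    using assms by (intro sm_intros sm_dv sm_G vertical_rules vertical_vf)
  moreover have "(\<lambda>q. (1/2) * (dv V (G W U) q + dv W (G V U) q - dv U (G V W) q
     + G (br V W) U q - G (br V U) W q - G (br W U) V q)) = koszul V W U"
    by (simp add: fun_eq_iff koszul_def)
  ultimately show ?thesis by simp
qed

text \<open>The functional is precomposed with \<open>J\<close> to make it a 1-form on all fields.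
  Its \<Omega>-representative \<open>K\<close> is vertical: \<Omega>(J K, Y) = -\<Omega>(K, J Y) is
  minus the functional at \<open>J (J Y)\<close>, which is zero.\<close>

lemma G_riesz:
  assumes t: "tensorial (\<lambda>Y. \<phi> (J Y))"
  shows "\<exists>K. vertical K \<and> (\<forall>U. vertical U \<longrightarrow> (\<forall>q\<in>Q. G K U q = \<phi> U q))"
proof -
  obtain K where K: "K \<in> VF" "\<And>Y q. Y \<in> VF \<Longrightarrow> q \<in> Q \<Longrightarrow> \<Omega> K Y q = \<phi> (J Y) q"
    using Omega_riesz[OF t] by blast
  have "J K = 0"
  proof (rule Omega_eqI)
    fix Y q assume Y: "Y \<in> VF" and q: "q \<in> Q"
    have "\<phi> (J (J Y)) q = 0"
      using tensorial_zero[OF t q] by (simp add: J_simps)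
    then show "\<Omega> (J K) Y q = \<Omega> 0 Y q"
      using Omega_J_sym[OF K(1) Y q] Omega_anti[of "J Y" K q] K Y q by (simp add: vf_rules Omega_left)
  qed (simp_all add: vf_rules K)
  then have "vertical K" using K by (simp add: vertical_def)
  moreover have "G K U q = \<phi> U q" if "vertical U" "q \<in> Q" for U q
    using that K(2)[of "br U S" q] by (simp add: G_def vertical_lift vertical_vf vf_rules spray)
  ultimately show ?thesis by blast
qed

definition LC :: "('p, real^'n) tfield \<Rightarrow> ('p, real^'n) tfield \<Rightarrow> ('p, real^'n) tfield" where
  "LC V W = (SOME K. vertical K \<and> (\<forall>U. vertical U \<longrightarrow> (\<forall>q\<in>Q. G K U q = koszul V W U q)))"

lemma LC:
  assumes "vertical V" "vertical W"
  shows "vertical (LC V W)" "vertical U \<Longrightarrow> q \<in> Q \<Longrightarrow> G (LC V W) U q = koszul V W U q"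
proof -
  have "tensorial (\<lambda>Y. koszul V W (J Y))"
    by (rule tensorialI) (use assms in \<open>simp_all add: J_simps koszul_add3 koszul_fscale3 vertical_J sm_koszul\<close>)
  from someI_ex[OF G_riesz[OF this]]
  show "vertical (LC V W)" "vertical U \<Longrightarrow> q \<in> Q \<Longrightarrow> G (LC V W) U q = koszul V W U q"
    by (auto simp: LC_def)
qed

lemma LC_add_left:
  assumes "vertical V" "vertical V'" "vertical W"
  shows "LC (V + V') W = LC V W + LC V' W"
  by (rule G_eqI) (use assms in \<open>simp_all add: LC vertical_rules G_left koszul_def vertical_vf br_simps
    dv_add_field sm_G dv_G_left G_right field_simps\<close>)

lemma LC_fscale_left:
  assumes "vertical V" "vertical W" "sm f"
  shows "LC (fscale f V) W = fscale f (LC V W)"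
proof (rule G_eqI)
  fix U q assume "vertical U" "q \<in> Q"
  then show "G (LC (fscale f V) W) U q = G (fscale f (LC V W)) U q"
    using assms by (simp add: LC vertical_rules G_left koszul_def vertical_vf vf_rules br_fscale_left
      dv_fscale sm_G dv_G_left G_right sm_rules field_simps)
qed (use assms in \<open>simp_all add: LC vertical_rules\<close>)

lemma LC_add_right:
  assumes "vertical V" "vertical W" "vertical W'"
  shows "LC V (W + W') = LC V W + LC V W'"
  by (rule G_eqI) (use assms in \<open>simp_all add: LC vertical_rules G_left koszul_def vertical_vf br_simps
    dv_add_field sm_G dv_G_left dv_G_right G_right field_simps\<close>)

lemma LC_fscale_right:
  assumes "vertical V" "vertical W" "sm f"
  shows "LC V (fscale f W) = fscale (dv V f) W + fscale f (LC V W)"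
proof (rule G_eqI)
  fix U q assume "vertical U" "q \<in> Q"
  then show "G (LC V (fscale f W)) U q = G (fscale (dv V f) W + fscale f (LC V W)) U q"
    using assms G_sym[of W V q] by (simp add: LC vertical_rules G_left koszul_def vertical_vf vf_rules br_fscale_left br_fscale_right
      dv_fscale sm_G dv_G_left dv_G_right G_right sm_rules field_simps)
qed (use assms in \<open>simp_all add: LC vertical_rules sm_rules vertical_vf\<close>)

lemma LC_zero_left: "vertical V \<Longrightarrow> LC 0 V = 0"
  using LC_add_left[OF vertical_zero vertical_zero, of V] by simp

lemma LC_torsion_free:
  assumes "vertical V" "vertical W"
  shows "LC V W - LC W V = br V W"
proof (rule G_eqI)
  fix U q assume U: "vertical U" "q \<in> Q"
  have "G (br W V) U q = - G (br V W) U q"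
    using br_anti[of W V] G_left(2)[of U 0 q "br V W"] G_left(4)[of U 0 q] assms U
    by (simp add: vertical_vf vertical_rules)
  then show "G (LC V W - LC W V) U q = G (br V W) U q"
    using assms U dv_G_sym[of V W U q] by (simp add: LC vertical_rules G_left koszul_def vertical_vf field_simps)
qed (use assms in \<open>simp_all add: LC vertical_rules\<close>)

lemma LC_metric:
  assumes "vertical V" "vertical W" "vertical U" "q \<in> Q"
  shows "dv V (G W U) q = G (LC V W) U q + G W (LC V U) q"
proof -
  have "G (br U W) V q = - G (br W U) V q"
    using br_anti[of U W] G_left(2)[of V 0 q "br W U"] G_left(4)[of V 0 q] assms
    by (simp add: vertical_vf vertical_rules)
  then show ?thesis
    using assms dv_G_sym[of U W V q] G_sym[of W "LC V U" q]
    by (simp add: LC vertical_rules koszul_def vertical_vf field_simps)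
qed

text \<open>\<open>C\<close> is the vertical gradient of \<open>E\<close>. Hence the second
  derivatives of \<open>E\<close> in the Koszul formula cancel against the bracket of
  \<open>V\<close> and \<open>U\<close>, and the terms left form the Lie derivative of \<Omega>
  along \<open>C\<close>, plus one more copy of G(V, U).\<close>

lemma LC_C:
  assumes V: "vertical V"
  shows "LC V C = V"
proof (rule G_eqI)
  have GC: "G C W q = dv W E q" if "vertical W" "q \<in> Q" for W q
    using that Omega_C[of "br W S" q] by (simp add: G_def vertical_lift vertical_vf vf_rules spray)
  fix U q assume U: "vertical U" and q: "q \<in> Q"
  obtain Y where Y: "Y \<in> VF" "U = J Y" using vertical_obtain[OF U] .
  note vf = vertical_vf[OF V] vertical_vf[OF U]
  have 1: "dv V (G C U) q = dv V (dv U E) q"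
    by (rule dv_cong) (use vf q U in \<open>simp_all add: sm_G vertical_C GC\<close>)
  have 2: "dv U (G V C) q = dv U (dv V E) q"
    by (rule dv_cong) (use vf q U V in \<open>simp_all add: sm_G vertical_C GC G_sym[of V C]\<close>)
  have 3: "G (br V U) C q = dv (br V U) E q"
    using U V q by (simp add: G_sym[of _ C] vertical_rules GC)
  have 4: "dv C (G V U) q = dv C (\<Omega> V Y) q"
    by (rule dv_cong) (use vf q U V Y in \<open>simp_all add: sm_G vf_C G_J\<close>)
  have 5: "G (br V C) U q = - \<Omega> (br C V) Y q"
  proof -
    have "G (br V C) U q = \<Omega> (br V C) Y q" using V q Y by (simp add: G_J vertical_rules)
    also have "\<dots> = - \<Omega> (br C V) Y q"
      using br_anti[of V C] V q Y by (simp add: vertical_vf vf_rules Omega_left)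
    finally show ?thesis .
  qed
  \<comment> \<open>The weight of \<open>J\<close> supplies the additional
    \<open>\<Omega> V Y\<close>; together with the Lie derivative it makes 2 G(V, U), which the
    factor 1/2 in \<open>koszul\<close> normalizes.\<close>
  have 6: "G (br C U) V q = \<Omega> V (br C Y) q - \<Omega> V Y q"
  proof -
    have "G (br C U) V q = G V (br C U) q"
      using U V q by (simp add: G_sym[of _ V] vertical_rules)
    also have "\<dots> = G V (J (br C Y - Y)) q"
      using br_C_J[OF Y(1)] by (simp add: Y(2) J_simps)
    finally have "G (br C U) V q = G V (J (br C Y - Y)) q" .
    then show ?thesis using V q Y by (simp add: G_J vf_rules Omega_right vertical_vf)
  qed
  show "G (LC V C) U q = G V U q"
    using 1 2 3 4 5 6 LC(2)[OF V vertical_C U q] dv_br[OF vf sm_E q] Lie_C_Omega[OF vf(1) Y(1) q]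
      G_J[OF V Y(1) q] Y(2) by (simp add: koszul_def)
qed (use V in \<open>simp_all add: LC vertical_rules\<close>)

end

subsection \<open>Construction of the lift\<close>

context finsler
begin

lemma vertical_fields_iff: "X \<in> vertical_fields A \<longleftrightarrow> vertical X"
  by (simp add: vertical_fields_def vertical_def)

definition ver_deriv :: "('p, real^'n) tfield \<Rightarrow> ('p, real^'n) tfield \<Rightarrow> ('p, real^'n) tfield" where
  "ver_deriv X V = v (br (h X) V) + LC (v X) V"

text \<open>The first summand is the vertical part; the second recovers the horizontal part from its
  image under \<open>J\<close>.\<close>

definition lift :: "('p, real^'n) tconn" where
  "lift X Y = (if X \<in> VF \<and> Y \<in> VF then ver_deriv X (v Y) + h (br (ver_deriv X (J Y)) S) else 0)"

lemma vertical_ver_deriv: "X \<in> VF \<Longrightarrow> vertical V \<Longrightarrow> vertical (ver_deriv X V)"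
  by (simp add: ver_deriv_def vertical_rules vertical_ver LC vf_hor vf_rules vertical_vf)

lemma ver_deriv_add_left:
  "X \<in> VF \<Longrightarrow> Y \<in> VF \<Longrightarrow> vertical V \<Longrightarrow> ver_deriv (X + Y) V = ver_deriv X V + ver_deriv Y V"
  by (simp add: ver_deriv_def hor_add ver_add br_add_left LC_add_left vertical_ver vf_hor vf_rules vertical_vf)

text \<open>The bracket of f h X with \<open>V\<close> produces a derivative of \<open>f\<close>
  times h X, which \<open>v\<close> removes.\<close>

lemma ver_deriv_fscale_left:
  "X \<in> VF \<Longrightarrow> sm f \<Longrightarrow> vertical V \<Longrightarrow> ver_deriv (fscale f X) V = fscale f (ver_deriv X V)"
  by (simp add: ver_deriv_def hor_fscale ver_fscale br_fscale_left LC_fscale_left vertical_ver vf_hor vf_rules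
      vertical_vf ver_diff ver_hor sm_rules fscale_zero fscale_add)

lemma ver_deriv_add_right:
  "X \<in> VF \<Longrightarrow> vertical V \<Longrightarrow> vertical W \<Longrightarrow> ver_deriv X (V + W) = ver_deriv X V + ver_deriv X W"
  by (simp add: ver_deriv_def ver_add br_add_right LC_add_right vertical_ver vf_hor vf_rules vertical_vf)

lemma ver_deriv_fscale_right:
  assumes X: "X \<in> VF" and f: "sm f" and V: "vertical V"
  shows "ver_deriv X (fscale f V) = fscale (dv X f) V + fscale f (ver_deriv X V)"
proof -
  \<comment> \<open>The Leibniz terms of the horizontal bracket and of \<open>LC\<close> are the two
    parts of X f.\<close>
  have "fscale (dv X f) V = fscale (\<lambda>q. dv (h X) f q + dv (v X) f q) V"
  proof (rule fscale_cong[OF vertical_vf[OF V]])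
    fix q assume "q \<in> Q"
    then show "dv X f q = dv (h X) f q + dv (v X) f q"
      using dv_add_field[OF vf_hor[OF X] vf_ver[OF X] f, of q] by (simp add: hor_eq)
  qed
  then show ?thesis
    using assms by (simp add: ver_deriv_def br_fscale_right ver_add ver_fscale ver_vertical LC_fscale_right
      vertical_ver vf_hor vf_ver vf_rules vertical_vf sm_rules fscale_add_fun fscale_add)
qed

lemma ver_deriv_zero: "X \<in> VF \<Longrightarrow> ver_deriv X 0 = 0"
  using ver_deriv_add_right[OF _ vertical_zero vertical_zero, of X] by simp

lemma ver_deriv_vertical: "vertical W \<Longrightarrow> vertical V \<Longrightarrow> ver_deriv W V = LC W V"
  by (simp add: ver_deriv_def hor_vertical ver_vertical br_simps vertical_vf ver_zero)

lemma ver_deriv_hor: "X \<in> VF \<Longrightarrow> vertical V \<Longrightarrow> ver_deriv (h X) V = v (br (h X) V)"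
  by (simp add: ver_deriv_def ver_hor LC_zero_left) (simp add: hor_eq[of "h X"] ver_hor)

lemma ver_deriv_C: "X \<in> VF \<Longrightarrow> ver_deriv X C = v X"
  by (simp add: ver_deriv_def ver_br_hor_C LC_C vertical_ver)

lemma hor_br_fscale:
  "vertical V \<Longrightarrow> sm f \<Longrightarrow> h (br (fscale f V) S) = fscale f (h (br V S))"
  by (simp add: br_fscale_left hor_diff hor_fscale hor_vertical vf_rules spray vertical_vf sm_rules fscale_zero)

lemma hor_br_add:
  "vertical V \<Longrightarrow> vertical W \<Longrightarrow> h (br (V + W) S) = h (br V S) + h (br W S)"
  by (simp add: br_add_left hor_add vf_rules spray vertical_vf)

lemma vf_hor_br: "vertical V \<Longrightarrow> h (br V S) \<in> VF"
  by (simp add: vf_hor vf_rules spray vertical_vf)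

lemma lift_eq: "X \<in> VF \<Longrightarrow> Y \<in> VF \<Longrightarrow> lift X Y = ver_deriv X (v Y) + h (br (ver_deriv X (J Y)) S)"
  by (simp add: lift_def)

lemma vf_lift: "X \<in> VF \<Longrightarrow> Y \<in> VF \<Longrightarrow> lift X Y \<in> VF"
  by (simp add: lift_eq vf_rules vf_hor_br vertical_vf vertical_ver_deriv vertical_ver vertical_J)

lemma lift_vertical: "X \<in> VF \<Longrightarrow> vertical V \<Longrightarrow> lift X V = ver_deriv X V"
  by (simp add: lift_eq vertical_vf ver_vertical)
    (simp add: vertical_def ver_deriv_zero br_simps spray hor_vertical[OF vertical_zero])

lemma J_lift: "X \<in> VF \<Longrightarrow> Y \<in> VF \<Longrightarrow> J (lift X Y) = ver_deriv X (J Y)"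
  using vertical_ver_deriv[OF _ vertical_ver, of X Y]
  by (simp add: lift_eq J_simps J_hor vf_rules spray vertical_vf vertical_ver_deriv vertical_J vertical_lift)
    (simp add: vertical_def)

lemma ver_lift: "X \<in> VF \<Longrightarrow> Y \<in> VF \<Longrightarrow> v (lift X Y) = ver_deriv X (v Y)"
  by (simp add: lift_eq ver_add vf_hor_br ver_hor vf_rules spray vertical_vf vertical_ver_deriv vertical_J
      vertical_ver ver_vertical)

section \<open>Verification of the lift and torsion conditions\<close>

lemma linear_connection_lift: "linear_connection (slit_atlas A) lift"
  unfolding linear_connection_def
proof (intro conjI ballI allI impI)
  fix X Y assume X: "X \<in> VF" and Y: "Y \<in> VF"
  note vert = vertical_ver[OF Y] vertical_J[OF Y]
  show "lift X Y \<in> VF" using X Y by (rule vf_lift)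
  show "lift (X + X') Y = lift X Y + lift X' Y" if "X' \<in> VF" for X'
    using X Y that vert by (simp add: lift_eq vf_rules ver_deriv_add_left hor_br_add vertical_ver_deriv)
  show "lift X (Y + Y') = lift X Y + lift X Y'" if "Y' \<in> VF" for Y'
    using X Y that vert vertical_ver[OF that] vertical_J[OF that]
    by (simp add: lift_eq vf_rules ver_add J_simps ver_deriv_add_right hor_br_add vertical_ver_deriv)
  fix f assume f: "sm f"
  show "lift (fscale f X) Y = fscale f (lift X Y)"
    using X Y f vert by (simp add: lift_eq vf_rules ver_deriv_fscale_left hor_br_fscale vertical_ver_deriv fscale_add)
  have "fscale (dv X f) Y = fscale (dv X f) (v Y) + fscale (dv X f) (h Y)"
    by (simp add: hor_eq fscale_add[symmetric])
  then show "lift X (fscale f Y) = fscale (dv X f) Y + fscale f (lift X Y)"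
    using X Y f vert by (simp add: lift_eq vf_rules ver_fscale J_simps ver_deriv_fscale_right hor_br_add
        hor_br_fscale hor_lift vertical_ver_deriv vertical_fscale sm_rules fscale_add)
qed (auto simp: lift_def)

text \<open>D C = v is the identity on vertical fields, so the induced connection is I - 2 v =
  \<Gamma>.\<close>

lemma is_lift_lift: "is_lift A \<Gamma> lift"
proof -
  have DC: "DC A lift X = v X" if "X \<in> VF" for X
    using that by (simp add: DC_def lift_vertical vertical_C ver_deriv_C)
  have bij: "bij_betw (DC A lift) (vertical_fields A) (vertical_fields A)"
    by (rule bij_betw_cong[THEN iffD1, OF _ bij_betw_id])
      (simp add: vertical_fields_iff DC vertical_vf ver_vertical)
  have "inv_into (vertical_fields A) (DC A lift) (v X) = v X" if "X \<in> VF" for X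
    using inv_into_f_f[OF bij_betw_imp_inj_on[OF bij], of "v X"] that
    by (simp add: vertical_fields_iff vertical_ver DC vf_ver ver_ver)
  then have ind: "induced_connection A lift X = \<Gamma> X" if "X \<in> VF" for X
    using that by (simp add: induced_connection_def DC barthel_ver[symmetric])
  have pJ: "parallel_endo (slit_atlas A) lift J"
    by (simp add: parallel_endo_def cov_deriv_endo_def J_lift lift_vertical vertical_J)
  have "lift X (\<Gamma> Y) = \<Gamma> (lift X Y)" if "X \<in> VF" "Y \<in> VF" for X Y
  proof (rule split_eqI)
    have v\<Gamma>: "v (\<Gamma> Z) = - v Z" if "Z \<in> VF" for Z
      using that by (simp add: barthel_ver ver_diff ver_fscale ver_ver vf_rules vf_ver sm_const)
        (simp add: fscale_def fun_eq_iff scaleR_2)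
    have neg: "ver_deriv X (- V) = - ver_deriv X V" if "vertical V" for V
      using ver_deriv_add_right[OF \<open>X \<in> VF\<close> that, of "- V"] vertical_diff[OF vertical_zero that] ver_deriv_zero[OF \<open>X \<in> VF\<close>]
      by (simp add: eq_neg_iff_add_eq_0 add.commute)
    show "J (lift X (\<Gamma> Y)) = J (\<Gamma> (lift X Y))"
      using that by (simp add: J_lift J_barthel vf_barthel vf_lift)
    show "v (lift X (\<Gamma> Y)) = v (\<Gamma> (lift X Y))"
      using that by (simp add: ver_lift v\<Gamma> vf_barthel vf_lift neg vertical_ver)
  qed (use that in \<open>simp_all add: vf_lift vf_barthel\<close>)
  then have "parallel_endo (slit_atlas A) lift (induced_connection A lift)"
    by (simp add: parallel_endo_def cov_deriv_endo_def ind vf_lift)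
  moreover have "\<forall>X\<in>VF. DC A lift (J X) = J X"
    by (simp add: DC vf_rules ver_vertical vertical_J)
  ultimately show ?thesis
    using linear_connection_lift pJ bij ind
    by (simp add: is_lift_def reducible_connection_def regular_connection_def projects_onto_def
        almost_projectable_def)
qed

lemma finsler_metric_eq:
  "X \<in> VF \<Longrightarrow> Y \<in> VF \<Longrightarrow> q \<in> Q \<Longrightarrow> finsler_metric A E X Y q = G (J X) (J Y) q + G (v X) (v Y) q"
  by (simp add: finsler_metric_def vertical_metric_eq vertical_J vertical_ver)

lemma dv_finsler_metric:
  assumes "X \<in> VF" "Y \<in> VF" "Z \<in> VF" "q \<in> Q"
  shows "dv Z (finsler_metric A E X Y) q = dv Z (G (J X) (J Y)) q + dv Z (G (v X) (v Y)) q"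
proof -
  have "dv Z (\<lambda>q. G (J X) (J Y) q + G (v X) (v Y) q) q = dv Z (finsler_metric A E X Y) q"
    by (rule dv_cong) (use assms in \<open>simp_all add: finsler_metric_eq sm_intros sm_G vertical_J vertical_ver\<close>)
  then show ?thesis
    using assms by (simp add: dv_add sm_G vertical_J vertical_ver)
qed

text \<open>Applying \<open>J\<close> or \<open>v\<close> to a derivative differentiates the
  corresponding vertical part, so both summands of the metric reduce to
  \<open>LC_metric\<close>.\<close>

lemma vertically_metric_lift: "vertically_metric A E lift"
  by (simp add: vertically_metric_def cov_deriv_form_def dv_finsler_metric finsler_metric_eq vf_rules vf_lift
      J_lift ver_lift ver_deriv_vertical vertical_J vertical_ver LC_metric)

lemma torsion_lift_vertical: "X \<in> VF \<Longrightarrow> Y \<in> VF \<Longrightarrow> torsion (slit_atlas A) lift (J X) (J Y) = 0"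
  by (simp add: torsion_def lift_vertical vf_rules vertical_J ver_deriv_vertical LC_torsion_free)

text \<open>Differentiating h X keeps it horizontal, so \<open>v\<close> annihilates that term, and
  the other two cancel.\<close>

lemma torsion_lift_mixed: "X \<in> VF \<Longrightarrow> Y \<in> VF \<Longrightarrow> v (torsion (slit_atlas A) lift (h X) (J Y)) = 0"
  using ver_deriv_zero[OF vf_J, of Y]
  by (simp add: torsion_def ver_diff vf_lift vf_rules vf_hor ver_lift ver_hor ver_vertical vertical_J ver_deriv_hor
      ver_ver)

subsection \<open>Uniqueness\<close>

definition admissible :: "('p, real^'n) tconn \<Rightarrow> bool" where
  "admissible D \<longleftrightarrow> is_lift A \<Gamma> D \<and> vertically_metric A E D \<and>
    (\<forall>\<zeta>\<in>VF. \<forall>\<eta>\<in>VF. torsion (slit_atlas A) D (J \<zeta>) (J \<eta>) = 0) \<and>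
    (\<forall>\<zeta>\<in>VF. \<forall>\<eta>\<in>VF. v (torsion (slit_atlas A) D (h \<zeta>) (J \<eta>)) = 0)"

lemma admissible_linear: "admissible D \<Longrightarrow> linear_connection (slit_atlas A) D"
  by (simp add: admissible_def is_lift_def reducible_connection_def regular_connection_def)

context
  fixes D assumes adm: "admissible D"
begin

lemma D_vf: "X \<in> VF \<Longrightarrow> Y \<in> VF \<Longrightarrow> D X Y \<in> VF"
  using admissible_linear[OF adm] by (simp add: linear_connection_def)

lemma D_outside: "X \<notin> VF \<or> Y \<notin> VF \<Longrightarrow> D X Y = 0"
  using admissible_linear[OF adm] by (simp add: linear_connection_def)

lemma D_add_left: "X \<in> VF \<Longrightarrow> X' \<in> VF \<Longrightarrow> Y \<in> VF \<Longrightarrow> D (X + X') Y = D X Y + D X' Y"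
  using admissible_linear[OF adm] by (simp add: linear_connection_def)

lemma D_add_right: "X \<in> VF \<Longrightarrow> Y \<in> VF \<Longrightarrow> Y' \<in> VF \<Longrightarrow> D X (Y + Y') = D X Y + D X Y'"
  using admissible_linear[OF adm] by (simp add: linear_connection_def)

lemma D_cscale:
  assumes "X \<in> VF" "Y \<in> VF"
  shows "D X (fscale (\<lambda>_. c) Y) = fscale (\<lambda>_. c) (D X Y)"
proof -
  have "fscale (dv X (\<lambda>_. c)) Y = fscale (\<lambda>_. 0) Y"
    by (rule fscale_cong) (use assms in \<open>simp_all add: dv_const\<close>)
  moreover have "D X (fscale (\<lambda>_. c) Y) = fscale (dv X (\<lambda>_. c)) Y + fscale (\<lambda>_. c) (D X Y)"
    using admissible_linear[OF adm] assms sm_const unfolding linear_connection_def by blast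
  ultimately show ?thesis by (simp add: fscale_def fun_eq_iff)
qed

lemma D_zero: "X \<in> VF \<Longrightarrow> D X 0 = 0"
  using D_add_right[OF _ vf_zero vf_zero, of X] by simp

lemma D_diff:
  assumes "X \<in> VF" "Y \<in> VF" "Y' \<in> VF"
  shows "D X (Y - Y') = D X Y - D X Y'"
  using D_add_right[of X "Y - Y'" Y'] assms by (simp add: vf_rules)

lemma D_J:
  assumes "X \<in> VF" "Y \<in> VF"
  shows "D X (J Y) = J (D X Y)"
proof -
  have "parallel_endo (slit_atlas A) D J"
    using adm by (simp add: admissible_def is_lift_def reducible_connection_def regular_connection_def)
  then have "D X (J Y) - J (D X Y) = 0"
    using assms unfolding parallel_endo_def cov_deriv_endo_def by blast
  then show ?thesis by simp
qed

lemma D_ver: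
  assumes "X \<in> VF" "Y \<in> VF"
  shows "D X (v Y) = v (D X Y)"
proof -
  have ind: "induced_connection A D Z = \<Gamma> Z" if "Z \<in> VF" for Z
    using adm that by (simp add: admissible_def is_lift_def projects_onto_def)
  have "parallel_endo (slit_atlas A) D (induced_connection A D)"
    using adm by (simp add: admissible_def is_lift_def reducible_connection_def)
  then have "D X (induced_connection A D Y) - induced_connection A D (D X Y) = 0"
    using assms unfolding parallel_endo_def cov_deriv_endo_def by blast
  then have "D X (\<Gamma> Y) = \<Gamma> (D X Y)" using assms by (simp add: ind D_vf)
  then show ?thesis
    using assms by (simp add: ver_eq D_cscale D_diff vf_rules vf_barthel)
qed

lemma D_vertical: "X \<in> VF \<Longrightarrow> vertical V \<Longrightarrow> vertical (D X V)"
  using D_J[of X V] D_zero[of X] by (simp add: vertical_def D_vf)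

lemma D_torsion:
  assumes "vertical V" "vertical W" shows "D V W - D W V = br V W"
proof -
  obtain X Y where "X \<in> VF" "V = J X" "Y \<in> VF" "W = J Y"
    using assms vertical_obtain by metis
  then have "D V W - D W V - br V W = 0"
    using adm unfolding admissible_def torsion_def by blast
  then show ?thesis by simp
qed

text \<open>\<open>D\<close> commutes with \<open>v\<close>, hence the term D_V (h X) of the torsion
  is horizontal and (c) leaves only D_(h X) V and the bracket.\<close>

lemma D_mixed:
  assumes X: "X \<in> VF" and V: "vertical V"
  shows "D (h X) V = v (br (h X) V)"
proof -
  obtain Y where Y: "Y \<in> VF" "V = J Y" using vertical_obtain[OF V] .
  have "v (D (h X) V - D V (h X) - br (h X) V) = 0"
    using adm X Y unfolding admissible_def torsion_def by blast
  moreover have "v (D V (h X)) = 0"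
    using D_ver[of V "h X"] X V by (simp add: vertical_vf vf_hor ver_hor D_zero)
  ultimately show ?thesis
    using X V by (simp add: ver_diff vf_rules D_vf vf_hor vertical_vf ver_vertical D_vertical)
qed

lemma D_metric:
  assumes V: "vertical V" and W: "vertical W" and U: "vertical U" and q: "q \<in> Q"
  shows "dv V (G W U) q = G (D V W) U q + G W (D V U) q"
proof -
  obtain X where X: "X \<in> VF" "V = J X" using vertical_obtain[OF V] .
  note vf = vertical_vf[OF V] vertical_vf[OF W] vertical_vf[OF U]
  have J0: "J W = 0" "J U = 0" "J (D V W) = 0" "J (D V U) = 0"
    using W U D_vertical[OF vf(1)] by (simp_all add: vertical_def)
  \<comment> \<open>The \<open>J\<close>-summand of the metric becomes \<open>G 0 0\<close> on
    vertical arguments; additivity in 0 + 0 shows that its derivative vanishes.\<close>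
  have "dv V (G 0 0) q = 0"
    using dv_G_left(1)[of 0 0 0 V q] vf q by (simp add: vertical_zero)
  moreover have "cov_deriv_form (slit_atlas A) D V (finsler_metric A E) W U q = 0"
    using adm X vf q unfolding admissible_def vertically_metric_def by blast
  ultimately show ?thesis
    using vf q W U V by (simp add: cov_deriv_form_def dv_finsler_metric finsler_metric_eq D_vf J0 ver_vertical
        D_vertical G_left(4) vertical_zero)
qed

end

lemma admissible_unique_vertical:
  assumes D: "admissible D" and D': "admissible D'" and V: "vertical V" and W: "vertical W"
  shows "D V W = D' V W"
proof -
  \<comment> \<open>The difference of the two connections, lowered by \<open>G\<close>: torsion
    gives symmetry in the first two slots, metricity skewness in the last two.\<close>
  define T where "T V W U q = G (D V W) U q - G (D' V W) U q" for V W U q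
  note vert = D_vertical[OF D vertical_vf] D_vertical[OF D' vertical_vf]
  have sym: "T V W U q = T W V U q" if "vertical V" "vertical W" "vertical U" "q \<in> Q" for V W U q
  proof -
    have "D V W + D' W V = D W V + D' V W"
      using D_torsion[OF D that(1,2)] D_torsion[OF D' that(1,2)] by (simp add: algebra_simps)
    then have "G (D V W + D' W V) U q = G (D W V + D' V W) U q" by simp
    then show ?thesis using that by (simp add: T_def G_left vert)
  qed
  have skew: "T V W U q = - T V U W q" if "vertical V" "vertical W" "vertical U" "q \<in> Q" for V W U q
    using D_metric[OF D that] D_metric[OF D' that] that
    by (simp add: T_def G_sym[of W] vert)
  \<comment> \<open>A trilinear form that is symmetric in two slots and skew in another two vanishes.\<close>
  have "T V W U q = 0" if U: "vertical U" "q \<in> Q" for U q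
    using sym[of V W U q] skew[of W V U q] sym[of W U V q] skew[of U W V q] sym[of U V W q] skew[of V U W q]
      V W U by simp
  then show ?thesis
    using V W by (intro G_eqI) (auto simp: T_def vert)
qed

lemma admissible_unique:
  assumes D: "admissible D" and D': "admissible D'"
  shows "D = D'"
proof -
  have vert: "D X V = D' X V" if X: "X \<in> VF" and V: "vertical V" for X V
  proof -
    have "D (h X + v X) V = D' (h X + v X) V"
      using X V admissible_unique_vertical[OF D D' vertical_ver[OF X] V]
      by (simp add: D_add_left[OF D] D_add_left[OF D'] D_mixed[OF D] D_mixed[OF D'] vf_hor vf_ver vertical_vf)
    then show ?thesis by (simp add: hor_eq)
  qed
  \<comment> \<open>Both parts of \<open>D X Y\<close> are derivatives of vertical fields, namely of
    \<open>J Y\<close> and \<open>v Y\<close>.\<close>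
  have eq: "D X Y = D' X Y" if X: "X \<in> VF" and Y: "Y \<in> VF" for X Y
    by (rule split_eqI)
      (use X Y vert[OF X vertical_J[OF Y]] vert[OF X vertical_ver[OF Y]] in
        \<open>simp_all add: D_vf[OF D] D_vf[OF D'] D_J[OF D] D_J[OF D'] D_ver[OF D] D_ver[OF D']\<close>)
  have "D X Y = D' X Y" if "X \<notin> VF \<or> Y \<notin> VF" for X Y
    using D_outside[OF D that] D_outside[OF D' that] by simp
  then show ?thesis using eq by (metis ext)
qed

end

theorem theorem4p8:
  fixes M :: "'p topology"
    and A :: "('p, real ^ 'n) atlas"
    and E :: "('p, real ^ 'n) tpoint \<Rightarrow> real"
    and \<Gamma> :: "('p, real ^ 'n) tfield \<Rightarrow> ('p, real ^ 'n) tfield"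
  assumes "finsler_manifold M A E"
    and "\<Gamma> = barthel A E"
  shows "\<exists>!D. is_lift A \<Gamma> D \<and>
    vertically_metric A E D \<and>
    (\<forall>\<zeta>\<in>slit_fields A. \<forall>\<eta>\<in>slit_fields A.
       torsion (slit_atlas A) D (J \<zeta>) (J \<eta>) = 0) \<and>
    (\<forall>\<zeta>\<in>slit_fields A. \<forall>\<eta>\<in>slit_fields A.
       ver \<Gamma> (torsion (slit_atlas A) D (hor \<Gamma> \<zeta>) (J \<eta>)) = 0)"
proof -
  interpret finsler M A E using assms(1) by unfold_locales
  have "admissible lift"
    unfolding admissible_def
    using is_lift_lift vertically_metric_lift torsion_lift_vertical torsion_lift_mixed by blast
  then have "\<exists>!D. admissible D" using admissible_unique by blast
  then show ?thesis unfolding admissible_def assms(2) .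
qed

end
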